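(* Let $(\Omega,\mathscr{A},\mu)$ be a probability space with a filtration $\mathscr{A}_1\subset\mathscr{A}_2\subset\cdots\subset\mathscr{A}$ of sub-$\sigma$-algebras whose union generates $\mathscr{A}$. Let $\{a_n\}_{n\ge 0}$ be a strictly increasing real sequence with $a_0=0$ and $\lim_{n\to\infty}a_n=1$, and let $$T=\sum_{n=1}^{\infty}(a_n-a_{n-1})E_n .$$ For $t>0$ let $T^t$ be the operator obtained from the positive selfadjoint contraction $T$ on $L_2(\Omega,\mathscr{A},\mu)$ by continuous functional calculus. Then for every $t>0$ $$T^t=\sum_{n=1}^{\infty}(1-a_{n-1})^t\,dE_n=\sum_{n=1}^{\infty}\left[(1-a_{n-1})^t-(1-a_n)^t\right]E_n ,$$ and $T^t$ is a positive contraction on $L_p(\Omega,\mathscr{A},\mu)$ for every $t>0$ and every $1\le p\le\infty$. Moreover, $\{T^t\}_{t>0}$ is a symmetric diffusion semigroup on $(\Omega,\mathscr{A},\mu)$.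
   Context: For $f\in L_1(\Omega,\mathscr{A},\mu)$ and $n\ge 1$: $E_n(f)=E(f\mid\mathscr{A}_n)$ is the conditional expectation, $E_0=0$ by convention, and $dE_n(f)=E_n(f)-E_{n-1}(f)$. "Positive" for an operator on $L_p$ means positivity preserving. The operator $T^t$, initially given on $L_2$, acts on $L_p$, $1\le p\le\infty$, through the series $\sum_{n\ge1}[(1-a_{n-1})^t-(1-a_n)^t]E_n$. Symmetric diffusion semigroup: a family $\{\mathsf{T}_t\}_{t>0}$ of operators on a $\sigma$-finite measure space $(\Omega,\mathscr{A},\mu)$ such that (a) $\mathsf{T}_t$ is a contraction on $L_p(\Omega)$ for every $1\le p\le\infty$; (b) $\mathsf{T}_t\mathsf{T}_s=\mathsf{T}_{t+s}$ for all $t,s>0$; (c) $\lim_{t\to0^+}\mathsf{T}_t(f)=f$ in $L_2(\Omega)$ for every $f\in L_2(\Omega)$; (d) $\mathsf{T}_t$ is positive (positivity preserving); (e) $\mathsf{T}_t$ is selfadjoint on $L_2(\Omega)$; (f) $\mathsf{T}_t(1)=1$. *)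

theory Defs
  imports
    "HOL-Probability.Probability"
    "HOL-Library.Nonpos_Ints"
    "HOL-Computational_Algebra.Polynomial"
begin

text \<open>
  Scalars are complex. An element of \<open>L\<^sub>p\<close> is represented by a measurable function, and an
  operator by a map on functions; equality in \<open>L\<^sub>p\<close> is equality almost everywhere.
  One map may act on several \<open>L\<^sub>p\<close> spaces at once, and its values outside the
  spaces under consideration are irrelevant.
\<close>

subsection \<open>\<open>L\<^sub>p\<close> spaces\<close>

definition Lp :: "'a measure \<Rightarrow> ennreal \<Rightarrow> ('a \<Rightarrow> complex) set" where
  "Lp M p = {f \<in> borel_measurable M.
     if p = \<infinity> then esssup M (\<lambda>x. ennreal (norm (f x))) < \<infinity>
     else integrable M (\<lambda>x. norm (f x) powr enn2real p)}"

definition Lp_norm :: "'a measure \<Rightarrow> ennreal \<Rightarrow> ('a \<Rightarrow> complex) \<Rightarrow> real" where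
  "Lp_norm M p f =
     (if p = \<infinity> then enn2real (esssup M (\<lambda>x. ennreal (norm (f x))))
      else (\<integral>x. norm (f x) powr enn2real p \<partial>M) powr (1 / enn2real p))"

definition L2_inner :: "'a measure \<Rightarrow> ('a \<Rightarrow> complex) \<Rightarrow> ('a \<Rightarrow> complex) \<Rightarrow> complex" where
  "L2_inner M f g = (\<integral>x. f x * cnj (g x) \<partial>M)"

subsection \<open>Operators on \<open>L\<^sub>p\<close>\<close>

type_synonym 'a operator = "('a \<Rightarrow> complex) \<Rightarrow> ('a \<Rightarrow> complex)"

definition Lp_bounded_op :: "'a measure \<Rightarrow> ennreal \<Rightarrow> 'a operator \<Rightarrow> bool" where
  "Lp_bounded_op M p S \<longleftrightarrow>
     (\<forall>f\<in>Lp M p. S f \<in> Lp M p) \<and>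
     (\<forall>f\<in>Lp M p. \<forall>g\<in>Lp M p. (AE x in M. f x = g x) \<longrightarrow> (AE x in M. S f x = S g x)) \<and>
     (\<forall>f\<in>Lp M p. \<forall>g\<in>Lp M p. AE x in M. S (\<lambda>y. f y + g y) x = S f x + S g x) \<and>
     (\<forall>f\<in>Lp M p. \<forall>c. AE x in M. S (\<lambda>y. c * f y) x = c * S f x) \<and>
     (\<exists>K. \<forall>f\<in>Lp M p. Lp_norm M p (S f) \<le> K * Lp_norm M p f)"

definition Lp_contraction :: "'a measure \<Rightarrow> ennreal \<Rightarrow> 'a operator \<Rightarrow> bool" where
  "Lp_contraction M p S \<longleftrightarrow>
     Lp_bounded_op M p S \<and> (\<forall>f\<in>Lp M p. Lp_norm M p (S f) \<le> Lp_norm M p f)"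

definition Lp_positivity_preserving :: "'a measure \<Rightarrow> ennreal \<Rightarrow> 'a operator \<Rightarrow> bool" where
  "Lp_positivity_preserving M p S \<longleftrightarrow>
     (\<forall>f\<in>Lp M p. (AE x in M. f x \<in> \<real>\<^sub>\<ge>\<^sub>0) \<longrightarrow> (AE x in M. S f x \<in> \<real>\<^sub>\<ge>\<^sub>0))"

definition L2_selfadjoint :: "'a measure \<Rightarrow> 'a operator \<Rightarrow> bool" where
  "L2_selfadjoint M S \<longleftrightarrow>
     Lp_bounded_op M 2 S \<and>
     (\<forall>f\<in>Lp M 2. \<forall>g\<in>Lp M 2. L2_inner M (S f) g = L2_inner M f (S g))"

text \<open>Positivity in the Hilbert space sense, as opposed to positivity preservation.\<close>

definition L2_nonneg_form :: "'a measure \<Rightarrow> 'a operator \<Rightarrow> bool" where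
  "L2_nonneg_form M S \<longleftrightarrow> (\<forall>f\<in>Lp M 2. L2_inner M (S f) f \<in> \<real>\<^sub>\<ge>\<^sub>0)"

text \<open>Convergence in the operator norm of \<open>L\<^sub>p\<close>.\<close>

definition Lp_op_tendsto ::
    "'a measure \<Rightarrow> ennreal \<Rightarrow> (nat \<Rightarrow> 'a operator) \<Rightarrow> 'a operator \<Rightarrow> bool" where
  "Lp_op_tendsto M p U S \<longleftrightarrow>
     (\<forall>n. Lp_bounded_op M p (U n)) \<and> Lp_bounded_op M p S \<and>
     (\<forall>\<epsilon>>0. \<exists>N. \<forall>n\<ge>N. \<forall>f\<in>Lp M p.
        Lp_norm M p (\<lambda>x. U n f x - S f x) \<le> \<epsilon> * Lp_norm M p f)"

text \<open>All series are indexed from 1.\<close>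

definition Lp_op_sums ::
    "'a measure \<Rightarrow> ennreal \<Rightarrow> (nat \<Rightarrow> 'a operator) \<Rightarrow> 'a operator \<Rightarrow> bool" where
  "Lp_op_sums M p U S \<longleftrightarrow> Lp_op_tendsto M p (\<lambda>N f x. \<Sum>n=1..N. U n f x) S"

definition Lp_suminf ::
    "'a measure \<Rightarrow> ennreal \<Rightarrow> (nat \<Rightarrow> 'a \<Rightarrow> complex) \<Rightarrow> ('a \<Rightarrow> complex)" where
  "Lp_suminf M p u =
     (SOME h. h \<in> Lp M p \<and> (\<forall>n\<ge>1. u n \<in> Lp M p) \<and>
        (\<lambda>N. Lp_norm M p (\<lambda>x. (\<Sum>n=1..N. u n x) - h x)) \<longlonglongrightarrow> 0)"

subsection \<open>Continuous functional calculus on \<open>L\<^sub>2\<close>\<close>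

definition L2_spectrum :: "'a measure \<Rightarrow> 'a operator \<Rightarrow> complex set" where
  "L2_spectrum M S =
     {z. \<not> (\<exists>R. Lp_bounded_op M 2 R \<and>
          (\<forall>f\<in>Lp M 2. (AE x in M. R (\<lambda>y. S f y - z * f y) x = f x) \<and>
                      (AE x in M. S (R f) x - z * R f x = f x)))}"

definition op_poly :: "complex poly \<Rightarrow> 'a operator \<Rightarrow> 'a operator" where
  "op_poly q S f = (\<lambda>x. \<Sum>i\<le>degree q. coeff q i * (S ^^ i) f x)"

text \<open>
  For selfadjoint \<open>S\<close> and \<open>\<phi>\<close> continuous on the spectrum, \<open>\<phi>(S)\<close> is the operator norm limit of
  \<open>q\<^sub>n(S)\<close>, where \<open>q\<^sub>n\<close> are polynomials converging to \<open>\<phi>\<close> uniformly on the spectrum. By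
  \<open>\<parallel>q(S)\<parallel> = sup \<bar>q\<bar>\<close> over the spectrum it does not depend on the choice of \<open>q\<^sub>n\<close>.
\<close>

definition is_fun_calc ::
    "'a measure \<Rightarrow> 'a operator \<Rightarrow> (complex \<Rightarrow> complex) \<Rightarrow> 'a operator \<Rightarrow> bool" where
  "is_fun_calc M S \<phi> R \<longleftrightarrow>
     L2_selfadjoint M S \<and> continuous_on (L2_spectrum M S) \<phi> \<and>
     (\<exists>q. uniform_limit (L2_spectrum M S) (\<lambda>n. poly (q n)) \<phi> sequentially \<and>
          Lp_op_tendsto M 2 (\<lambda>n. op_poly (q n) S) R)"

definition fun_calc ::
    "'a measure \<Rightarrow> 'a operator \<Rightarrow> (complex \<Rightarrow> complex) \<Rightarrow> 'a operator" where
  "fun_calc M S \<phi> = (SOME R. is_fun_calc M S \<phi> R)"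

subsection \<open>Symmetric diffusion semigroups\<close>

text \<open>Only the values of \<open>P\<close> at positive times matter.\<close>

definition symmetric_diffusion_semigroup :: "'a measure \<Rightarrow> (real \<Rightarrow> 'a operator) \<Rightarrow> bool" where
  "symmetric_diffusion_semigroup M P \<longleftrightarrow>
     sigma_finite_measure M \<and>
     (\<forall>t>0. \<forall>p\<ge>1. Lp_contraction M p (P t)) \<and>
     (\<forall>t>0. \<forall>s>0. \<forall>p\<ge>1. \<forall>f\<in>Lp M p. AE x in M. P t (P s f) x = P (t + s) f x) \<and>
     (\<forall>f\<in>Lp M 2. ((\<lambda>t. Lp_norm M 2 (\<lambda>x. P t f x - f x)) \<longlongrightarrow> 0) (at_right 0)) \<and>
     (\<forall>t>0. \<forall>p\<ge>1. Lp_positivity_preserving M p (P t)) \<and>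
     (\<forall>t>0. L2_selfadjoint M (P t)) \<and>
     (\<forall>t>0. AE x in M. P t (\<lambda>_. 1) x = 1)"

subsection \<open>The averaging operator of a filtration\<close>

definition cexp :: "'a measure \<Rightarrow> (nat \<Rightarrow> 'a measure) \<Rightarrow> nat \<Rightarrow> 'a operator" where
  "cexp M \<A> n f =
     (if n = 0 then (\<lambda>_. 0)
      else (\<lambda>x. Complex (real_cond_exp M (\<A> n) (\<lambda>y. Re (f y)) x)
                        (real_cond_exp M (\<A> n) (\<lambda>y. Im (f y)) x)))"

definition dcexp :: "'a measure \<Rightarrow> (nat \<Rightarrow> 'a measure) \<Rightarrow> nat \<Rightarrow> 'a operator" where
  "dcexp M \<A> n f = (\<lambda>x. cexp M \<A> n f x - cexp M \<A> (n - 1) f x)"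

definition avg_op :: "'a measure \<Rightarrow> (nat \<Rightarrow> 'a measure) \<Rightarrow> (nat \<Rightarrow> real) \<Rightarrow> 'a operator" where
  "avg_op M \<A> a f =
     Lp_suminf M 2 (\<lambda>n x. complex_of_real (a n - a (n - 1)) * cexp M \<A> n f x)"

text \<open>The power \<open>T\<^sup>t\<close> as an operator on \<open>L\<^sub>2\<close>. Note that complex \<open>powr\<close> agrees with the real
  power on the nonnegative reals, including \<open>0 powr t = 0\<close> for \<open>t > 0\<close>.\<close>

definition avg_pow ::
    "'a measure \<Rightarrow> (nat \<Rightarrow> 'a measure) \<Rightarrow> (nat \<Rightarrow> real) \<Rightarrow> real \<Rightarrow> 'a operator" where
  "avg_pow M \<A> a t = fun_calc M (avg_op M \<A> a) (\<lambda>z. z powr complex_of_real t)"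

definition pow_weight :: "(nat \<Rightarrow> real) \<Rightarrow> real \<Rightarrow> nat \<Rightarrow> real" where
  "pow_weight a t n = (1 - a (n - 1)) powr t - (1 - a n) powr t"

text \<open>The action of \<open>T\<^sup>t\<close> on the scale of \<open>L\<^sub>p\<close> spaces through its series. On a probability space
  \<open>L\<^sub>p \<subseteq> L\<^sub>1\<close> for all \<open>p \<ge> 1\<close>, so the sum is taken in \<open>L\<^sub>1\<close>, the largest space of the scale.\<close>

definition avg_pow_ext ::
    "'a measure \<Rightarrow> (nat \<Rightarrow> 'a measure) \<Rightarrow> (nat \<Rightarrow> real) \<Rightarrow> real \<Rightarrow> 'a operator" where
  "avg_pow_ext M \<A> a t f =
     Lp_suminf M 1 (\<lambda>n x. complex_of_real (pow_weight a t n) * cexp M \<A> n f x)"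

end

theory Submission
  imports Defs
begin

text \<open>
  Summation by parts turns \<open>\<Sum>\<^sub>n c\<^sub>n dE\<^sub>n\<close> into \<open>lim c + \<Sum>\<^sub>n (c\<^sub>n - c\<^sub>n\<^sub>+\<^sub>1) E\<^sub>n\<close>, which for a symbol \<open>c\<close> of
  bounded variation converges absolutely on every \<open>L\<^sub>p\<close>, since the \<open>E\<^sub>n\<close> are contractions. Because
  \<open>E\<^sub>m E\<^sub>n = E\<^bsub>min m n\<^esub>\<close>, these operators multiply like their symbols. The operator \<open>T\<close> has the symbol
  \<open>\<lambda>\<^sub>n = 1 - a\<^sub>n\<^sub>-\<^sub>1\<close>, a polynomial \<open>q(T)\<close> has the symbol \<open>q(\<lambda>\<^sub>n)\<close>, and the resolvent at \<open>z\<close> has the symbol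
  \<open>1 / (\<lambda>\<^sub>n - z)\<close>, so the spectrum of \<open>T\<close> lies in \<open>[0, 1]\<close>.

  On \<open>L\<^sub>2\<close> the \<open>dE\<^sub>n\<close> are orthogonal projections with sum the identity, because the filtration generates
  the whole \<open>\<sigma>\<close>-algebra. Hence the norm of such an operator is at most the supremum of \<open>|c\<^sub>n|\<close> over the
  \<open>n\<close> with \<open>dE\<^sub>n \<noteq> 0\<close>, and for these \<open>n\<close> the number \<open>\<lambda>\<^sub>n\<close> is an eigenvalue of \<open>T\<close>. So uniform convergence
  of polynomials on the spectrum forces norm convergence, and \<open>T\<^sup>t\<close> has the symbol \<open>\<lambda>\<^sub>n\<^sup>t\<close>. This symbol
  decreases from 1 to 0: the coefficients of the \<open>E\<^sub>n\<close> in \<open>T\<^sup>t\<close> are nonnegative with sum 1, and \<open>T\<^sup>t\<close>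
  inherits contractivity, positivity and \<open>T\<^sup>t 1 = 1\<close> from the conditional expectations.
\<close>

text \<open>Two estimates of different strength are at work. The absolute series bounds an operator
  by the total variation of its symbol, for all p alike, but uniform convergence of polynomials on
  the spectrum does not control their variation along the sequence of symbol values. The functional
  calculus therefore needs the supremum bound, which orthogonality gives on L_2 only. That supremum
  has to skip the n with \<open>dE_n = 0\<close>: where the filtration pauses,
  \<open>1 - a (n - 1)\<close> need not lie in the spectrum, and nothing is known there about the
  polynomials. On the part of L_2 orthogonal to all differences an operator with symbol c would act
  as multiplication by lim c; generation makes this part trivial. Finally, sums and powers are
  defined by choosing a limit, so for each chosen operator both existence and uniqueness almost
  everywhere have to be shown before its coefficients are known.\<close>

section \<open>Convexity of powers\<close>

text \<open>If one argument is 0, the inequality reduces to \<open>s powr p \<le> s\<close> on (0,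
  1); otherwise the triangle inequality and monotonicity leave convexity of the power on the
  positive half-line.\<close>

lemma convex_on_abs_powr:
  fixes p :: real
  assumes "p \<ge> 1"
  shows "convex_on UNIV (\<lambda>x::real. \<bar>x\<bar> powr p)"
proof (rule convex_onI)
  fix t x y :: real
  assume t: "0 < t" "t < 1"
  have pow_le: "s powr p \<le> s" if "0 < s" "s < 1" for s :: real
    using powr_mono'[of 1 p s] that assms by simp
  have "\<bar>(1 - t) *\<^sub>R x + t *\<^sub>R y\<bar> \<le> \<bar>(1 - t) * x\<bar> + \<bar>t * y\<bar>"
    using abs_triangle_ineq[of "(1 - t) * x" "t * y"] by simp
  also have "\<dots> = (1 - t) * \<bar>x\<bar> + t * \<bar>y\<bar>"
    using t by (simp add: abs_mult)
  finally have "\<bar>(1 - t) *\<^sub>R x + t *\<^sub>R y\<bar> powr p \<le> ((1 - t) * \<bar>x\<bar> + t * \<bar>y\<bar>) powr p"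
    using assms by (intro powr_mono2) auto
  also have "\<dots> \<le> (1 - t) * \<bar>x\<bar> powr p + t * \<bar>y\<bar> powr p"
  proof (cases "x = 0 \<or> y = 0")
    case True
    then show ?thesis
      using pow_le[of t] pow_le[of "1 - t"] t
      by (auto simp: powr_mult intro!: mult_right_mono)
  next
    case False
    then show ?thesis
      using convex_onD[OF powr_convex[OF assms], of t "\<bar>x\<bar>" "\<bar>y\<bar>"] t by simp
  qed
  finally show "\<bar>(1 - t) *\<^sub>R x + t *\<^sub>R y\<bar> powr p \<le> (1 - t) * \<bar>x\<bar> powr p + t * \<bar>y\<bar> powr p" .
qed simp

text \<open>Jensen for the weights divided by their sum W; clearing the denominators leaves the
  factor \<open>W powr (p - 1)\<close>.\<close>

lemma weighted_sum_powr_le: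
  fixes w y :: "'i \<Rightarrow> real"
  assumes "finite I" and w: "\<And>i. i \<in> I \<Longrightarrow> w i \<ge> 0" and y: "\<And>i. i \<in> I \<Longrightarrow> y i \<ge> 0" and p: "p \<ge> 1"
  shows "(\<Sum>i\<in>I. w i * y i) powr p \<le> (\<Sum>i\<in>I. w i) powr (p - 1) * (\<Sum>i\<in>I. w i * y i powr p)"
proof (cases "(\<Sum>i\<in>I. w i) = 0")
  case True
  then have "\<And>i. i \<in> I \<Longrightarrow> w i = 0"
    using sum_nonneg_eq_0_iff[OF \<open>finite I\<close> w] by auto
  then show ?thesis by simp
next
  case False
  define W where "W = (\<Sum>i\<in>I. w i)"
  have W: "W > 0"
    using False sum_nonneg[of I w] w by (simp add: W_def order_less_le)
  have "I \<noteq> {}" using False by auto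
  have "(\<Sum>i\<in>I. w i / W) = 1"
    using W by (simp flip: sum_divide_distrib W_def)
  then have "\<bar>\<Sum>i\<in>I. (w i / W) *\<^sub>R y i\<bar> powr p \<le> (\<Sum>i\<in>I. w i / W * \<bar>y i\<bar> powr p)"
    using W w by (intro convex_on_sum[OF \<open>finite I\<close> \<open>I \<noteq> {}\<close> convex_on_abs_powr[OF p]]) auto
  moreover have "(\<Sum>i\<in>I. (w i / W) *\<^sub>R y i) = (\<Sum>i\<in>I. w i * y i) / W"
    by (simp add: sum_divide_distrib)
  moreover have "(\<Sum>i\<in>I. w i / W * \<bar>y i\<bar> powr p) = (\<Sum>i\<in>I. w i * y i powr p) / W"
    using y by (simp add: sum_divide_distrib)
  moreover have "0 \<le> (\<Sum>i\<in>I. w i * y i)"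
    using w y by (intro sum_nonneg) auto
  ultimately have "(\<Sum>i\<in>I. w i * y i) powr p / W powr p \<le> (\<Sum>i\<in>I. w i * y i powr p) / W"
    using W by (simp add: powr_divide)
  then show ?thesis
    using W by (simp add: powr_diff field_simps flip: W_def)
qed

subsection \<open>\<open>L\<^sub>p\<close> spaces\<close>

lemma measurable_cnj [measurable (raw)]:
  assumes "f \<in> borel_measurable M"
  shows "(\<lambda>x. cnj (f x)) \<in> borel_measurable M"
  using assms by (simp add: borel_measurable_complex_iff)

lemma exponent_cases:
  fixes p :: ennreal
  assumes "p \<ge> 1"
  obtains (infinity) "p = \<infinity>" | (finite) r where "p = ennreal r" "r \<ge> 1"
proof (cases p)
  case (real r)
  then show ?thesis using assms finite[of r] by (simp add: ennreal_le_iff2 flip: ennreal_1)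
qed (simp add: infinity)

lemma one_le_two_ennreal [simp]: "(1::ennreal) \<le> 2"
  using ennreal_leI[of 1 2] by simp

lemma Lp_measurable [measurable_dest]: "f \<in> Lp M p \<Longrightarrow> f \<in> borel_measurable M"
  by (simp add: Lp_def)

lemma Lp_norm_nonneg [simp]: "Lp_norm M p f \<ge> 0"
  by (simp add: Lp_norm_def)

text \<open>For measurable functions outside the space \<open>Lp_norm\<close> takes the default
  value 0, so a norm bound is informative only together with membership. The pair is equivalent to a
  bound almost everywhere (for finite exponents: on a nonnegative integral), and inequalities are
  proved in that form.\<close>

lemma Lp_infinity_le_iff:
  assumes "B \<ge> 0"
  shows "f \<in> Lp M \<infinity> \<and> Lp_norm M \<infinity> f \<le> B \<longleftrightarrow> f \<in> borel_measurable M \<and> (AE x in M. norm (f x) \<le> B)"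
proof safe
  assume f: "f \<in> Lp M \<infinity>" and le: "Lp_norm M \<infinity> f \<le> B"
  show [measurable]: "f \<in> borel_measurable M" using f by measurable
  let ?s = "esssup M (\<lambda>x. ennreal (norm (f x)))"
  have "?s < top" using f by (simp add: Lp_def)
  then have "?s = ennreal (enn2real ?s)" by simp
  also have "\<dots> \<le> ennreal B"
    using le by (intro ennreal_leI) (simp add: Lp_norm_def)
  finally have "?s \<le> ennreal B" .
  then show "AE x in M. norm (f x) \<le> B"
    using esssup_AE[of "\<lambda>x. ennreal (norm (f x))" M] assms
    by (elim eventually_mono) (meson ennreal_le_iff order_trans)
next
  assume [measurable]: "f \<in> borel_measurable M" and "AE x in M. norm (f x) \<le> B"
  then have le: "esssup M (\<lambda>x. ennreal (norm (f x))) \<le> ennreal B"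
    by (intro esssup_I) (auto elim!: eventually_mono intro!: ennreal_leI)
  then show "f \<in> Lp M \<infinity>"
    by (auto simp: Lp_def intro: le_less_trans[OF _ ennreal_less_top])
  show "Lp_norm M \<infinity> f \<le> B"
    using enn2real_mono[OF le] assms by (simp add: Lp_norm_def)
qed

lemma Lp_finite_le_iff:
  assumes "B \<ge> 0" and r: "r \<ge> 1"
  shows "f \<in> Lp M (ennreal r) \<and> Lp_norm M (ennreal r) f \<le> B \<longleftrightarrow>
     f \<in> borel_measurable M \<and> (\<integral>\<^sup>+x. ennreal (norm (f x) powr r) \<partial>M) \<le> ennreal (B powr r)"
proof safe
  assume f: "f \<in> Lp M (ennreal r)" and le: "Lp_norm M (ennreal r) f \<le> B"
  show [measurable]: "f \<in> borel_measurable M" using f by measurable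
  have int: "integrable M (\<lambda>x. norm (f x) powr r)"
    using f r by (simp add: Lp_def)
  let ?I = "\<integral>x. norm (f x) powr r \<partial>M"
  have "?I powr (1 / r) \<le> B"
    using le r by (simp add: Lp_norm_def)
  then have "(?I powr (1 / r)) powr r \<le> B powr r"
    using r by (intro powr_mono2) auto
  then have "?I \<le> B powr r"
    using r by (simp add: powr_powr)
  then show "(\<integral>\<^sup>+x. ennreal (norm (f x) powr r) \<partial>M) \<le> ennreal (B powr r)"
    using nn_integral_eq_integral[OF int] by (simp add: ennreal_leI)
next
  assume [measurable]: "f \<in> borel_measurable M"
    and le: "(\<integral>\<^sup>+x. ennreal (norm (f x) powr r) \<partial>M) \<le> ennreal (B powr r)"
  have int: "integrable M (\<lambda>x. norm (f x) powr r)"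
    using le by (intro integrableI_bounded) (auto intro: le_less_trans[OF _ ennreal_less_top])
  then show "f \<in> Lp M (ennreal r)"
    using r by (simp add: Lp_def)
  have "(\<integral>x. norm (f x) powr r \<partial>M) \<le> B powr r"
    using le nn_integral_eq_integral[OF int] by simp
  then have "(\<integral>x. norm (f x) powr r \<partial>M) powr (1 / r) \<le> (B powr r) powr (1 / r)"
    using r by (intro powr_mono2) auto
  then show "Lp_norm M (ennreal r) f \<le> B"
    using r assms by (simp add: Lp_norm_def powr_powr)
qed

lemma Lp_dominated:
  assumes "p \<ge> 1" and g: "g \<in> Lp M p" and [measurable]: "f \<in> borel_measurable M"
    and le: "AE x in M. norm (f x) \<le> norm (g x)"
  shows "f \<in> Lp M p" "Lp_norm M p f \<le> Lp_norm M p g"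
proof -
  have "f \<in> Lp M p \<and> Lp_norm M p f \<le> Lp_norm M p g"
    using \<open>p \<ge> 1\<close>
  proof (cases rule: exponent_cases)
    case infinity
    have "AE x in M. norm (g x) \<le> Lp_norm M \<infinity> g"
      using g Lp_infinity_le_iff[of "Lp_norm M \<infinity> g" g M] infinity by simp
    with le have "AE x in M. norm (f x) \<le> Lp_norm M \<infinity> g"
      by eventually_elim simp
    then show ?thesis
      using Lp_infinity_le_iff[of "Lp_norm M \<infinity> g" f M] infinity by simp
  next
    case (finite r)
    have "(\<integral>\<^sup>+x. ennreal (norm (f x) powr r) \<partial>M) \<le> (\<integral>\<^sup>+x. ennreal (norm (g x) powr r) \<partial>M)"
      using le finite by (intro nn_integral_mono_AE) (auto elim!: eventually_mono intro!: ennreal_leI powr_mono2)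
    also have "\<dots> \<le> ennreal (Lp_norm M p g powr r)"
      using g Lp_finite_le_iff[of "Lp_norm M p g" r g M] finite by simp
    finally show ?thesis
      using Lp_finite_le_iff[of "Lp_norm M p g" r f M] finite by simp
  qed
  then show "f \<in> Lp M p" "Lp_norm M p f \<le> Lp_norm M p g" by auto
qed

lemma Lp_cong_AE:
  assumes "p \<ge> 1" and f: "f \<in> Lp M p" and g: "g \<in> borel_measurable M"
    and eq: "AE x in M. f x = g x"
  shows "g \<in> Lp M p" "Lp_norm M p g = Lp_norm M p f"
proof -
  have "AE x in M. norm (g x) \<le> norm (f x)" "AE x in M. norm (f x) \<le> norm (g x)"
    using eq by (auto elim!: eventually_mono)
  then show "g \<in> Lp M p" "Lp_norm M p g = Lp_norm M p f"
    using Lp_dominated[OF \<open>p \<ge> 1\<close> f g] Lp_dominated[of p g M f] f g \<open>p \<ge> 1\<close>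
    by (auto intro: antisym)
qed

text \<open>Minkowski's inequality for series. Finite sums and scalar multiples are special cases.\<close>

lemma Lp_suminf:
  fixes u :: "nat \<Rightarrow> 'a \<Rightarrow> complex" and v :: "nat \<Rightarrow> complex"
  assumes p: "p \<ge> 1" and u: "\<And>n. u n \<in> Lp M p" and B: "\<And>n. Lp_norm M p (u n) \<le> B"
    and v: "summable (\<lambda>n. norm (v n))"
  shows "AE x in M. summable (\<lambda>n. norm (v n * u n x))"
    and "(\<lambda>x. \<Sum>n. v n * u n x) \<in> Lp M p"
    and "Lp_norm M p (\<lambda>x. \<Sum>n. v n * u n x) \<le> (\<Sum>n. norm (v n)) * B"
proof -
  have [measurable]: "u n \<in> borel_measurable M" for n
    using u by measurable
  have "B \<ge> 0" using B[of 0] Lp_norm_nonneg[of M p "u 0"] by linarith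
  define W where "W = (\<Sum>n. norm (v n))"
  have "W \<ge> 0" unfolding W_def by (rule suminf_nonneg[OF v]) simp
  have "(AE x in M. summable (\<lambda>n. norm (v n * u n x))) \<and>
     (\<lambda>x. \<Sum>n. v n * u n x) \<in> Lp M p \<and> Lp_norm M p (\<lambda>x. \<Sum>n. v n * u n x) \<le> W * B"
    using p
  proof (cases rule: exponent_cases)
    case infinity
    have "AE x in M. norm (u n x) \<le> B" for n
      using Lp_infinity_le_iff[OF \<open>B \<ge> 0\<close>, of "u n" M] u B infinity by simp
    then have *: "AE x in M. \<forall>n. norm (u n x) \<le> B"
      by (simp add: AE_all_countable)
    have sum: "summable (\<lambda>n. norm (v n * u n x))"
      and le: "norm (\<Sum>n. v n * u n x) \<le> W * B" if "\<forall>n. norm (u n x) \<le> B" for x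
    proof -
      have le: "norm (v n * u n x) \<le> norm (v n) * B" for n
        using that by (simp add: norm_mult mult_left_mono)
      have s: "summable (\<lambda>n. norm (v n) * B)"
        using v by (rule summable_mult2)
      show sum: "summable (\<lambda>n. norm (v n * u n x))"
        by (rule summable_comparison_test'[OF s]) (use le in simp)
      have "norm (\<Sum>n. v n * u n x) \<le> (\<Sum>n. norm (v n * u n x))"
        using sum by (rule summable_norm)
      also have "\<dots> \<le> (\<Sum>n. norm (v n) * B)"
        using le sum s by (rule suminf_le)
      finally show "norm (\<Sum>n. v n * u n x) \<le> W * B"
        using v by (simp add: W_def suminf_mult2)
    qed
    have "AE x in M. summable (\<lambda>n. norm (v n * u n x))"
      using * by eventually_elim (rule sum)
    moreover have "AE x in M. norm (\<Sum>n. v n * u n x) \<le> W * B"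
      using * by eventually_elim (rule le)
    ultimately show ?thesis
      using Lp_infinity_le_iff[of "W * B" "\<lambda>x. \<Sum>n. v n * u n x" M] \<open>B \<ge> 0\<close> \<open>W \<ge> 0\<close> infinity by simp
  next
    case (finite r)
    define h where "h = (\<lambda>N x. \<Sum>n<N. norm (v n) * norm (u n x))"
    have [measurable]: "h N \<in> borel_measurable M" for N
      unfolding h_def by measurable
    have h_nonneg: "h N x \<ge> 0" for N x
      unfolding h_def by (intro sum_nonneg) auto
    have h_mono: "h N x \<le> h N' x" if "N \<le> N'" for N N' x
      unfolding h_def using that by (intro sum_mono2) auto
    define H where "H = (\<lambda>x. SUP N. ennreal (h N x powr r))"
    have [measurable]: "H \<in> borel_measurable M"
      unfolding H_def by measurable
    \<comment> \<open>The weighted Jensen inequality with weights \<open>norm (v n)\<close> of total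
      V yields \<open>V powr (r - 1)\<close> times V times \<open>B powr r\<close>, the r-th power
      of V B, and V is at most W.\<close>
    have int_h: "(\<integral>\<^sup>+x. ennreal (h N x powr r) \<partial>M) \<le> ennreal ((W * B) powr r)" for N
    proof -
      define V where "V = (\<Sum>n<N. norm (v n))"
      have "V \<ge> 0" unfolding V_def by (intro sum_nonneg) auto
      have "V \<le> W" unfolding V_def W_def by (intro sum_le_suminf[OF v]) auto
      have "(\<integral>\<^sup>+x. ennreal (h N x powr r) \<partial>M)
          \<le> (\<integral>\<^sup>+x. ennreal (V powr (r - 1)) * (\<Sum>n<N. ennreal (norm (v n)) * ennreal (norm (u n x) powr r)) \<partial>M)"
      proof (intro nn_integral_mono)
        fix x
        have "ennreal (h N x powr r) \<le> ennreal (V powr (r - 1) * (\<Sum>n<N. norm (v n) * norm (u n x) powr r))"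
          unfolding h_def V_def using finite by (intro ennreal_leI weighted_sum_powr_le) auto
        then show "ennreal (h N x powr r)
            \<le> ennreal (V powr (r - 1)) * (\<Sum>n<N. ennreal (norm (v n)) * ennreal (norm (u n x) powr r))"
          by (simp add: ennreal_mult ennreal_mult' sum_nonneg flip: sum_ennreal)
      qed
      also have "\<dots> = ennreal (V powr (r - 1)) *
          (\<Sum>n<N. ennreal (norm (v n)) * (\<integral>\<^sup>+x. ennreal (norm (u n x) powr r) \<partial>M))"
        by (simp add: nn_integral_cmult nn_integral_sum)
      also have "\<dots> \<le> ennreal (V powr (r - 1)) * (\<Sum>n<N. ennreal (norm (v n)) * ennreal (B powr r))"
        using Lp_finite_le_iff[OF \<open>B \<ge> 0\<close> \<open>r \<ge> 1\<close>, of "u _" M] u B finite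
        by (intro mult_left_mono sum_mono) auto
      also have "\<dots> = ennreal (V powr (r - 1)) * ennreal (V * B powr r)"
        using \<open>V \<ge> 0\<close> by (simp add: V_def sum_nonneg ennreal_mult' flip: sum_distrib_right sum_ennreal)
      also have "\<dots> = ennreal (V powr r * B powr r)"
        using \<open>V \<ge> 0\<close> by (cases "V = 0") (auto simp: powr_diff simp flip: ennreal_mult')
      also have "\<dots> \<le> ennreal ((W * B) powr r)"
        using \<open>V \<le> W\<close> \<open>V \<ge> 0\<close> \<open>B \<ge> 0\<close> finite
        by (auto simp: powr_mult intro!: ennreal_leI mult_right_mono powr_mono2)
      finally show ?thesis .
    qed
    have "(\<integral>\<^sup>+x. H x \<partial>M) = (SUP N. \<integral>\<^sup>+x. ennreal (h N x powr r) \<partial>M)"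
      unfolding H_def using finite
      by (intro nn_integral_monotone_convergence_SUP)
        (auto simp: incseq_def le_fun_def intro!: ennreal_leI powr_mono2 h_mono h_nonneg)
    also have "\<dots> \<le> ennreal ((W * B) powr r)"
      by (intro SUP_least int_h)
    finally have int_H: "(\<integral>\<^sup>+x. H x \<partial>M) \<le> ennreal ((W * B) powr r)" .
    then have "AE x in M. H x \<noteq> \<infinity>"
      by (intro nn_integral_PInf_AE) (auto simp: top_unique)
    moreover have sum: "summable (\<lambda>n. norm (v n * u n x))" if "H x \<noteq> \<infinity>" for x
    proof -
      define C where "C = enn2real (H x)"
      have "ennreal (h N x powr r) \<le> H x" for N
        unfolding H_def by (intro SUP_upper) auto
      then have "h N x powr r \<le> C" for N
        using that enn2real_mono[of "ennreal (h N x powr r)" "H x"] by (simp add: C_def less_top)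
      then have "(h N x powr r) powr (1 / r) \<le> C powr (1 / r)" for N
        using finite by (intro powr_mono2) auto
      then have "h N x \<le> C powr (1 / r)" for N
        using finite h_nonneg by (simp add: powr_powr)
      then show ?thesis
        by (intro summableI_nonneg_bounded[of _ "C powr (1 / r)"]) (auto simp: h_def norm_mult)
    qed
    ultimately have AE_sum: "AE x in M. summable (\<lambda>n. norm (v n * u n x))"
      by (auto elim!: eventually_mono)
    \<comment> \<open>Where the series converges absolutely, the r-th power of the sum of norms is
      the limit of the powers whose supremum is H.\<close>
    have "(\<integral>\<^sup>+x. ennreal (norm (\<Sum>n. v n * u n x) powr r) \<partial>M) \<le> (\<integral>\<^sup>+x. H x \<partial>M)"
    proof (intro nn_integral_mono_AE, use AE_sum in eventually_elim)
      case (elim x)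
      let ?s = "\<Sum>n. norm (v n * u n x)"
      have "(\<lambda>N. h N x) \<longlonglongrightarrow> ?s"
        using summable_LIMSEQ[OF elim] by (simp add: h_def norm_mult)
      then have "(\<lambda>N. ennreal (h N x powr r)) \<longlonglongrightarrow> ennreal (?s powr r)"
        using finite h_nonneg by (intro tendsto_ennrealI tendsto_powr') auto
      then have "ennreal (?s powr r) \<le> H x"
        unfolding H_def by (rule LIMSEQ_le_const2) (intro exI allI impI SUP_upper UNIV_I)
      moreover have "norm (\<Sum>n. v n * u n x) powr r \<le> ?s powr r"
        using finite by (intro powr_mono2 summable_norm[OF elim]) auto
      ultimately show ?case
        by (meson ennreal_leI order_trans)
    qed
    also note int_H
    finally show ?thesis
      using Lp_finite_le_iff[of "W * B" r "\<lambda>x. \<Sum>n. v n * u n x" M] \<open>B \<ge> 0\<close> \<open>W \<ge> 0\<close> finite AE_sum by simp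
  qed
  then show "AE x in M. summable (\<lambda>n. norm (v n * u n x))"
    and "(\<lambda>x. \<Sum>n. v n * u n x) \<in> Lp M p"
    and "Lp_norm M p (\<lambda>x. \<Sum>n. v n * u n x) \<le> (\<Sum>n. norm (v n)) * B"
    by (auto simp: W_def)
qed

lemma Lp_zero:
  assumes "p \<ge> 1"
  shows "(\<lambda>_. 0) \<in> Lp M p" "Lp_norm M p (\<lambda>_. 0) = 0"
proof -
  have "(\<lambda>_. 0) \<in> Lp M p \<and> Lp_norm M p (\<lambda>_. 0) \<le> 0"
    using assms
  proof (cases rule: exponent_cases)
    case infinity
    then show ?thesis using Lp_infinity_le_iff[of 0 "\<lambda>_. 0" M] by simp
  next
    case (finite r)
    then show ?thesis using Lp_finite_le_iff[of 0 r "\<lambda>_. 0" M] by simp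
  qed
  then show "(\<lambda>_. 0) \<in> Lp M p" "Lp_norm M p (\<lambda>_. 0) = 0"
    by (auto intro: antisym)
qed

lemma Lp_cmult:
  assumes p: "p \<ge> 1" and f: "f \<in> Lp M p"
  shows "(\<lambda>x. c * f x) \<in> Lp M p" "Lp_norm M p (\<lambda>x. c * f x) \<le> norm c * Lp_norm M p f"
proof -
  let ?v = "\<lambda>n. if n = 0 then c else (0::complex)"
  have v: "(\<lambda>n. norm (?v n)) sums norm c"
    using sums_single[of 0 "\<lambda>_. norm c"] by (simp add: if_distrib[of norm] cong: if_cong)
  have "(\<Sum>n. ?v n * f x) = c * f x" for x
    using sums_single[of 0 "\<lambda>_. c * f x"]
    by (intro sums_unique[symmetric]) (simp add: if_distrib[of "\<lambda>z. z * f x"] cong: if_cong)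
  then show "(\<lambda>x. c * f x) \<in> Lp M p" "Lp_norm M p (\<lambda>x. c * f x) \<le> norm c * Lp_norm M p f"
    using Lp_suminf(2,3)[of p "\<lambda>_. f" M "Lp_norm M p f" ?v] p f v
    by (simp_all add: sums_iff)
qed

lemma Lp_add:
  assumes p: "p \<ge> 1" and f: "f \<in> Lp M p" and g: "g \<in> Lp M p"
  shows "(\<lambda>x. f x + g x) \<in> Lp M p"
    and "Lp_norm M p (\<lambda>x. f x + g x) \<le> Lp_norm M p f + Lp_norm M p g"
proof -
  have *: "(\<lambda>x. f x + g x) \<in> Lp M p \<and> Lp_norm M p (\<lambda>x. f x + g x) \<le> Lp_norm M p f + Lp_norm M p g + e"
    if "e > 0" for e
  proof -
    \<comment> \<open>The functions f / A and g / B have norm at most 1 and enter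
      \<open>Lp_suminf\<close> with the weights A and B, which gives the bound A + B. The slack e /
      2 keeps A and B positive when a norm is 0.\<close>
    define A where "A = Lp_norm M p f + e / 2"
    define B where "B = Lp_norm M p g + e / 2"
    have AB: "A > 0" "B > 0" "Lp_norm M p f \<le> A" "Lp_norm M p g \<le> B"
      using that Lp_norm_nonneg[of M p f] Lp_norm_nonneg[of M p g] by (auto simp: A_def B_def add_nonneg_pos)
    let ?u = "\<lambda>n::nat. if n = 0 then (\<lambda>x. complex_of_real (1 / A) * f x)
      else if n = 1 then (\<lambda>x. complex_of_real (1 / B) * g x) else (\<lambda>_. 0)"
    let ?v = "\<lambda>n::nat. if n = 0 then complex_of_real A else if n = 1 then complex_of_real B else 0"
    have u: "?u n \<in> Lp M p \<and> Lp_norm M p (?u n) \<le> 1" for n :: nat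
    proof -
      have "Lp_norm M p (\<lambda>x. complex_of_real (1 / A) * f x) \<le> norm (complex_of_real (1 / A)) * Lp_norm M p f"
           "Lp_norm M p (\<lambda>x. complex_of_real (1 / B) * g x) \<le> norm (complex_of_real (1 / B)) * Lp_norm M p g"
        using Lp_cmult(2)[OF p f] Lp_cmult(2)[OF p g] by blast+
      moreover have "norm (complex_of_real (1 / A)) * Lp_norm M p f \<le> 1"
           "norm (complex_of_real (1 / B)) * Lp_norm M p g \<le> 1"
        using AB by (simp_all add: field_simps norm_divide)
      ultimately show ?thesis
        using Lp_cmult(1)[OF p f] Lp_cmult(1)[OF p g] Lp_zero[OF p, of M]
        by (auto simp del: of_real_divide of_real_1)
    qed
    have "(\<lambda>n. norm (?v n)) sums (\<Sum>n<2. norm (?v n))"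
      by (intro sums_finite) auto
    then have v: "(\<lambda>n. norm (?v n)) sums (A + B)"
      using AB by (simp add: numeral_2_eq_2)
    have "A + B = Lp_norm M p f + Lp_norm M p g + e"
      by (simp add: A_def B_def)
    moreover have "(\<Sum>n. ?v n * ?u n x) = f x + g x" for x
    proof -
      have "(\<lambda>n. ?v n * ?u n x) sums (\<Sum>n<2. ?v n * ?u n x)"
        by (intro sums_finite) auto
      then show ?thesis
        using AB by (subst sums_unique[symmetric]) (auto simp: numeral_2_eq_2)
    qed
    ultimately show ?thesis
      using Lp_suminf(2,3)[of p ?u M 1 ?v] p u v by (simp add: sums_iff)
  qed
  show "(\<lambda>x. f x + g x) \<in> Lp M p" using *[of 1] by simp
  show "Lp_norm M p (\<lambda>x. f x + g x) \<le> Lp_norm M p f + Lp_norm M p g"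
    by (rule field_le_epsilon) (use * in auto)
qed

lemma Lp_diff:
  assumes p: "p \<ge> 1" and f: "f \<in> Lp M p" and g: "g \<in> Lp M p"
  shows "(\<lambda>x. f x - g x) \<in> Lp M p"
    and "Lp_norm M p (\<lambda>x. f x - g x) \<le> Lp_norm M p f + Lp_norm M p g"
  using Lp_add[OF p f Lp_cmult(1)[OF p g, of "-1"]] Lp_cmult(2)[OF p g, of "-1"]
  by simp_all

lemma Lp_sum:
  assumes "p \<ge> 1" "\<And>i. i \<in> I \<Longrightarrow> f i \<in> Lp M p"
  shows "(\<lambda>x. \<Sum>i\<in>I. f i x) \<in> Lp M p"
  using assms(2) by (induction I rule: infinite_finite_induct) (auto simp: Lp_zero Lp_add assms(1))

lemma Lp_norm_eq_0_AE:
  assumes p: "p \<ge> 1" and f: "f \<in> Lp M p" and 0: "Lp_norm M p f = 0"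
  shows "AE x in M. f x = 0"
  using p
proof (cases rule: exponent_cases)
  case infinity
  then show ?thesis
    using Lp_infinity_le_iff[of 0 f M] f 0 by simp
next
  case (finite r)
  have [measurable]: "f \<in> borel_measurable M" using f by measurable
  have "(\<integral>\<^sup>+x. ennreal (norm (f x) powr r) \<partial>M) = 0"
    using Lp_finite_le_iff[of 0 r f M] f 0 finite by simp
  then have "AE x in M. ennreal (norm (f x) powr r) = 0"
    by (subst (asm) nn_integral_0_iff_AE) auto
  then show ?thesis
    by eventually_elim (simp add: ennreal_eq_0_iff)
qed

text \<open>Needed for objects such as \<open>Lp_suminf\<close> that are chosen by their limit
  property: whatever the choice, it is determined almost everywhere.\<close>

lemma Lp_limit_unique:
  assumes p: "p \<ge> 1" and u: "\<And>n. u n \<in> Lp M p" and f: "f \<in> Lp M p" and g: "g \<in> Lp M p"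
    and lim: "(\<lambda>n. Lp_norm M p (\<lambda>x. u n x - f x)) \<longlonglongrightarrow> 0" "(\<lambda>n. Lp_norm M p (\<lambda>x. u n x - g x)) \<longlonglongrightarrow> 0"
  shows "AE x in M. f x = g x"
proof -
  have "Lp_norm M p (\<lambda>x. f x - g x)
      \<le> Lp_norm M p (\<lambda>x. u n x - g x) + Lp_norm M p (\<lambda>x. u n x - f x)" for n
    using Lp_diff(2)[OF p Lp_diff(1)[OF p u g] Lp_diff(1)[OF p u f], of n n] by simp
  moreover have "(\<lambda>n. Lp_norm M p (\<lambda>x. u n x - g x) + Lp_norm M p (\<lambda>x. u n x - f x)) \<longlonglongrightarrow> 0"
    using tendsto_add[OF lim(2,1)] by simp
  ultimately have "Lp_norm M p (\<lambda>x. f x - g x) \<le> 0"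
    by (intro LIMSEQ_le_const[of _ 0]) auto
  then have "Lp_norm M p (\<lambda>x. f x - g x) = 0"
    using Lp_norm_nonneg antisym by blast
  from Lp_norm_eq_0_AE[OF p Lp_diff(1)[OF p f g] this] show ?thesis
    by simp
qed

section \<open>The exponents 1 and 2\<close>

lemma Lp_1_iff: "f \<in> Lp M 1 \<longleftrightarrow> integrable M f"
  by (auto simp: Lp_def integrable_norm_iff)

lemma Lp_2_iff: "f \<in> Lp M 2 \<longleftrightarrow> f \<in> borel_measurable M \<and> integrable M (\<lambda>x. (norm (f x))\<^sup>2)"
  using Lp_def[of M 2] by (simp add: powr_numeral)

lemma Lp_norm_2: "Lp_norm M 2 f = sqrt (\<integral>x. (norm (f x))\<^sup>2 \<partial>M)"
  by (simp add: Lp_norm_def powr_half_sqrt integral_nonneg_AE)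

lemma L2_mult_integrable:
  assumes "f \<in> Lp M 2" "g \<in> Lp M 2"
  shows "integrable M (\<lambda>x. f x * g x)" "integrable M (\<lambda>x. f x * cnj (g x))"
proof -
  have [measurable]: "f \<in> borel_measurable M" "g \<in> borel_measurable M"
    using assms by measurable
  have "norm a * norm b \<le> (norm a)\<^sup>2 + (norm b)\<^sup>2" for a b :: complex
    using sum_squares_bound[of "norm a" "norm b"] mult_nonneg_nonneg[of "norm a" "norm b"] norm_ge_zero[of a] norm_ge_zero[of b] by linarith
  moreover have "integrable M (\<lambda>x. (norm (f x))\<^sup>2 + (norm (g x))\<^sup>2)"
    using assms by (simp add: Lp_2_iff)
  ultimately show "integrable M (\<lambda>x. f x * g x)" "integrable M (\<lambda>x. f x * cnj (g x))"
    by (auto intro!: Bochner_Integration.integrable_bound[of M "\<lambda>x. (norm (f x))\<^sup>2 + (norm (g x))\<^sup>2"] simp: norm_mult)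
qed

lemma (in prob_space) Lp_subset_L1:
  assumes p: "p \<ge> 1" and f: "f \<in> Lp M p"
  shows "integrable M f"
  using p
proof (cases rule: exponent_cases)
  case infinity
  then show ?thesis
    using Lp_infinity_le_iff[of "Lp_norm M \<infinity> f" f M] f
    by (intro integrable_const_bound[of _ "Lp_norm M \<infinity> f"]) auto
next
  case (finite r)
  have [measurable]: "f \<in> borel_measurable M" using f by measurable
  \<comment> \<open>Below 1 the constant suffices, from 1 on y is at most
    \<open>y powr r\<close>.\<close>
  have "y \<le> 1 + y powr r" if "y \<ge> 0" for y :: real
    using powr_mono[of 1 r y] finite that by (cases "y \<ge> 1") (auto intro: add_increasing2)
  moreover have "integrable M (\<lambda>x. 1 + norm (f x) powr r)"
    using f finite by (simp add: Lp_def)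
  ultimately show ?thesis
    by (auto intro!: Bochner_Integration.integrable_bound[of M "\<lambda>x. 1 + norm (f x) powr r"])
qed

lemma L2_dominated_convergence:
  fixes f :: "'a \<Rightarrow> complex"
  assumes f: "f \<in> Lp M 2" and s: "\<And>i. s i \<in> borel_measurable M"
    and lim: "\<And>x. x \<in> space M \<Longrightarrow> (\<lambda>i. s i x) \<longlonglongrightarrow> f x"
    and le: "\<And>i x. x \<in> space M \<Longrightarrow> norm (s i x) \<le> K * norm (f x)"
  shows "s i \<in> Lp M 2" "(\<lambda>i. Lp_norm M 2 (\<lambda>x. f x - s i x)) \<longlonglongrightarrow> 0"
proof -
  note [measurable] = s Lp_measurable[OF f]
  have f2: "integrable M (\<lambda>x. (norm (f x))\<^sup>2)" using f by (simp add: Lp_2_iff)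
  have le2: "(norm (s i x))\<^sup>2 \<le> K\<^sup>2 * (norm (f x))\<^sup>2" if "x \<in> space M" for i x
    using power_mono[OF le[OF that, of i], of 2] by (simp add: power_mult_distrib)
  have "integrable M (\<lambda>x. (norm (s i x))\<^sup>2)" for i
  proof (rule Bochner_Integration.integrable_bound)
    show "integrable M (\<lambda>x. K\<^sup>2 * (norm (f x))\<^sup>2)" using f2 by simp
    show "AE x in M. norm ((norm (s i x))\<^sup>2) \<le> norm (K\<^sup>2 * (norm (f x))\<^sup>2)"
      by (intro AE_I2) (simp add: le2)
  qed measurable
  then show "s i \<in> Lp M 2" for i
    by (simp add: Lp_2_iff s)
  have "(\<lambda>i. \<integral>x. (norm (f x - s i x))\<^sup>2 \<partial>M) \<longlonglongrightarrow> (\<integral>x. 0 \<partial>M)"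
  \<comment> \<open>The majorant squares
    \<open>norm (f x - s i x) \<le> (1 + K) * norm (f x)\<close>.\<close>
  proof (rule integral_dominated_convergence[where w="\<lambda>x. (1 + K)\<^sup>2 * (norm (f x))\<^sup>2"])
    show "AE x in M. (\<lambda>i. (norm (f x - s i x))\<^sup>2) \<longlonglongrightarrow> 0"
    proof (rule AE_I2)
      fix x assume "x \<in> space M"
      from lim[OF this] have "(\<lambda>i. (norm (f x - s i x))\<^sup>2) \<longlonglongrightarrow> (norm (f x - f x))\<^sup>2"
        by (intro tendsto_intros)
      then show "(\<lambda>i. (norm (f x - s i x))\<^sup>2) \<longlonglongrightarrow> 0" by simp
    qed
    show "AE x in M. norm ((norm (f x - s i x))\<^sup>2) \<le> (1 + K)\<^sup>2 * (norm (f x))\<^sup>2" for i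
    proof (rule AE_I2)
      fix x assume "x \<in> space M"
      then have "norm (f x - s i x) \<le> (1 + K) * norm (f x)"
        using norm_triangle_ineq4[of "f x" "s i x"] le[of x i] by (simp add: algebra_simps)
      from power_mono[OF this, of 2] show "norm ((norm (f x - s i x))\<^sup>2) \<le> (1 + K)\<^sup>2 * (norm (f x))\<^sup>2"
        by (simp add: power_mult_distrib)
    qed
  qed (use f2 in auto)
  from tendsto_real_sqrt[OF this] show "(\<lambda>i. Lp_norm M 2 (\<lambda>x. f x - s i x)) \<longlonglongrightarrow> 0"
    by (simp add: Lp_norm_2)
qed

lemma L2_norm_add_orthogonal:
  assumes f: "f \<in> Lp M 2" and g: "g \<in> Lp M 2" and "L2_inner M f g = 0"
  shows "(Lp_norm M 2 (\<lambda>x. f x + g x))\<^sup>2 = (Lp_norm M 2 f)\<^sup>2 + (Lp_norm M 2 g)\<^sup>2"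
proof -
  have sq: "(Lp_norm M 2 h)\<^sup>2 = (\<integral>x. (norm (h x))\<^sup>2 \<partial>M)" for h :: "'a \<Rightarrow> complex"
    by (simp add: Lp_norm_2 integral_nonneg_AE)
  note i = L2_mult_integrable(2)[OF f g]
  define P where "P x = Re (f x * cnj (g x))" for x
  have *: "(norm (f x + g x))\<^sup>2 = (norm (f x))\<^sup>2 + (norm (g x))\<^sup>2 + 2 * P x" for x
    unfolding P_def by (simp only: cmod_power2) (simp add: power2_eq_square algebra_simps)
  have "integrable M P" "(\<integral>x. P x \<partial>M) = 0"
    using integrable_Re[OF i] integral_Re[OF i] assms(3) by (simp_all only: P_def[abs_def] L2_inner_def zero_complex.sel)
  then show ?thesis
    using f g unfolding sq * by (simp add: Lp_2_iff)
qed

section \<open>Limits in operator norm\<close>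

lemma
  assumes "Lp_bounded_op M p S" "f \<in> Lp M p"
  shows Lp_bounded_op_cong_AE: "g \<in> Lp M p \<Longrightarrow> AE x in M. f x = g x \<Longrightarrow> AE x in M. S f x = S g x"
    and Lp_bounded_op_cmult: "AE x in M. S (\<lambda>y. c * f y) x = c * S f x"
  using assms by (auto simp: Lp_bounded_op_def)

lemma Lp_op_tendsto_LIMSEQ:
  assumes S: "Lp_op_tendsto M p U S" and f: "f \<in> Lp M p"
  shows "(\<lambda>n. Lp_norm M p (\<lambda>x. U n f x - S f x)) \<longlonglongrightarrow> 0"
proof (rule LIMSEQ_I)
  fix r :: real assume "r > 0"
  \<comment> \<open>Adding 1 to the norm keeps the quotient meaningful when f vanishes almost
    everywhere.\<close>
  define e where "e = r / (Lp_norm M p f + 1)"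
  have "Lp_norm M p f + 1 > 0"
    by (simp add: add_nonneg_pos)
  then have e: "e > 0" "e * Lp_norm M p f < r"
    using \<open>r > 0\<close> by (simp_all add: e_def field_simps)
  from S e(1) obtain N where "\<And>n. n \<ge> N \<Longrightarrow> Lp_norm M p (\<lambda>x. U n f x - S f x) \<le> e * Lp_norm M p f"
    using f by (fastforce simp: Lp_op_tendsto_def)
  then show "\<exists>no. \<forall>n\<ge>no. norm (Lp_norm M p (\<lambda>x. U n f x - S f x) - 0) < r"
    using e(2) by (force intro: le_less_trans)
qed

lemma Lp_op_tendsto_unique:
  assumes p: "p \<ge> 1" and S: "Lp_op_tendsto M p U S" and R: "Lp_op_tendsto M p U R" and f: "f \<in> Lp M p"
  shows "AE x in M. S f x = R f x"
proof (rule Lp_limit_unique[OF p])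
  show "U n f \<in> Lp M p" for n
    using S f by (auto simp: Lp_op_tendsto_def Lp_bounded_op_def)
  show "S f \<in> Lp M p" "R f \<in> Lp M p"
    using S R f by (auto simp: Lp_op_tendsto_def Lp_bounded_op_def)
qed (rule Lp_op_tendsto_LIMSEQ[OF S f] Lp_op_tendsto_LIMSEQ[OF R f])+

text \<open>The witnesses are the Bernstein polynomials of \<open>\<phi>\<close>, lifted to complex
  polynomials because \<open>op_poly\<close> takes complex coefficients; at real points they have
  the real Bernstein values.\<close>

lemma polynomials_dense_unit_interval:
  fixes \<phi> :: "real \<Rightarrow> real"
  assumes "continuous_on {0..1} \<phi>"
  obtains q :: "nat \<Rightarrow> complex poly"
  where "uniform_limit (of_real ` {0..1}) (\<lambda>n. poly (q n)) (\<lambda>z. of_real (\<phi> (Re z))) sequentially"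
proof
  let ?q = "\<lambda>n. \<Sum>k\<le>n. smult (complex_of_real (\<phi> (k / n) * real (n choose k))) ([:0, 1:] ^ k * [:1, -1:] ^ (n - k))"
  have q: "poly (?q n) (of_real x) = of_real (\<Sum>k\<le>n. \<phi> (k / n) * Bernstein n k x)" for n x
    by (simp add: poly_sum Bernstein_def mult.assoc)
  show "uniform_limit (of_real ` {0..1}) (\<lambda>n. poly (?q n)) (\<lambda>z. of_real (\<phi> (Re z))) sequentially"
  proof (rule uniform_limitI)
    fix e :: real assume "e > 0"
    from Bernstein_Weierstrass[OF assms this] obtain N where
      N: "\<And>n x. N \<le> n \<Longrightarrow> x \<in> {0..1} \<Longrightarrow> \<bar>\<phi> x - (\<Sum>k\<le>n. \<phi> (k / n) * Bernstein n k x)\<bar> < e"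
      by blast
    show "\<forall>\<^sub>F n in sequentially. \<forall>z\<in>of_real ` {0..1}. dist (poly (?q n) z) (of_real (\<phi> (Re z))) < e"
    proof (intro eventually_sequentiallyI ballI)
      fix n and z :: complex assume "N \<le> n" "z \<in> of_real ` {0..1}"
      then obtain x where x: "z = of_real x" "x \<in> {0..1}" by blast
      have "dist (poly (?q n) z) (of_real (\<phi> (Re z))) = \<bar>(\<Sum>k\<le>n. \<phi> (k / n) * Bernstein n k x) - \<phi> x\<bar>"
        unfolding x(1) q dist_norm Re_complex_of_real of_real_diff[symmetric] norm_of_real ..
      then show "dist (poly (?q n) z) (of_real (\<phi> (Re z))) < e"
        using N[OF \<open>N \<le> n\<close> x(2)] by (simp add: abs_minus_commute)
    qed
  qed
qed

lemma measurable_Complex [measurable (raw)]: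
  assumes "f \<in> borel_measurable M" "g \<in> borel_measurable M"
  shows "(\<lambda>x. Complex (f x) (g x)) \<in> borel_measurable M"
  using assms by (simp add: borel_measurable_complex_iff)

lemma integrable_Complex:
  assumes "integrable M f" "integrable M g"
  shows "integrable M (\<lambda>x. Complex (f x) (g x))"
  using assms by (simp add: Complex_eq)

subsection \<open>Complex conditional expectations along a filtration\<close>

locale filtered_prob_space = prob_space M for M :: "'a measure" +
  fixes \<A> :: "nat \<Rightarrow> 'a measure"
  assumes sub: "n \<ge> 1 \<Longrightarrow> subalgebra M (\<A> n)"
    and incr: "n \<ge> 1 \<Longrightarrow> sets (\<A> n) \<subseteq> sets (\<A> (Suc n))"
begin

abbreviation "E \<equiv> cexp M \<A>"

lemma subalgebra_filtration:
  assumes "1 \<le> m" "m \<le> n"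
  shows "subalgebra (\<A> n) (\<A> m)"
  using assms(2)
proof (induction n rule: dec_induct)
  case (step k)
  then have "k \<ge> 1" using assms(1) by linarith
  then show ?case
    using step.IH incr[of k] sub[of k] sub[of "Suc k"] by (auto simp: subalgebra_def)
qed (simp add: subalgebra_def)

lemma sigma_finite_subalgebra_filtration:
  assumes "n \<ge> 1"
  shows "sigma_finite_subalgebra M (\<A> n)"
  using sub[OF assms]
  by (intro finite_measure_subalgebra_is_sigma_finite)
    (simp add: finite_measure_subalgebra_def finite_measure_subalgebra_axioms_def finite_measure_axioms)

lemma measurable_filtration:
  "n \<ge> 1 \<Longrightarrow> f \<in> borel_measurable (\<A> n) \<Longrightarrow> f \<in> borel_measurable M"
  using measurable_from_subalg[OF sub] .

lemma Re_cexp: "n \<ge> 1 \<Longrightarrow> Re (E n f x) = real_cond_exp M (\<A> n) (\<lambda>y. Re (f y)) x"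
  and Im_cexp: "n \<ge> 1 \<Longrightarrow> Im (E n f x) = real_cond_exp M (\<A> n) (\<lambda>y. Im (f y)) x"
  by (simp_all add: cexp_def)

lemma cexp_0 [simp]: "E 0 f = (\<lambda>_. 0)"
  by (simp add: cexp_def)

lemma cexp_measurable_filtration:
  assumes "n \<ge> 1"
  shows "E n f \<in> borel_measurable (\<A> n)"
  using assms by (simp add: cexp_def measurable_Complex)

lemma cexp_measurable [measurable]: "E n f \<in> borel_measurable M"
  using measurable_filtration[OF _ cexp_measurable_filtration, of n f] by (cases "n = 0") auto

lemma cexp_cong_AE:
  assumes "AE x in M. f x = g x" and [measurable]: "f \<in> borel_measurable M" "g \<in> borel_measurable M"
  shows "AE x in M. E n f x = E n g x"
proof (cases "n = 0")
  case False
  then interpret S: sigma_finite_subalgebra M "\<A> n"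
    by (intro sigma_finite_subalgebra_filtration) auto
  have "AE x in M. Re (f x) = Re (g x)" "AE x in M. Im (f x) = Im (g x)"
    using assms(1) by (auto elim: eventually_mono)
  from this[THEN S.real_cond_exp_cong] have
    "AE x in M. real_cond_exp M (\<A> n) (\<lambda>y. Re (f y)) x = real_cond_exp M (\<A> n) (\<lambda>y. Re (g y)) x"
    "AE x in M. real_cond_exp M (\<A> n) (\<lambda>y. Im (f y)) x = real_cond_exp M (\<A> n) (\<lambda>y. Im (g y)) x"
    by auto
  then show ?thesis
    by eventually_elim (simp add: cexp_def)
qed simp

lemma cexp_integrable:
  assumes "integrable M f"
  shows "integrable M (E n f)"
proof (cases "n = 0")
  case False
  then interpret S: sigma_finite_subalgebra M "\<A> n"
    by (intro sigma_finite_subalgebra_filtration) auto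
  show ?thesis
    using False assms by (simp add: cexp_def integrable_Complex S.real_cond_exp_int)
qed simp

text \<open>The product splits into four real products, each dominated by
  \<open>norm (h x * f x)\<close>, so the real property applies to each of them although h and f
  need not be integrable separately.\<close>

lemma integral_mult_cexp:
  assumes n: "n \<ge> 1" and h: "h \<in> borel_measurable (\<A> n)" and f [measurable]: "f \<in> borel_measurable M"
    and int: "integrable M (\<lambda>x. h x * f x)"
  shows "integrable M (\<lambda>x. h x * E n f x)"
    and "(\<integral>x. h x * E n f x \<partial>M) = (\<integral>x. h x * f x \<partial>M)"
proof -
  interpret S: sigma_finite_subalgebra M "\<A> n"
    using n by (rule sigma_finite_subalgebra_filtration)
  have [measurable]: "h \<in> borel_measurable M"
    using h n by (rule measurable_filtration[rotated])
  have abs: "\<bar>Re a\<bar> * \<bar>Re b\<bar> \<le> norm (a * b)" "\<bar>Re a\<bar> * \<bar>Im b\<bar> \<le> norm (a * b)"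
    "\<bar>Im a\<bar> * \<bar>Re b\<bar> \<le> norm (a * b)" "\<bar>Im a\<bar> * \<bar>Im b\<bar> \<le> norm (a * b)" for a b :: complex
    unfolding norm_mult by (intro mult_mono abs_Re_le_cmod abs_Im_le_cmod; simp)+
  have i: "integrable M (\<lambda>x. Re (h x) * Re (f x))" "integrable M (\<lambda>x. Re (h x) * Im (f x))"
    "integrable M (\<lambda>x. Im (h x) * Re (f x))" "integrable M (\<lambda>x. Im (h x) * Im (f x))"
    by (rule Bochner_Integration.integrable_bound[OF int]; simp add: abs_mult abs)+
  have hm: "(\<lambda>x. Re (h x)) \<in> borel_measurable (\<A> n)" "(\<lambda>x. Im (h x)) \<in> borel_measurable (\<A> n)"
    using h by simp_all
  note E1 = S.real_cond_exp_intg[OF i(1) hm(1)] and E2 = S.real_cond_exp_intg[OF i(2) hm(1)]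
    and E3 = S.real_cond_exp_intg[OF i(3) hm(2)] and E4 = S.real_cond_exp_intg[OF i(4) hm(2)]
  have *: "h x * E n f x = Complex
      (Re (h x) * real_cond_exp M (\<A> n) (\<lambda>y. Re (f y)) x - Im (h x) * real_cond_exp M (\<A> n) (\<lambda>y. Im (f y)) x)
      (Re (h x) * real_cond_exp M (\<A> n) (\<lambda>y. Im (f y)) x + Im (h x) * real_cond_exp M (\<A> n) (\<lambda>y. Re (f y)) x)" for x
    using n by (simp add: cexp_def complex_eq_iff)
  show int': "integrable M (\<lambda>x. h x * E n f x)"
    unfolding * by (intro integrable_Complex Bochner_Integration.integrable_add Bochner_Integration.integrable_diff E1(1) E2(1) E3(1) E4(1)) auto
  show "(\<integral>x. h x * E n f x \<partial>M) = (\<integral>x. h x * f x \<partial>M)"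
    using E1 E2 E3 E4 i n
    by (simp add: complex_eq_iff integral_Re[OF int, symmetric] integral_Im[OF int, symmetric]
        integral_Re[OF int', symmetric] integral_Im[OF int', symmetric] Re_cexp Im_cexp)
qed

text \<open>Identities for the complex \<open>E n\<close> reduce to integrals over sets of
  \<open>\<A> n\<close>. This helps where real and imaginary parts mix, or where a series has to be
  passed.\<close>

lemma cexp_charact:
  assumes n: "n \<ge> 1" and f: "integrable M f" and g: "integrable M g" and g': "g \<in> borel_measurable (\<A> n)"
    and eq: "\<And>B. B \<in> sets (\<A> n) \<Longrightarrow> (\<integral>x. indicator B x * f x \<partial>M) = (\<integral>x. indicator B x * g x \<partial>M)"
  shows "AE x in M. E n f x = g x"
proof -
  interpret S: sigma_finite_subalgebra M "\<A> n"
    using n by (rule sigma_finite_subalgebra_filtration)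
  have *: "(\<integral>x\<in>B. Re (f x) \<partial>M) = (\<integral>x\<in>B. Re (g x) \<partial>M)"
    "(\<integral>x\<in>B. Im (f x) \<partial>M) = (\<integral>x\<in>B. Im (g x) \<partial>M)" if B: "B \<in> sets (\<A> n)" for B
  proof -
    have [measurable]: "B \<in> sets M"
      using B sub[OF n] by (auto simp: subalgebra_def)
    have i: "integrable M (\<lambda>x. indicator B x * f x)" "integrable M (\<lambda>x. indicator B x * g x)"
      using f g by (auto intro: Bochner_Integration.integrable_bound simp: norm_mult split: split_indicator)
    have ind: "Re (indicator B x * z) = indicator B x * Re z" "Im (indicator B x * z) = indicator B x * Im z" for x z
      by (auto split: split_indicator)
    show "(\<integral>x\<in>B. Re (f x) \<partial>M) = (\<integral>x\<in>B. Re (g x) \<partial>M)"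
      using arg_cong[OF eq[OF B], of Re, folded integral_Re[OF i(1)] integral_Re[OF i(2)], unfolded ind]
      by (simp add: set_lebesgue_integral_def)
    show "(\<integral>x\<in>B. Im (f x) \<partial>M) = (\<integral>x\<in>B. Im (g x) \<partial>M)"
      using arg_cong[OF eq[OF B], of Im, folded integral_Im[OF i(1)] integral_Im[OF i(2)], unfolded ind]
      by (simp add: set_lebesgue_integral_def)
  qed
  have "AE x in M. real_cond_exp M (\<A> n) (\<lambda>x. Re (f x)) x = Re (g x)"
    "AE x in M. real_cond_exp M (\<A> n) (\<lambda>x. Im (f x)) x = Im (g x)"
    using f g g' by (auto intro!: S.real_cond_exp_charact *)
  then show ?thesis
    by eventually_elim (use n in \<open>simp add: cexp_def complex_eq_iff\<close>)
qed

lemma integral_indicator_cexp: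
  assumes n: "n \<ge> 1" and f: "integrable M f" and B: "B \<in> sets (\<A> n)"
  shows "(\<integral>x. indicator B x * E n f x \<partial>M) = (\<integral>x. indicator B x * f x \<partial>M)"
proof (rule integral_mult_cexp(2)[OF n])
  show "(indicator B :: 'a \<Rightarrow> complex) \<in> borel_measurable (\<A> n)"
    using B by simp
  then have [measurable]: "(indicator B :: 'a \<Rightarrow> complex) \<in> borel_measurable M"
    using n measurable_filtration by blast
  show "integrable M (\<lambda>x. indicator B x * f x)"
    using f by (auto intro: Bochner_Integration.integrable_bound simp: norm_mult split: split_indicator)
qed (use f in auto)

lemma cexp_add:
  assumes "integrable M f" "integrable M g"
  shows "AE x in M. E n (\<lambda>y. f y + g y) x = E n f x + E n g x"
proof (cases "n = 0")
  case False
  then interpret S: sigma_finite_subalgebra M "\<A> n"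
    by (intro sigma_finite_subalgebra_filtration) auto
  have "AE x in M. Re (E n (\<lambda>y. f y + g y) x) = Re (E n f x) + Re (E n g x)"
    "AE x in M. Im (E n (\<lambda>y. f y + g y) x) = Im (E n f x) + Im (E n g x)"
    using False assms by (auto simp: cexp_def intro!: S.real_cond_exp_add)
  then show ?thesis
    by eventually_elim (simp add: complex_eq_iff)
qed simp

text \<open>A complex factor mixes real and imaginary parts, so the identity is tested on sets
  instead of being read off from the components, as it is for sums.\<close>

lemma cexp_cmult:
  assumes "integrable M f"
  shows "AE x in M. E n (\<lambda>y. c * f y) x = c * E n f x"
proof (cases "n = 0")
  case False
  show ?thesis
  proof (rule cexp_charact)
    fix B assume B: "B \<in> sets (\<A> n)"
    have "(\<integral>x. indicator B x * (c * E n f x) \<partial>M) = c * (\<integral>x. indicator B x * E n f x \<partial>M)"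
      by (simp add: mult.left_commute)
    also have "\<dots> = c * (\<integral>x. indicator B x * f x \<partial>M)"
      using integral_indicator_cexp[OF _ assms B] False by simp
    also have "\<dots> = (\<integral>x. indicator B x * (c * f x) \<partial>M)"
      by (simp add: mult.left_commute)
    finally show "(\<integral>x. indicator B x * (c * f x) \<partial>M) = (\<integral>x. indicator B x * (c * E n f x) \<partial>M)" ..
  qed (use False assms cexp_measurable_filtration[of n f] in \<open>auto intro: cexp_integrable\<close>)
qed simp

lemma cexp_const:
  assumes "n \<ge> 1"
  shows "AE x in M. E n (\<lambda>_. c) x = c"
  using assms by (intro cexp_charact) auto

text \<open>With s = sgn (E n f), \<open>norm (E n f x)\<close> is the real part of conj(s) times E
  n f. As s is measurable for \<open>\<A> n\<close> and has modulus at most 1, it moves inside the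
  conditional expectation, where Re (conj(s) f) is at most \<open>norm (f x)\<close>. The functions
  u and v are the real and imaginary parts of s.\<close>

lemma norm_cexp_le:
  assumes n: "n \<ge> 1" and f: "integrable M f"
  shows "AE x in M. norm (E n f x) \<le> real_cond_exp M (\<A> n) (\<lambda>y. norm (f y)) x"
proof -
  interpret S: sigma_finite_subalgebra M "\<A> n"
    using n by (rule sigma_finite_subalgebra_filtration)
  have [measurable]: "f \<in> borel_measurable M" using f by measurable
  define u where "u = (\<lambda>x. Re (sgn (E n f x)))"
  define v where "v = (\<lambda>x. Im (sgn (E n f x)))"
  have [measurable]: "E n f \<in> borel_measurable (\<A> n)"
    using n by (rule cexp_measurable_filtration)
  have uv [measurable]: "u \<in> borel_measurable (\<A> n)" "v \<in> borel_measurable (\<A> n)"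
    unfolding u_def v_def sgn_div_norm by measurable
  have [measurable]: "u \<in> borel_measurable M" "v \<in> borel_measurable M"
    using uv[THEN measurable_from_subalg[OF S.subalg]] .
  have uv_le: "\<bar>u x\<bar> \<le> 1" "\<bar>v x\<bar> \<le> 1" "(u x)\<^sup>2 + (v x)\<^sup>2 \<le> 1" for x
  proof -
    have "norm (sgn (E n f x)) \<le> 1" by (simp add: norm_sgn)
    then show "\<bar>u x\<bar> \<le> 1" "\<bar>v x\<bar> \<le> 1" "(u x)\<^sup>2 + (v x)\<^sup>2 \<le> 1"
      using abs_Re_le_cmod[of "sgn (E n f x)"] abs_Im_le_cmod[of "sgn (E n f x)"]
        cmod_power2[of "sgn (E n f x)"] power_le_one[of "norm (sgn (E n f x))" 2]
      by (simp_all add: u_def v_def)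
  qed
  have int: "integrable M (\<lambda>x. u x * Re (f x))" "integrable M (\<lambda>x. v x * Im (f x))"
    using mult_mono[OF uv_le(1) abs_Re_le_cmod[of "f _"]] mult_mono[OF uv_le(2) abs_Im_le_cmod[of "f _"]]
    by (auto intro!: Bochner_Integration.integrable_bound[OF f] simp: abs_mult)
  have polar: "norm z = Re (sgn z) * Re z + Im (sgn z) * Im z" for z :: complex
  proof (cases "z = 0")
    case False
    have "Re (sgn z) * Re z + Im (sgn z) * Im z = ((Re z)\<^sup>2 + (Im z)\<^sup>2) / norm z"
      by (simp add: sgn_div_norm power2_eq_square divide_inverse_commute distrib_left mult.assoc)
    also have "\<dots> = norm z"
      using False by (simp flip: cmod_power2) (simp add: power2_eq_square)
    finally show ?thesis ..
  qed simp
  have "u x * Re (f x) + v x * Im (f x) \<le> norm (f x)" for x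
  proof -
    have "u x * Re (f x) + v x * Im (f x) = Re (Complex (u x) (- v x) * f x)"
      by simp
    also have "\<dots> \<le> norm (Complex (u x) (- v x)) * norm (f x)"
      unfolding norm_mult[symmetric] by (rule complex_Re_le_cmod)
    also have "\<dots> \<le> 1 * norm (f x)"
      using uv_le(3) by (intro mult_right_mono) (auto simp: cmod_def)
    finally show ?thesis by simp
  qed
  then have "AE x in M. real_cond_exp M (\<A> n) (\<lambda>x. u x * Re (f x) + v x * Im (f x)) x
      \<le> real_cond_exp M (\<A> n) (\<lambda>x. norm (f x)) x"
    using int f by (intro S.real_cond_exp_mono) auto
  moreover have "AE x in M. real_cond_exp M (\<A> n) (\<lambda>x. u x * Re (f x) + v x * Im (f x)) x =
      real_cond_exp M (\<A> n) (\<lambda>x. u x * Re (f x)) x + real_cond_exp M (\<A> n) (\<lambda>x. v x * Im (f x)) x"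
    using int by (rule S.real_cond_exp_add)
  moreover have "AE x in M. real_cond_exp M (\<A> n) (\<lambda>x. u x * Re (f x)) x = u x * Re (E n f x)"
    "AE x in M. real_cond_exp M (\<A> n) (\<lambda>x. v x * Im (f x)) x = v x * Im (E n f x)"
    using int n by (auto simp: Re_cexp Im_cexp intro!: S.real_cond_exp_mult)
  ultimately show ?thesis
    unfolding u_def v_def by eventually_elim (simp only: polar)
qed

text \<open>Domination by the conditional expectation of \<open>norm (f y)\<close> leaves a constant
  bound when p is infinite and conditional Jensen for the power when p is finite; the conditional
  expectation of \<open>norm (f y) powr r\<close> then has the same integral as the function
  itself.\<close>

lemma Lp_cexp:
  assumes p: "p \<ge> 1" and f: "f \<in> Lp M p"
  shows "E n f \<in> Lp M p" "Lp_norm M p (E n f) \<le> Lp_norm M p f"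
proof -
  have "E n f \<in> Lp M p \<and> Lp_norm M p (E n f) \<le> Lp_norm M p f"
  proof (cases "n = 0")
    case True
    then show ?thesis using Lp_zero[OF p, of M] by simp
  next
    case False
    then have n: "n \<ge> 1" by simp
    interpret S: sigma_finite_subalgebra M "\<A> n"
      using n by (rule sigma_finite_subalgebra_filtration)
    have int: "integrable M f" using Lp_subset_L1[OF p f] .
    note le = norm_cexp_le[OF n int]
    from p show ?thesis
    proof (cases rule: exponent_cases)
      case infinity
      then have "AE x in M. norm (f x) \<le> Lp_norm M p f"
        using Lp_infinity_le_iff[of "Lp_norm M p f" f M] f by simp
      then have "AE x in M. real_cond_exp M (\<A> n) (\<lambda>y. norm (f y)) x \<le> Lp_norm M p f"
        using int by (intro S.real_cond_exp_le_c) auto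
      with le have "AE x in M. norm (E n f x) \<le> Lp_norm M p f"
        by eventually_elim simp
      then show ?thesis
        using Lp_infinity_le_iff[of "Lp_norm M p f" "E n f" M] infinity by simp
    next
      case (finite r)
      let ?g = "real_cond_exp M (\<A> n) (\<lambda>y. norm (f y))"
      let ?G = "real_cond_exp M (\<A> n) (\<lambda>y. norm (f y) powr r)"
      have intr: "integrable M (\<lambda>x. norm (f x) powr r)"
        using f finite by (simp add: Lp_def)
      have "AE x in M. \<bar>?g x\<bar> powr r \<le> real_cond_exp M (\<A> n) (\<lambda>x. \<bar>norm (f x)\<bar> powr r) x"
        using finite int intr
        by (intro S.real_cond_exp_jensens_inequality(2)[where I=UNIV and q="\<lambda>t. \<bar>t\<bar> powr r"])
          (auto intro: convex_on_abs_powr)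
      with le have "AE x in M. norm (E n f x) powr r \<le> ?G x"
      proof eventually_elim
        case (elim x)
        have "norm (E n f x) powr r \<le> \<bar>?g x\<bar> powr r"
          using elim(1) finite by (intro powr_mono2) auto
        with elim(2) show ?case by simp
      qed
      then have "(\<integral>\<^sup>+x. ennreal (norm (E n f x) powr r) \<partial>M) \<le> (\<integral>\<^sup>+x. ennreal (?G x) \<partial>M)"
        by (intro nn_integral_mono_AE) (auto elim!: eventually_mono intro: ennreal_leI)
      also have "\<dots> = ennreal (\<integral>x. ?G x \<partial>M)"
        using intr by (intro nn_integral_eq_integral S.real_cond_exp_int S.real_cond_exp_pos) auto
      also have "\<dots> = ennreal (\<integral>x. norm (f x) powr r \<partial>M)"
        using S.real_cond_exp_int(2)[OF intr] by simp
      also have "\<dots> = (\<integral>\<^sup>+x. ennreal (norm (f x) powr r) \<partial>M)"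
        using intr by (intro nn_integral_eq_integral[symmetric]) auto
      also have "\<dots> \<le> ennreal (Lp_norm M p f powr r)"
        using Lp_finite_le_iff[of "Lp_norm M p f" r f M] f finite by simp
      finally show ?thesis
        using Lp_finite_le_iff[of "Lp_norm M p f" r "E n f" M] finite by simp
    qed
  qed
  then show "E n f \<in> Lp M p" "Lp_norm M p (E n f) \<le> Lp_norm M p f" by auto
qed

text \<open>For m \<le> n every set of \<open>\<A> m\<close> lies in \<open>\<A> n\<close>, so the
  integrals over it agree. Otherwise \<open>E n f\<close> is already measurable for
  \<open>\<A> m\<close>.\<close>

lemma cexp_cexp:
  assumes m: "m \<ge> 1" and n: "n \<ge> 1" and f: "integrable M f"
  shows "AE x in M. E m (E n f) x = E (min m n) f x"
proof (cases "m \<le> n")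
  case True
  have "AE x in M. E m (E n f) x = E m f x"
  proof (rule AE_symmetric, rule cexp_charact[OF m f])
    fix B assume B: "B \<in> sets (\<A> m)"
    then have B': "B \<in> sets (\<A> n)"
      using subalgebra_filtration[OF m True] by (auto simp: subalgebra_def)
    show "(\<integral>x. indicator B x * f x \<partial>M) = (\<integral>x. indicator B x * E m (E n f) x \<partial>M)"
      using integral_indicator_cexp[OF m cexp_integrable[OF f] B] integral_indicator_cexp[OF n f B'] by simp
  qed (auto intro!: cexp_integrable f cexp_measurable_filtration m)
  with True show ?thesis by (simp add: min_def)
next
  case False
  have "E n f \<in> borel_measurable (\<A> m)"
    using measurable_from_subalg[OF subalgebra_filtration cexp_measurable_filtration] n False by auto
  then have "AE x in M. E m (E n f) x = E n f x"
    using m by (intro cexp_charact) (auto intro!: cexp_integrable f)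
  with False show ?thesis by (simp add: min_def)
qed

text \<open>Both sides have the same integrals over the sets of \<open>\<A> n\<close>, term by term;
  the common L_1 bound B and the summability of \<open>norm (v k)\<close> justify exchanging sum and
  integral.\<close>

lemma cexp_suminf:
  assumes n: "n \<ge> 1" and u: "\<And>k. u k \<in> Lp M 1" and B: "\<And>k. Lp_norm M 1 (u k) \<le> B"
    and v: "summable (\<lambda>k. norm (v k))"
  shows "AE x in M. E n (\<lambda>x. \<Sum>k. v k * u k x) x = (\<Sum>k. v k * E n (u k) x)"
proof (rule cexp_charact[OF n])
  note Eu = Lp_cexp[OF order_refl u, of n]
  have EB: "Lp_norm M 1 (E n (u k)) \<le> B" for k
    using Eu(2) B order_trans by blast
  have int: "integrable M (\<lambda>x. \<Sum>k. v k * w k x)"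
    and sum: "AE x in M. summable (\<lambda>k. norm (v k * w k x))"
    if "\<And>k. w k \<in> Lp M 1" "\<And>k. Lp_norm M 1 (w k) \<le> B" for w
    using Lp_suminf(1,2)[of 1 w M B v] that v by (auto simp: Lp_1_iff)
  show "integrable M (\<lambda>x. \<Sum>k. v k * u k x)" by (rule int[OF u B])
  show "integrable M (\<lambda>x. \<Sum>k. v k * E n (u k) x)" by (rule int[OF Eu(1) EB])
  show "(\<lambda>x. \<Sum>k. v k * E n (u k) x) \<in> borel_measurable (\<A> n)"
    using cexp_measurable_filtration[OF n] by measurable
  fix B' assume B': "B' \<in> sets (\<A> n)"
  then have [measurable]: "B' \<in> sets M"
    using sub[OF n] by (auto simp: subalgebra_def)
  \<comment> \<open>Stated for an arbitrary sequence w, since it serves both the \<open>u k\<close>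
    and their conditional expectations.\<close>
  have sums: "(\<integral>x. indicator B' x * (\<Sum>k. v k * w k x) \<partial>M) = (\<Sum>k. v k * (\<integral>x. indicator B' x * w k x \<partial>M))"
    if w: "\<And>k. w k \<in> Lp M 1" "\<And>k. Lp_norm M 1 (w k) \<le> B" for w
  proof -
    have wi: "integrable M (w k)" for k using w by (simp add: Lp_1_iff)
    have wi': "integrable M (\<lambda>x. indicator B' x * w k x)" for k
      using wi[of k] by (auto intro: Bochner_Integration.integrable_bound simp: norm_mult split: split_indicator)
    have "(\<integral>x. indicator B' x * (\<Sum>k. v k * w k x) \<partial>M) = (\<integral>x. (\<Sum>k. v k * (indicator B' x * w k x)) \<partial>M)"
      by (intro Bochner_Integration.integral_cong) (auto split: split_indicator)
    also have "\<dots> = (\<Sum>k. \<integral>x. v k * (indicator B' x * w k x) \<partial>M)"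
    proof (rule integral_suminf)
      show "integrable M (\<lambda>x. v k * (indicator B' x * w k x))" for k
        using wi' by simp
      show "AE x in M. summable (\<lambda>k. norm (v k * (indicator B' x * w k x)))"
        using sum[OF w] by eventually_elim (auto split: split_indicator)
      have "norm (\<integral>x. norm (v k * (indicator B' x * w k x)) \<partial>M) \<le> norm (v k) * B" for k
      proof -
        have "(\<integral>x. norm (v k * (indicator B' x * w k x)) \<partial>M) \<le> (\<integral>x. norm (v k) * norm (w k x) \<partial>M)"
          using wi by (intro integral_mono integrable_norm integrable_mult_right wi')
            (auto simp: norm_mult split: split_indicator)
        also have "\<dots> \<le> norm (v k) * B"
          using w(2)[of k] wi[of k] by (simp add: Lp_norm_def mult_left_mono)
        finally show ?thesis by simp
      qed
      then show "summable (\<lambda>k. \<integral>x. norm (v k * (indicator B' x * w k x)) \<partial>M)"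
        by (intro summable_comparison_test'[OF summable_mult2[OF v, of B], of 0]) auto
    qed
    finally show ?thesis by simp
  qed
  show "(\<integral>x. indicator B' x * (\<Sum>k. v k * u k x) \<partial>M) = (\<integral>x. indicator B' x * (\<Sum>k. v k * E n (u k) x) \<partial>M)"
    unfolding sums[OF u B] sums[OF Eu(1) EB]
    using integral_indicator_cexp[OF n _ B'] u by (simp add: Lp_1_iff)
qed

text \<open>Both sides equal the inner product of \<open>E n f\<close> and \<open>E n g\<close>,
  because the conjugate of either one is a multiplier measurable for \<open>\<A> n\<close>.\<close>

lemma cexp_selfadjoint:
  assumes f: "f \<in> Lp M 2" and g: "g \<in> Lp M 2"
  shows "L2_inner M (E n f) g = L2_inner M f (E n g)"
proof (cases "n = 0")
  case False
  then have n: "n \<ge> 1" by simp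
  note Ef = Lp_cexp(1)[OF one_le_two_ennreal f, of n]
  note Eg = Lp_cexp(1)[OF one_le_two_ennreal g, of n]
  have [measurable]: "f \<in> borel_measurable M" "g \<in> borel_measurable M"
    using f g by measurable
  have "(\<integral>x. cnj (E n f x) * E n g x \<partial>M) = (\<integral>x. cnj (E n f x) * g x \<partial>M)"
    using L2_mult_integrable(2)[OF g Ef] cexp_measurable_filtration[OF n, of f] n
    by (intro integral_mult_cexp) (auto simp: mult.commute)
  then have "(\<integral>x. cnj (cnj (E n f x) * E n g x) \<partial>M) = (\<integral>x. cnj (cnj (E n f x) * g x) \<partial>M)"
    by (simp only: Bochner_Integration.integral_cnj)
  moreover have "(\<integral>x. cnj (E n g x) * E n f x \<partial>M) = (\<integral>x. cnj (E n g x) * f x \<partial>M)"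
    using L2_mult_integrable(2)[OF f Eg] cexp_measurable_filtration[OF n, of g] n
    by (intro integral_mult_cexp) (auto simp: mult.commute)
  ultimately show ?thesis
    by (simp add: L2_inner_def mult.commute)
qed (simp add: L2_inner_def)

end

subsection \<open>Sequences of bounded variation\<close>

text \<open>A sequence \<open>c\<close> plays the role of a symbol: \<open>mult_op c\<close> below is the operator that multiplies
  the martingale difference \<open>dE\<^sub>n\<close>, \<open>n \<ge> 1\<close>, by \<open>c n\<close>. Summation by parts writes it as a series
  in the \<open>E\<^sub>n\<close> with coefficients \<open>coef c\<close>, where the index 0 stands for the identity.\<close>

definition bv :: "(nat \<Rightarrow> complex) \<Rightarrow> bool" where
  "bv c \<longleftrightarrow> summable (\<lambda>n. norm (c n - c (Suc n)))"

definition coef :: "(nat \<Rightarrow> complex) \<Rightarrow> nat \<Rightarrow> complex" where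
  "coef c n = (if n = 0 then lim c else c n - c (Suc n))"

lemma coef_Suc [simp]: "coef c (Suc n) = c (Suc n) - c (Suc (Suc n))"
  by (simp add: coef_def)

lemma bv_LIMSEQ:
  assumes "bv c"
  shows "c \<longlonglongrightarrow> lim c"
proof -
  have "summable (\<lambda>n. c n - c (Suc n))"
    using assms unfolding bv_def by (rule summable_norm_cancel)
  then have "convergent (\<lambda>n. \<Sum>k<n. c k - c (Suc k))"
    by (simp add: summable_iff_convergent)
  then have "convergent (\<lambda>n. c 0 - (\<Sum>k<n. c k - c (Suc k)))"
    by (intro convergent_diff convergent_const)
  moreover have "c 0 - (\<Sum>k<n. c k - c (Suc k)) = c n" for n
    by (simp add: sum_lessThan_telescope')
  ultimately show ?thesis
    by (simp add: convergent_LIMSEQ_iff)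
qed

lemma bv_bounded:
  assumes "bv c"
  obtains K where "K > 0" "\<And>n. norm (c n) \<le> K"
  using convergent_imp_Bseq[OF convergentI[OF bv_LIMSEQ[OF assms]]] BseqE by metis

lemma summable_coef:
  assumes "bv c"
  shows "summable (\<lambda>n. norm (coef c n))"
  using assms summable_Suc_iff[of "\<lambda>n. norm (coef c n)"] summable_Suc_iff[of "\<lambda>n. norm (c n - c (Suc n))"]
  by (simp add: bv_def)

lemma bv_add:
  assumes "bv c" "bv d"
  shows "bv (\<lambda>n. c n + d n)"
  unfolding bv_def
  by (rule summable_comparison_test'[OF summable_add[OF assms[unfolded bv_def]], of 0])
    (use norm_triangle_ineq[of "c _ - c (Suc _)" "d _ - d (Suc _)"] in \<open>simp add: algebra_simps\<close>)

text \<open>The discrete product rule, with both sequences bounded.\<close>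

lemma bv_mult:
  assumes "bv c" "bv d"
  shows "bv (\<lambda>n. c n * d n)"
proof -
  obtain K where K: "K > 0" "\<And>n. norm (c n) \<le> K" using bv_bounded[OF assms(1)] by metis
  obtain L where L: "L > 0" "\<And>n. norm (d n) \<le> L" using bv_bounded[OF assms(2)] by metis
  have s: "summable (\<lambda>n. K * norm (d n - d (Suc n)) + norm (c n - c (Suc n)) * L)"
    using assms unfolding bv_def by (intro summable_add summable_mult summable_mult2)
  have "norm (c n * d n - c (Suc n) * d (Suc n)) \<le> K * norm (d n - d (Suc n)) + norm (c n - c (Suc n)) * L" for n
  proof -
    have "c n * d n - c (Suc n) * d (Suc n) = c n * (d n - d (Suc n)) + (c n - c (Suc n)) * d (Suc n)"
      by (simp add: algebra_simps)
    also have "norm \<dots> \<le> norm (c n) * norm (d n - d (Suc n)) + norm (c n - c (Suc n)) * norm (d (Suc n))"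
      by (simp only: norm_mult[symmetric] norm_triangle_ineq)
    also have "\<dots> \<le> K * norm (d n - d (Suc n)) + norm (c n - c (Suc n)) * L"
      using K L by (intro add_mono mult_right_mono mult_left_mono) auto
    finally show ?thesis .
  qed
  then show ?thesis
    unfolding bv_def by (intro summable_comparison_test'[OF s, of 0]) auto
qed

lemma bv_const [simp]: "bv (\<lambda>_. k)"
  by (simp add: bv_def)

lemma bv_power: "bv c \<Longrightarrow> bv (\<lambda>n. c n ^ i)"
  by (induction i) (auto intro: bv_mult)

lemma bv_sum: "(\<And>i. i \<in> I \<Longrightarrow> bv (c i)) \<Longrightarrow> bv (\<lambda>n. \<Sum>i\<in>I. c i n)"
  by (induction I rule: infinite_finite_induct) (auto intro: bv_add)

lemma bv_diff: "bv c \<Longrightarrow> bv d \<Longrightarrow> bv (\<lambda>n. c n - d n)"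
  using bv_add[of c "\<lambda>n. - 1 * d n"] bv_mult[of "\<lambda>_. -1" d] by simp

lemma bv_eventually_const:
  assumes "\<And>n. n \<ge> N \<Longrightarrow> c n = k"
  shows "bv c"
  unfolding bv_def
  by (rule summable_comparison_test'[of "\<lambda>_. 0" N]) (simp_all add: assms)

lemma lim_eventually_const:
  assumes "\<And>n. n \<ge> N \<Longrightarrow> c n = (k::complex)"
  shows "lim c = k"
  by (intro limI tendsto_eventually eventually_sequentiallyI[of N]) (rule assms)

text \<open>Past n the sequence y is constant, like \<open>E (min (Suc n) k) f\<close> in k. The
  coefficients there telescope to \<open>d (Suc n) - lim d\<close>, and the term at index 0, where y
  has the same value, adds \<open>lim d\<close> back.\<close>

lemma coef_mult_sum:
  assumes d: "bv d"
    and y: "y 0 = y (Suc n)" "\<And>k. k \<ge> Suc n \<Longrightarrow> y k = y (Suc n)"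
  shows "(\<Sum>k. coef d k * y k) = (\<Sum>k<n. (d (Suc k) - d (Suc (Suc k))) * y (Suc k)) + d (Suc n) * y (Suc n)"
proof -
  have "(\<lambda>k. d (k + Suc n)) \<longlonglongrightarrow> lim d"
    using bv_LIMSEQ[OF d] LIMSEQ_ignore_initial_segment by blast
  from telescope_sums'[OF this] have "(\<lambda>k. d (k + Suc n) - d (Suc (k + Suc n))) sums (d (Suc n) - lim d)"
    by simp
  from sums_mult2[OF this, of "y (Suc n)"]
  have "(\<lambda>k. coef d (k + Suc n) * y (k + Suc n)) sums ((d (Suc n) - lim d) * y (Suc n))"
    using y(2)[of "k + Suc n" for k] by simp
  then have "(\<lambda>k. coef d k * y k) sums ((d (Suc n) - lim d) * y (Suc n) + (\<Sum>k<Suc n. coef d k * y k))"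
    by (rule sums_iff_shift[THEN iffD1])
  moreover have "(\<Sum>k<Suc n. coef d k * y k) = lim d * y (Suc n) + (\<Sum>k<n. (d (Suc k) - d (Suc (Suc k))) * y (Suc k))"
    using y(1) by (simp only: sum.lessThan_Suc_shift) (simp add: coef_def)
  ultimately have "(\<Sum>k. coef d k * y k) = (d (Suc n) - lim d) * y (Suc n) +
      (lim d * y (Suc n) + (\<Sum>k<n. (d (Suc k) - d (Suc (Suc k))) * y (Suc k)))"
    by (simp only: sums_iff)
  then show ?thesis
    by (simp add: left_diff_distrib)
qed

text \<open>The scalar form of the product rule for symbols: \<open>y k\<close> stands for the value
  of \<open>lev k f\<close> and \<open>z n\<close> for that of \<open>lev n\<close> applied to the
  output of the operator with symbol d. The index 0 terms carry the limits, and they balance because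
  the limit of the product is the product of the limits.\<close>

lemma coef_product:
  assumes c: "bv c" and d: "bv d"
    and z0: "z 0 = (\<Sum>k. coef d k * y k)"
    and z: "\<And>n. z (Suc n) = (\<Sum>k<n. (d (Suc k) - d (Suc (Suc k))) * y (Suc k)) + d (Suc n) * y (Suc n)"
    and sd: "summable (\<lambda>k. coef d k * y k)" and sz: "summable (\<lambda>k. coef c k * z k)"
    and scd: "summable (\<lambda>k. coef (\<lambda>n. c n * d n) k * y k)"
  shows "(\<Sum>k. coef c k * z k) = (\<Sum>k. coef (\<lambda>n. c n * d n) k * y k)"
proof -
  let ?S = "\<lambda>N. \<Sum>k<N. (d (Suc k) - d (Suc (Suc k))) * y (Suc k)"
  let ?T = "\<lambda>N. \<Sum>n<N. (c (Suc n) * d (Suc n) - c (Suc (Suc n)) * d (Suc (Suc n))) * y (Suc n)"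
  have lim: "(\<lambda>N. \<Sum>n<N. f (Suc n)) \<longlonglongrightarrow> suminf f - f 0" if "summable f" for f :: "nat \<Rightarrow> complex"
    using that summable_LIMSEQ[of "\<lambda>n. f (Suc n)"] suminf_split_head[of f] by (simp add: summable_Suc_iff)
  \<comment> \<open>Abel summation: z grows by
    \<open>d (Suc (Suc n)) * (y (Suc (Suc n)) - y (Suc n))\<close>, and the boundary term pairs
    \<open>c (Suc N)\<close> with \<open>?S N\<close>.\<close>
  have "(\<Sum>n<N. (c (Suc n) - c (Suc (Suc n))) * z (Suc n)) = ?T N - c (Suc N) * ?S N" for N
    by (induction N) (simp_all add: z algebra_simps)
  moreover have "(\<lambda>N. \<Sum>n<N. (c (Suc n) - c (Suc (Suc n))) * z (Suc n))
      \<longlonglongrightarrow> (\<Sum>k. coef c k * z k) - lim c * z 0"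
    using lim[OF sz] by (simp add: coef_def[of _ 0])
  moreover have "(\<lambda>N. ?T N - c (Suc N) * ?S N) \<longlonglongrightarrow>
      ((\<Sum>k. coef (\<lambda>n. c n * d n) k * y k) - lim c * lim d * y 0) - lim c * (z 0 - lim d * y 0)"
  proof (intro tendsto_diff tendsto_mult)
    have "lim (\<lambda>n. c n * d n) = lim c * lim d"
      using bv_LIMSEQ[OF c] bv_LIMSEQ[OF d] by (intro limI tendsto_mult)
    then show "?T \<longlonglongrightarrow> (\<Sum>k. coef (\<lambda>n. c n * d n) k * y k) - lim c * lim d * y 0"
      using lim[OF scd] by (simp add: coef_def[of _ 0])
    show "(\<lambda>N. c (Suc N)) \<longlonglongrightarrow> lim c"
      using bv_LIMSEQ[OF c] by (rule LIMSEQ_Suc)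
    show "?S \<longlonglongrightarrow> z 0 - lim d * y 0"
      using lim[OF sd] by (simp add: coef_def[of _ 0] z0)
  qed
  ultimately have "(\<Sum>k. coef c k * z k) - lim c * z 0 =
      ((\<Sum>k. coef (\<lambda>n. c n * d n) k * y k) - lim c * lim d * y 0) - lim c * (z 0 - lim d * y 0)"
    using LIMSEQ_unique by simp
  then show ?thesis by (simp add: algebra_simps)
qed

subsection \<open>Absolutely convergent series of conditional expectations\<close>

context filtered_prob_space
begin

text \<open>The convention at 0 differs from that of \<open>cexp\<close>, which is the zero operator
  there: a symbol with nonzero limit, such as that of a resolvent, requires a multiple of the
  identity.\<close>

definition lev :: "nat \<Rightarrow> 'a operator" where
  "lev n f = (if n = 0 then f else E n f)"

text \<open>The sum is pointwise rather than a limit in some norm, so one formula serves all p;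
  \<open>Lp_suminf\<close> supplies absolute convergence almost everywhere.\<close>

definition wsum :: "(nat \<Rightarrow> complex) \<Rightarrow> 'a operator" where
  "wsum v f = (\<lambda>x. \<Sum>n. v n * lev n f x)"

definition mult_op :: "(nat \<Rightarrow> complex) \<Rightarrow> 'a operator" where
  "mult_op c = wsum (coef c)"

lemma lev_0 [simp]: "lev 0 f = f" and lev_Suc: "lev (Suc n) f = E (Suc n) f"
  by (simp_all add: lev_def)

lemma lev_pos: "n \<ge> 1 \<Longrightarrow> lev n f = E n f"
  by (simp add: lev_def)

lemma lev_measurable [measurable]: "f \<in> borel_measurable M \<Longrightarrow> lev n f \<in> borel_measurable M"
  by (simp add: lev_def)

lemma wsum_measurable [measurable]: "f \<in> borel_measurable M \<Longrightarrow> wsum v f \<in> borel_measurable M"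
  unfolding wsum_def by measurable

lemma Lp_lev:
  assumes "p \<ge> 1" "f \<in> Lp M p"
  shows "lev n f \<in> Lp M p" "Lp_norm M p (lev n f) \<le> Lp_norm M p f"
  using Lp_cexp[OF assms] assms by (auto simp: lev_def)

lemma Lp_wsum:
  assumes "p \<ge> 1" "f \<in> Lp M p" "summable (\<lambda>n. norm (v n))"
  shows "AE x in M. summable (\<lambda>n. norm (v n * lev n f x))"
    and "wsum v f \<in> Lp M p"
    and "Lp_norm M p (wsum v f) \<le> (\<Sum>n. norm (v n)) * Lp_norm M p f"
  unfolding wsum_def using Lp_suminf[OF assms(1) Lp_lev[OF assms(1,2)] assms(3)] by auto

lemma AE_summable_wsum:
  assumes "integrable M f" "summable (\<lambda>n. norm (v n))"
  shows "AE x in M. summable (\<lambda>n. v n * lev n f x)"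
  using Lp_wsum(1)[of 1 f v] assms by (auto simp: Lp_1_iff elim!: eventually_mono dest: summable_norm_cancel)

lemma integrable_wsum:
  assumes "integrable M f" "summable (\<lambda>n. norm (v n))"
  shows "integrable M (wsum v f)"
  using Lp_wsum(2)[of 1 f v] assms by (simp add: Lp_1_iff)

lemma wsum_cong_AE:
  assumes "AE x in M. f x = g x" "f \<in> borel_measurable M" "g \<in> borel_measurable M"
  shows "AE x in M. wsum v f x = wsum v g x"
proof -
  have "AE x in M. lev n f x = lev n g x" for n
    using assms cexp_cong_AE[OF assms] by (simp add: lev_def)
  then have "AE x in M. \<forall>n. lev n f x = lev n g x"
    by (simp add: AE_all_countable)
  then show ?thesis
    by eventually_elim (simp add: wsum_def)
qed

lemma wsum_add:
  assumes f: "integrable M f" and g: "integrable M g" and v: "summable (\<lambda>n. norm (v n))"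
  shows "AE x in M. wsum v (\<lambda>y. f y + g y) x = wsum v f x + wsum v g x"
proof -
  have "AE x in M. lev n (\<lambda>y. f y + g y) x = lev n f x + lev n g x" for n
    using cexp_add[OF f g] by (simp add: lev_def)
  then have "AE x in M. \<forall>n. lev n (\<lambda>y. f y + g y) x = lev n f x + lev n g x"
    by (simp add: AE_all_countable)
  with AE_summable_wsum[OF f v] AE_summable_wsum[OF g v] show ?thesis
    by eventually_elim (simp add: wsum_def ring_distribs suminf_add)
qed

lemma wsum_cmult:
  assumes f: "integrable M f" and v: "summable (\<lambda>n. norm (v n))"
  shows "AE x in M. wsum v (\<lambda>y. c * f y) x = c * wsum v f x"
proof -
  have "AE x in M. lev n (\<lambda>y. c * f y) x = c * lev n f x" for n
    using cexp_cmult[OF f] by (simp add: lev_def)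
  then have "AE x in M. \<forall>n. lev n (\<lambda>y. c * f y) x = c * lev n f x"
    by (simp add: AE_all_countable)
  with AE_summable_wsum[OF f v] show ?thesis
    by eventually_elim (simp add: wsum_def suminf_mult mult.left_commute)
qed

lemma wsum_lincomb:
  assumes f: "integrable M f" and "summable (\<lambda>n. norm (v n))" "summable (\<lambda>n. norm (w n))"
  shows "AE x in M. wsum (\<lambda>n. a * v n + b * w n) f x = a * wsum v f x + b * wsum w f x"
  using AE_summable_wsum[OF f assms(2)] AE_summable_wsum[OF f assms(3)]
proof eventually_elim
  case (elim x)
  then have "(\<lambda>n. a * (v n * lev n f x) + b * (w n * lev n f x)) sums (a * wsum v f x + b * wsum w f x)"
    unfolding wsum_def by (intro sums_add sums_mult summable_sums)
  then show ?case
    by (simp add: wsum_def sums_iff algebra_simps)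
qed

lemma wsum_finite:
  assumes "finite I" "\<And>n. n \<notin> I \<Longrightarrow> v n = 0"
  shows "wsum v f = (\<lambda>x. \<Sum>n\<in>I. v n * lev n f x)"
  unfolding wsum_def using assms by (intro ext suminf_finite) auto

lemma mult_op_const: "mult_op (\<lambda>_. k) f = (\<lambda>x. k * f x)"
  unfolding mult_op_def by (subst wsum_finite[of "{0}"]) (auto simp: coef_def)

text \<open>The symbol selects the first n differences; its only jump, at n, leaves the single term
  \<open>E n\<close>.\<close>

lemma mult_op_cexp:
  assumes "n \<ge> 1"
  shows "mult_op (\<lambda>k. if k \<le> n then 1 else 0) f = E n f"
proof -
  have "lim (\<lambda>k. if k \<le> n then 1 else (0::complex)) = 0"
    by (rule lim_eventually_const[of "Suc n"]) auto
  then show ?thesis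
    unfolding mult_op_def using assms by (subst wsum_finite[of "{n}"]) (auto simp: coef_def lev_pos)
qed

lemma mult_op_dcexp:
  assumes "n \<ge> 1"
  shows "mult_op (\<lambda>k. if k = n then 1 else 0) f = dcexp M \<A> n f"
proof -
  have *: "lim (\<lambda>k. if k = n then 1 else (0::complex)) = 0"
    by (rule lim_eventually_const[of "Suc n"]) auto
  show ?thesis
  \<comment> \<open>For n = 1 the lower of the two jumps would sit at index 0, where
    \<open>lev\<close> is the identity and not \<open>E 0\<close>, while \<open>coef\<close> is the
    limit 0. Only the jump at 1 remains.\<close>
  proof (cases "n = 1")
    case True
    then show ?thesis
      unfolding mult_op_def using * by (subst wsum_finite[of "{1}"]) (auto simp: coef_def lev_pos dcexp_def)
  next
    case False
    then show ?thesis
      unfolding mult_op_def using * assms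
      by (subst wsum_finite[of "{n, n - 1}"]) (auto simp: coef_def lev_pos dcexp_def)
  qed
qed

lemma bv_indicators [simp]: "bv (\<lambda>k. if k \<le> n then c k else 0)" "bv (\<lambda>k. if k = n then c k else 0)"
  by (rule bv_eventually_const[of "Suc n"]; simp)+

lemma mult_op_lincomb:
  assumes f: "integrable M f" and c: "bv c" and d: "bv d"
  shows "AE x in M. mult_op (\<lambda>n. a * c n + b * d n) f x = a * mult_op c f x + b * mult_op d f x"
proof -
  have "lim (\<lambda>n. a * c n + b * d n) = a * lim c + b * lim d"
    by (intro limI tendsto_intros bv_LIMSEQ c d)
  then have "coef (\<lambda>n. a * c n + b * d n) = (\<lambda>n. a * coef c n + b * coef d n)"
    by (auto simp: coef_def algebra_simps)
  then show ?thesis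
    unfolding mult_op_def using wsum_lincomb[OF f summable_coef[OF c] summable_coef[OF d], of a b] by simp
qed

lemma mult_op_sum:
  assumes f: "integrable M f" and c: "\<And>i. i \<in> I \<Longrightarrow> bv (c i)"
  shows "AE x in M. mult_op (\<lambda>n. \<Sum>i\<in>I. a i * c i n) f x = (\<Sum>i\<in>I. a i * mult_op (c i) f x)"
  using c
proof (induction I rule: infinite_finite_induct)
  case (insert i I)
  have "bv (\<lambda>n. \<Sum>i\<in>I. a i * c i n)"
    using insert.prems by (intro bv_sum bv_mult) auto
  from mult_op_lincomb[OF f insert.prems[OF insertI1] this, of "a i" 1]
  have "AE x in M. mult_op (\<lambda>n. \<Sum>i\<in>insert i I. a i * c i n) f x =
      a i * mult_op (c i) f x + mult_op (\<lambda>n. \<Sum>i\<in>I. a i * c i n) f x"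
    using insert.hyps by simp
  moreover have "AE x in M. mult_op (\<lambda>n. \<Sum>i\<in>I. a i * c i n) f x = (\<Sum>i\<in>I. a i * mult_op (c i) f x)"
    using insert by auto
  ultimately show ?case
    by eventually_elim (use insert.hyps in simp)
qed (auto simp: mult_op_const)

text \<open>\<open>E (Suc n)\<close> maps \<open>lev k f\<close> to
  \<open>E (min (Suc n) k) f\<close> for k \<ge> 1, and the identity term at k = 0 to
  \<open>E (Suc n) f\<close>. In k this is the eventually constant sequence of
  \<open>coef_mult_sum\<close>.\<close>

lemma cexp_mult_op_expansion:
  assumes d: "bv d" and f: "integrable M f"
  shows "AE x in M. E (Suc n) (mult_op d f) x =
    (\<Sum>k<n. (d (Suc k) - d (Suc (Suc k))) * E (Suc k) f x) + d (Suc n) * E (Suc n) f x"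
proof -
  have f1: "f \<in> Lp M 1" using f by (simp add: Lp_1_iff)
  have "AE x in M. E (Suc n) (mult_op d f) x = (\<Sum>k. coef d k * E (Suc n) (lev k f) x)"
    unfolding mult_op_def wsum_def
    by (rule cexp_suminf[OF _ Lp_lev[OF order_refl f1] summable_coef[OF d]]) simp
  moreover have "AE x in M. E (Suc n) (lev k f) x = (if k = 0 then E (Suc n) f x else E (min (Suc n) k) f x)" for k
    using cexp_cexp[OF _ _ f, of "Suc n" k] by (auto simp: lev_def)
  then have "AE x in M. \<forall>k. E (Suc n) (lev k f) x = (if k = 0 then E (Suc n) f x else E (min (Suc n) k) f x)"
    by (simp add: AE_all_countable)
  ultimately show ?thesis
  proof eventually_elim
    case (elim x)
    let ?y = "\<lambda>k. if k = 0 then E (Suc n) f x else E (min (Suc n) k) f x"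
    have "E (Suc n) (mult_op d f) x = (\<Sum>k. coef d k * ?y k)"
      using elim by simp
    also have "\<dots> = (\<Sum>k<n. (d (Suc k) - d (Suc (Suc k))) * ?y (Suc k)) + d (Suc n) * ?y (Suc n)"
      by (rule coef_mult_sum[OF d]) (auto simp: min_def)
    also have "\<dots> = (\<Sum>k<n. (d (Suc k) - d (Suc (Suc k))) * E (Suc k) f x) + d (Suc n) * E (Suc n) f x"
      by (intro arg_cong2[of _ _ _ _ "(+)"] sum.cong) (auto simp: min_def)
    finally show ?case .
  qed
qed

text \<open>The expansions are countably many, so almost every point satisfies all of them at once;
  at such a point the claim is the scalar identity \<open>coef_product\<close>.\<close>

theorem mult_op_mult_op:
  assumes c: "bv c" and d: "bv d" and f: "integrable M f"
  shows "AE x in M. mult_op c (mult_op d f) x = mult_op (\<lambda>n. c n * d n) f x"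
proof -
  have df: "integrable M (mult_op d f)"
    unfolding mult_op_def by (intro integrable_wsum f summable_coef d)
  have "AE x in M. \<forall>n. E (Suc n) (mult_op d f) x =
      (\<Sum>k<n. (d (Suc k) - d (Suc (Suc k))) * E (Suc k) f x) + d (Suc n) * E (Suc n) f x"
    using cexp_mult_op_expansion[OF d f] by (simp add: AE_all_countable)
  with AE_summable_wsum[OF f summable_coef[OF d]] AE_summable_wsum[OF df summable_coef[OF c]]
    AE_summable_wsum[OF f summable_coef[OF bv_mult[OF c d]]]
  show ?thesis
  proof eventually_elim
    case (elim x)
    then show ?case
      unfolding mult_op_def[of c] mult_op_def[of "\<lambda>n. c n * d n"] wsum_def
      by (intro coef_product[OF c d, where y="\<lambda>k. lev k f x"])
        (auto simp: lev_Suc mult_op_def wsum_def)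
  qed
qed

lemma mult_op_cong_AE:
  assumes "AE x in M. f x = g x" "f \<in> borel_measurable M" "g \<in> borel_measurable M"
  shows "AE x in M. mult_op c f x = mult_op c g x"
  unfolding mult_op_def using assms by (rule wsum_cong_AE)

subsection \<open>Operators represented by such series\<close>

text \<open>An operator obtained by choosing a limit is fixed only up to null sets; the relation
  identifies it by its coefficients. Measurability is recorded because equality almost everywhere
  does not imply it.\<close>

definition acts_as :: "ennreal \<Rightarrow> 'a operator \<Rightarrow> (nat \<Rightarrow> complex) \<Rightarrow> bool" where
  "acts_as p S v \<longleftrightarrow> (\<forall>f\<in>Lp M p. S f \<in> borel_measurable M \<and> (AE x in M. S f x = wsum v f x))"

lemma acts_asD:
  assumes "acts_as p S v" "f \<in> Lp M p"
  shows "S f \<in> borel_measurable M" "AE x in M. S f x = wsum v f x"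
  using assms by (auto simp: acts_as_def)

lemma acts_as_wsum: "acts_as p (wsum v) v"
  by (auto simp: acts_as_def Lp_measurable)

lemma acts_as_Lp:
  assumes p: "p \<ge> 1" and S: "acts_as p S v" and v: "summable (\<lambda>n. norm (v n))" and f: "f \<in> Lp M p"
  shows "S f \<in> Lp M p" "Lp_norm M p (S f) \<le> (\<Sum>n. norm (v n)) * Lp_norm M p f"
proof -
  have "AE x in M. wsum v f x = S f x"
    using acts_asD(2)[OF S f] by (rule AE_symmetric)
  note Lp_cong_AE[OF p Lp_wsum(2)[OF p f v] acts_asD(1)[OF S f] this]
  then show "S f \<in> Lp M p" "Lp_norm M p (S f) \<le> (\<Sum>n. norm (v n)) * Lp_norm M p f"
    using Lp_wsum(3)[OF p f v] by simp_all
qed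

lemma acts_as_bounded_op:
  assumes p: "p \<ge> 1" and S: "acts_as p S v" and v: "summable (\<lambda>n. norm (v n))"
  shows "Lp_bounded_op M p S"
  unfolding Lp_bounded_op_def
proof (intro conjI ballI allI impI)
  show "\<exists>K. \<forall>f\<in>Lp M p. Lp_norm M p (S f) \<le> K * Lp_norm M p f"
    using acts_as_Lp(2)[OF p S v] by blast
  fix f assume f: "f \<in> Lp M p"
  note Sf = acts_asD(2)[OF S f] and fi = Lp_subset_L1[OF p f]
  show "S f \<in> Lp M p" by (rule acts_as_Lp(1)[OF p S v f])
  show "AE x in M. S (\<lambda>y. c * f y) x = c * S f x" for c
    using wsum_cmult[OF fi v, of c] acts_asD(2)[OF S Lp_cmult(1)[OF p f, of c]] Sf
    by eventually_elim simp
  fix g assume g: "g \<in> Lp M p"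
  note Sg = acts_asD(2)[OF S g] and gi = Lp_subset_L1[OF p g]
  show "AE x in M. S (\<lambda>y. f y + g y) x = S f x + S g x"
    using wsum_add[OF fi gi v] acts_asD(2)[OF S Lp_add(1)[OF p f g]] Sf Sg
    by eventually_elim simp
  assume "AE x in M. f x = g x"
  from wsum_cong_AE[OF this Lp_measurable[OF f] Lp_measurable[OF g], of v] Sf Sg
  show "AE x in M. S f x = S g x"
    by eventually_elim simp
qed

lemma acts_as_contraction:
  assumes p: "p \<ge> 1" and S: "acts_as p S v" and v: "summable (\<lambda>n. norm (v n))" and le: "(\<Sum>n. norm (v n)) \<le> 1"
  shows "Lp_contraction M p S"
  unfolding Lp_contraction_def
proof (intro conjI ballI acts_as_bounded_op[OF p S v])
  fix f assume "f \<in> Lp M p"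
  from acts_as_Lp(2)[OF p S v this] show "Lp_norm M p (S f) \<le> Lp_norm M p f"
    using mult_right_mono[OF le Lp_norm_nonneg[of M p f]] by simp
qed

lemma acts_as_diff_norm_le:
  assumes p: "p \<ge> 1" and S: "acts_as p S v" and R: "acts_as p R w"
    and v: "summable (\<lambda>n. norm (v n))" and w: "summable (\<lambda>n. norm (w n))" and f: "f \<in> Lp M p"
  shows "Lp_norm M p (\<lambda>x. S f x - R f x) \<le> (\<Sum>n. norm (v n - w n)) * Lp_norm M p f"
proof -
  note [measurable] = acts_asD(1)[OF S f] acts_asD(1)[OF R f]
  have fi: "integrable M f" by (rule Lp_subset_L1[OF p f])
  have vw: "summable (\<lambda>n. norm (v n - w n))"
    by (rule summable_comparison_test'[OF summable_add[OF v w], of 0]) (simp add: norm_triangle_ineq4)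
  have "AE x in M. wsum (\<lambda>n. v n - w n) f x = S f x - R f x"
    using wsum_lincomb[OF fi v w, of 1 "-1"] acts_asD(2)[OF S f] acts_asD(2)[OF R f]
    by eventually_elim simp
  from Lp_cong_AE(2)[OF p Lp_wsum(2)[OF p f vw] _ this] show ?thesis
    using Lp_wsum(3)[OF p f vw] by simp
qed

text \<open>Convergence of the coefficients in the sequence space l_1 gives operator norm
  convergence, with a rate that does not depend on p.\<close>

lemma acts_as_tendsto:
  assumes p: "p \<ge> 1" and U: "\<And>N. acts_as p (U N) (u N)" and S: "acts_as p S v"
    and u: "\<And>N. summable (\<lambda>n. norm (u N n))" and v: "summable (\<lambda>n. norm (v n))"
    and lim: "(\<lambda>N. \<Sum>n. norm (u N n - v n)) \<longlonglongrightarrow> 0"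
  shows "Lp_op_tendsto M p U S"
  unfolding Lp_op_tendsto_def
proof (intro conjI allI impI)
  fix e :: real assume "e > 0"
  then obtain N where N: "\<And>n. n \<ge> N \<Longrightarrow> (\<Sum>k. norm (u n k - v k)) < e"
    using order_tendstoD(2)[OF lim] by (auto simp: eventually_sequentially)
  have "Lp_norm M p (\<lambda>x. U n f x - S f x) \<le> e * Lp_norm M p f" if "n \<ge> N" "f \<in> Lp M p" for n f
    using acts_as_diff_norm_le[OF p U S u v that(2), of n]
      mult_right_mono[OF less_imp_le[OF N[OF that(1)]] Lp_norm_nonneg[of M p f]] by simp
  then show "\<exists>N. \<forall>n\<ge>N. \<forall>f\<in>Lp M p. Lp_norm M p (\<lambda>x. U n f x - S f x) \<le> e * Lp_norm M p f"
    by blast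
qed (auto intro!: acts_as_bounded_op p U S u v)

lemma acts_as_positivity_preserving:
  assumes p: "p \<ge> 1" and S: "acts_as p S v" and v: "summable (\<lambda>n. norm (v n))"
    and nonneg: "\<And>n. v n \<in> \<real>\<^sub>\<ge>\<^sub>0"
  shows "Lp_positivity_preserving M p S"
  unfolding Lp_positivity_preserving_def
proof (intro ballI impI)
  fix f assume f: "f \<in> Lp M p" and pos: "AE x in M. f x \<in> \<real>\<^sub>\<ge>\<^sub>0"
  have [measurable]: "f \<in> borel_measurable M" using f by measurable
  have "AE x in M. lev n f x \<in> \<real>\<^sub>\<ge>\<^sub>0" for n
  proof (cases "n = 0")
    case False
    then interpret S: sigma_finite_subalgebra M "\<A> n"
      by (intro sigma_finite_subalgebra_filtration) auto
    have pos': "AE x in M. Re (f x) \<ge> 0" "AE x in M. Im (f x) = 0"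
      using pos by (auto elim!: eventually_mono simp: complex_nonneg_Reals_iff)
    have "AE x in M. real_cond_exp M (\<A> n) (\<lambda>x. Re (f x)) x \<ge> 0"
      by (rule S.real_cond_exp_pos[OF pos'(1)]) measurable
    moreover have "AE x in M. real_cond_exp M (\<A> n) (\<lambda>x. Im (f x)) x = real_cond_exp M (\<A> n) (\<lambda>x. 0) x"
      by (rule S.real_cond_exp_cong[OF pos'(2)]) measurable
    moreover have "AE x in M. real_cond_exp M (\<A> n) (\<lambda>x. 0) x = 0"
      by (rule S.real_cond_exp_F_meas) auto
    ultimately show ?thesis
      by eventually_elim (use False in \<open>auto simp: lev_def cexp_def complex_nonneg_Reals_iff\<close>)
  qed (use pos in simp)
  then have "AE x in M. \<forall>n. lev n f x \<in> \<real>\<^sub>\<ge>\<^sub>0"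
    by (simp add: AE_all_countable)
  with acts_asD(2)[OF S f] AE_summable_wsum[OF Lp_subset_L1[OF p f] v]
  show "AE x in M. S f x \<in> \<real>\<^sub>\<ge>\<^sub>0"
  proof eventually_elim
    case (elim x)
    have "\<forall>n. v n * lev n f x \<in> \<real>\<^sub>\<ge>\<^sub>0"
      using elim(3) nonneg by (simp add: nonneg_Reals_mult_I)
    then have "\<And>n. Re (v n * lev n f x) \<ge> 0" "\<And>n. Im (v n * lev n f x) = 0"
      unfolding complex_nonneg_Reals_iff by blast+
    then have "Re (\<Sum>n. v n * lev n f x) \<ge> 0" "Im (\<Sum>n. v n * lev n f x) = 0"
      using elim(2) by (simp_all only: Re_suminf Im_suminf suminf_nonneg summable_Re suminf_zero)
    then show ?case
      using elim(1) by (simp add: wsum_def complex_nonneg_Reals_iff)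
  qed
qed

section \<open>Quadratic forms and selfadjointness\<close>

lemma L2_inner_wsum:
  assumes f: "f \<in> Lp M 2" and g: "g \<in> Lp M 2" and v: "summable (\<lambda>n. norm (v n))"
  shows "(\<lambda>n. v n * L2_inner M (lev n f) g) sums L2_inner M (wsum v f) g"
proof -
  note lf = Lp_lev[OF one_le_two_ennreal f]
  have i: "integrable M (\<lambda>x. v n * (lev n f x * cnj (g x)))" for n
    using L2_mult_integrable(2)[OF lf(1) g] by simp
  have sq: "(\<integral>x. (norm (h x))\<^sup>2 \<partial>M) = (Lp_norm M 2 h)\<^sup>2" for h :: "'a \<Rightarrow> complex"
    by (simp add: Lp_norm_2 integral_nonneg_AE)
  \<comment> \<open>A crude bound through
    \<open>norm a * norm b \<le> (norm a)\<^sup>2 + (norm b)\<^sup>2\<close> is enough: the exchange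
    of sum and integral needs only a constant multiple of \<open>norm (v n)\<close>.\<close>
  let ?K = "(Lp_norm M 2 f)\<^sup>2 + (Lp_norm M 2 g)\<^sup>2"
  have K: "(\<integral>x. norm (v n * (lev n f x * cnj (g x))) \<partial>M) \<le> norm (v n) * ?K" for n
  proof -
    have le: "norm a * norm b \<le> (norm a)\<^sup>2 + (norm b)\<^sup>2" for a b :: complex
      using sum_squares_bound[of "norm a" "norm b"] mult_nonneg_nonneg[OF norm_ge_zero norm_ge_zero, of a b]
      by linarith
    have "(\<integral>x. norm (v n * (lev n f x * cnj (g x))) \<partial>M)
        \<le> (\<integral>x. norm (v n) * ((norm (lev n f x))\<^sup>2 + (norm (g x))\<^sup>2) \<partial>M)"
      using lf(1)[of n] g le
      by (intro integral_mono integrable_norm i) (auto simp: Lp_2_iff norm_mult mult_left_mono)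
    also have "\<dots> = norm (v n) * ((Lp_norm M 2 (lev n f))\<^sup>2 + (Lp_norm M 2 g)\<^sup>2)"
      using lf(1)[of n] g by (simp add: Lp_2_iff sq)
    also have "\<dots> \<le> norm (v n) * ?K"
      using lf(2) by (intro mult_left_mono add_mono power_mono) auto
    finally show ?thesis .
  qed
  have "(\<lambda>n. \<integral>x. v n * (lev n f x * cnj (g x)) \<partial>M) sums (\<integral>x. (\<Sum>n. v n * (lev n f x * cnj (g x))) \<partial>M)"
  proof (rule sums_integral[OF i])
    show "AE x in M. summable (\<lambda>n. norm (v n * (lev n f x * cnj (g x))))"
      using Lp_wsum(1)[OF one_le_two_ennreal f v]
      by eventually_elim (simp add: norm_mult summable_mult2 flip: mult.assoc)
    show "summable (\<lambda>n. \<integral>x. norm (v n * (lev n f x * cnj (g x))) \<partial>M)"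
      by (rule summable_comparison_test'[OF summable_mult2[OF v, of ?K], of 0]) (use K in auto)
  qed
  also have "(\<integral>x. (\<Sum>n. v n * (lev n f x * cnj (g x))) \<partial>M) = L2_inner M (wsum v f) g"
    unfolding L2_inner_def
  proof (intro integral_cong_AE)
    show "AE x in M. (\<Sum>n. v n * (lev n f x * cnj (g x))) = wsum v f x * cnj (g x)"
      using AE_summable_wsum[OF Lp_subset_L1[OF one_le_two_ennreal f] v]
      by eventually_elim (simp add: wsum_def suminf_mult2 mult.assoc)
  qed (use f g in measurable)
  finally show ?thesis
    by (simp add: L2_inner_def)
qed

lemma L2_inner_cong_AE:
  assumes "AE x in M. f x = f' x" "AE x in M. g x = g' x"
    and [measurable]: "f \<in> borel_measurable M" "f' \<in> borel_measurable M" "g \<in> borel_measurable M" "g' \<in> borel_measurable M"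
  shows "L2_inner M f g = L2_inner M f' g'"
  unfolding L2_inner_def using assms(1,2) by (intro integral_cong_AE) auto

lemma L2_inner_commute: "L2_inner M f g = cnj (L2_inner M g f)"
  unfolding L2_inner_def by (subst Bochner_Integration.integral_cnj[symmetric]) (simp add: mult.commute)

text \<open>Both inner products are series in \<open>L2_inner M (lev n f) g\<close>, since
  conjugation leaves the real coefficients fixed.\<close>

lemma acts_as_selfadjoint:
  assumes S: "acts_as 2 S v" and v: "summable (\<lambda>n. norm (v n))" and real: "\<And>n. v n \<in> \<real>"
  shows "L2_selfadjoint M S"
  unfolding L2_selfadjoint_def
proof (intro conjI ballI acts_as_bounded_op[OF one_le_two_ennreal S v])
  fix f g assume f: "f \<in> Lp M 2" and g: "g \<in> Lp M 2"
  have [measurable]: "f \<in> borel_measurable M" "g \<in> borel_measurable M" "S f \<in> borel_measurable M" "S g \<in> borel_measurable M"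
    using f g acts_asD(1)[OF S] by measurable
  have sa: "L2_inner M (lev n f) g = L2_inner M f (lev n g)" for n
    using cexp_selfadjoint[OF f g] by (simp add: lev_def)
  have "(\<lambda>n. cnj (v n * L2_inner M (lev n g) f)) sums cnj (L2_inner M (wsum v g) f)"
    using L2_inner_wsum[OF g f v] by (simp only: sums_cnj)
  moreover have "cnj (v n * L2_inner M (lev n g) f) = v n * L2_inner M (lev n f) g" for n
    using real[of n] by (simp add: sa Reals_cnj_iff flip: L2_inner_commute)
  ultimately have "L2_inner M (wsum v f) g = L2_inner M f (wsum v g)"
    using sums_unique2[OF L2_inner_wsum[OF f g v]] by (simp flip: L2_inner_commute)
  moreover have "L2_inner M (S f) g = L2_inner M (wsum v f) g" "L2_inner M f (S g) = L2_inner M f (wsum v g)"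
    using acts_asD(2)[OF S] f g by (auto intro!: L2_inner_cong_AE)
  ultimately show "L2_inner M (S f) g = L2_inner M f (S g)" by simp
qed

lemma L2_inner_self: "L2_inner M f f = complex_of_real (\<integral>x. (norm (f x))\<^sup>2 \<partial>M)"
  unfolding L2_inner_def by (simp add: complex_norm_square[symmetric] del: of_real_power)

lemma L2_inner_cexp_self:
  assumes "f \<in> Lp M 2" "n \<ge> 1"
  shows "L2_inner M (E n f) f = complex_of_real (\<integral>x. (norm (E n f x))\<^sup>2 \<partial>M)"
proof -
  note Ef = Lp_cexp(1)[OF one_le_two_ennreal assms(1), of n]
  have fi: "integrable M f" using Lp_subset_L1[OF one_le_two_ennreal assms(1)] .
  have "L2_inner M (E n f) f = L2_inner M (E n (E n f)) f"
    using cexp_cexp[OF assms(2,2) fi] assms(1)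
    by (intro L2_inner_cong_AE) (auto simp: Lp_measurable)
  also have "\<dots> = L2_inner M (E n f) (E n f)"
    by (rule cexp_selfadjoint[OF Ef assms(1)])
  finally show ?thesis by (simp add: L2_inner_self)
qed

lemma acts_as_nonneg_form:
  assumes S: "acts_as 2 S v" and v: "summable (\<lambda>n. norm (v n))" and nonneg: "\<And>n. v n \<in> \<real>\<^sub>\<ge>\<^sub>0"
  shows "L2_nonneg_form M S"
  unfolding L2_nonneg_form_def
proof
  fix f assume f: "f \<in> Lp M 2"
  have [measurable]: "f \<in> borel_measurable M" "S f \<in> borel_measurable M"
    using f acts_asD(1)[OF S] by measurable
  have "L2_inner M (lev n f) f \<in> \<real>\<^sub>\<ge>\<^sub>0" for n
    using L2_inner_cexp_self[OF f, of n]
    by (cases "n = 0") (auto simp: lev_def L2_inner_self integral_nonneg_AE simp del: of_real_power)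
  then have *: "\<forall>n. v n * L2_inner M (lev n f) f \<in> \<real>\<^sub>\<ge>\<^sub>0"
    using nonneg by (simp add: nonneg_Reals_mult_I)
  note s = L2_inner_wsum[OF f f v]
  have *: "Re (v n * L2_inner M (lev n f) f) \<ge> 0" "Im (v n * L2_inner M (lev n f) f) = 0" for n
    using * unfolding complex_nonneg_Reals_iff by blast+
  have "Re (L2_inner M (wsum v f) f) \<ge> 0"
    by (rule sums_le[OF *(1) sums_zero sums_Re[OF s]])
  moreover have "Im (L2_inner M (wsum v f) f) = 0"
    using sums_Im[OF s] sums_zero unfolding *(2) by (rule sums_unique2)
  moreover have "L2_inner M (S f) f = L2_inner M (wsum v f) f"
    using acts_asD(2)[OF S f] by (intro L2_inner_cong_AE) auto
  ultimately show "L2_inner M (S f) f \<in> \<real>\<^sub>\<ge>\<^sub>0"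
    by (simp add: complex_nonneg_Reals_iff)
qed

lemma Lp_mult_op:
  assumes "p \<ge> 1" "bv c" "f \<in> Lp M p"
  shows "mult_op c f \<in> Lp M p"
  unfolding mult_op_def by (rule Lp_wsum(2)[OF assms(1,3) summable_coef[OF assms(2)]])

lemma acts_as_mult_op: "acts_as p (mult_op c) (coef c)"
  unfolding mult_op_def by (rule acts_as_wsum)

lemma acts_as_coefD:
  assumes "acts_as p S (coef c)" "f \<in> Lp M p"
  shows "S f \<in> borel_measurable M" "AE x in M. S f x = mult_op c f x"
  using acts_asD[OF assms] by (simp_all add: mult_op_def)

lemma mult_op_measurable [measurable]: "f \<in> borel_measurable M \<Longrightarrow> mult_op c f \<in> borel_measurable M"
  unfolding mult_op_def by measurable

lemma mult_op_cong: "(\<And>n. n \<ge> 1 \<Longrightarrow> c n = d n) \<Longrightarrow> bv c \<Longrightarrow> mult_op c = mult_op d"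
proof -
  assume eq: "\<And>n. n \<ge> 1 \<Longrightarrow> c n = d n" and c: "bv c"
  have "d \<longlonglongrightarrow> lim c"
    by (rule Lim_transform_eventually[OF bv_LIMSEQ[OF c]]) (use eq in \<open>auto simp: eventually_sequentially\<close>)
  then have "lim d = lim c" by (rule limI)
  then have "coef c = coef d"
    using eq by (auto simp: coef_def)
  then show ?thesis by (simp add: mult_op_def)
qed

section \<open>Polynomials, eigenvalues and resolvents\<close>

lemma acts_as_power:
  assumes S: "acts_as 2 S (coef c)" and c: "bv c"
  shows "acts_as 2 (S ^^ i) (coef (\<lambda>n. c n ^ i))"
proof (induction i)
  case 0
  have "mult_op (\<lambda>_. 1) f = f" for f :: "'a \<Rightarrow> complex"
    by (simp add: mult_op_const)
  then show ?case
    by (auto simp: acts_as_def Lp_measurable mult_op_def)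
next
  case (Suc i)
  show ?case
    unfolding acts_as_def
  proof (intro ballI conjI)
    fix f assume f: "f \<in> Lp M 2"
    have i: "(S ^^ i) f \<in> Lp M 2"
      by (rule acts_as_Lp(1)[OF _ Suc.IH summable_coef[OF bv_power[OF c]] f]) simp
    note Si = acts_as_coefD[OF Suc.IH f] and SS = acts_as_coefD[OF S i]
    show "(S ^^ Suc i) f \<in> borel_measurable M" using SS(1) by simp
    have "AE x in M. mult_op c ((S ^^ i) f) x = mult_op c (mult_op (\<lambda>n. c n ^ i) f) x"
      using f by (intro mult_op_cong_AE Si) (auto simp: Lp_measurable)
    with SS(2) mult_op_mult_op[OF c bv_power[OF c] Lp_subset_L1[OF one_le_two_ennreal f], of i]
    show "AE x in M. (S ^^ Suc i) f x = wsum (coef (\<lambda>n. c n ^ Suc i)) f x"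
      by eventually_elim (simp add: mult_op_def)
  qed
qed

lemma bv_poly: "bv c \<Longrightarrow> bv (\<lambda>n. poly q (c n))"
  unfolding poly_altdef by (intro bv_sum bv_mult bv_power bv_const)

lemma acts_as_op_poly:
  assumes S: "acts_as 2 S (coef c)" and c: "bv c"
  shows "acts_as 2 (op_poly q S) (coef (\<lambda>n. poly q (c n)))"
  unfolding acts_as_def
proof (intro ballI conjI)
  fix f assume f: "f \<in> Lp M 2"
  note P = acts_as_coefD[OF acts_as_power[OF S c] f]
  note [measurable] = P(1)
  show "op_poly q S f \<in> borel_measurable M"
    unfolding op_poly_def by measurable
  have "AE x in M. \<forall>i. (S ^^ i) f x = mult_op (\<lambda>n. c n ^ i) f x"
    using P(2) by (simp add: AE_all_countable)
  with mult_op_sum[where I="{..degree q}" and a="coeff q" and c="\<lambda>i n. c n ^ i",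
      OF Lp_subset_L1[OF one_le_two_ennreal f] bv_power[OF c]]
  show "AE x in M. op_poly q S f x = wsum (coef (\<lambda>n. poly q (c n))) f x"
    by eventually_elim (simp add: op_poly_def poly_altdef mult_op_def)
qed

text \<open>A nonzero difference g is an eigenvector for \<open>c n\<close>. A bounded inverse of
  \<open>S - c n\<close> would have to send the zero vector \<open>S g - c n * g\<close> back to
  g.\<close>

lemma eigenvalue_in_spectrum:
  assumes S: "acts_as 2 S (coef c)" and c: "bv c" and n: "n \<ge> 1"
    and f: "f \<in> Lp M 2" and nz: "\<not> (AE x in M. dcexp M \<A> n f x = 0)"
  shows "c n \<in> L2_spectrum M S"
  unfolding L2_spectrum_def
proof (safe)
  fix R assume R: "Lp_bounded_op M 2 R"
    and inv: "\<forall>f\<in>Lp M 2. (AE x in M. R (\<lambda>y. S f y - c n * f y) x = f x) \<and> (AE x in M. S (R f) x - c n * R f x = f x)"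
  let ?\<delta> = "\<lambda>k. if k = n then 1 else (0::complex)"
  define g where "g = mult_op ?\<delta> f"
  have fi: "integrable M f" using Lp_subset_L1[OF one_le_two_ennreal f] .
  have g: "g \<in> Lp M 2" unfolding g_def by (intro Lp_mult_op f) auto
  have prod: "(\<lambda>k. c k * ?\<delta> k) = (\<lambda>k. c n * ?\<delta> k + 0 * ?\<delta> k)" by auto
  note Sg = acts_as_coefD[OF S g]
  have "AE x in M. mult_op c g x = mult_op (\<lambda>k. c k * ?\<delta> k) f x"
    unfolding g_def by (rule mult_op_mult_op[OF c _ fi]) simp
  moreover have "AE x in M. mult_op (\<lambda>k. c n * ?\<delta> k + 0 * ?\<delta> k) f x = c n * g x + 0 * g x"
    unfolding g_def by (rule mult_op_lincomb[OF fi]) simp_all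
  ultimately have Sg0: "AE x in M. S g x - c n * g x = 0"
    using Sg(2) unfolding prod by eventually_elim simp
  have Sg_Lp: "S g \<in> Lp M 2"
    by (rule acts_as_Lp(1)[OF one_le_two_ennreal S summable_coef[OF c] g])
  have diff: "(\<lambda>y. S g y - c n * g y) \<in> Lp M 2"
    by (intro Lp_diff Lp_cmult Sg_Lp g) auto
  have zero: "(\<lambda>_. 0) \<in> Lp M 2" using Lp_zero(1)[OF one_le_two_ennreal] .
  have "AE x in M. R (\<lambda>y. S g y - c n * g y) x = R (\<lambda>_. 0) x"
    by (rule Lp_bounded_op_cong_AE[OF R diff zero Sg0])
  \<comment> \<open>That R maps 0 to 0 almost everywhere is homogeneity with factor 0.\<close>
  moreover have "AE x in M. R (\<lambda>_. 0 * 0) x = 0 * R (\<lambda>_. 0) x"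
    by (rule Lp_bounded_op_cmult[OF R zero])
  moreover have "AE x in M. R (\<lambda>y. S g y - c n * g y) x = g x"
    using inv g by blast
  ultimately have "AE x in M. g x = 0"
    by eventually_elim simp
  then show False
    using nz mult_op_dcexp[OF n, of f] by (simp add: g_def)
qed

text \<open>A common distance \<open>\<delta>\<close> from all symbol values keeps the reciprocal
  symbol of bounded variation, as each increment grows by a factor of at most
  \<open>1 / \<delta>\<^sup>2\<close>. The reciprocal and \<open>c n - z\<close> multiply to 1,
  which makes the corresponding operators inverse on both sides.\<close>

lemma not_in_spectrum:
  assumes S: "acts_as 2 S (coef c)" and c: "bv c" and "\<delta> > 0" and \<delta>: "\<And>n. norm (c n - z) \<ge> \<delta>"
  shows "z \<notin> L2_spectrum M S"
proof -
  let ?r = "\<lambda>n. 1 / (c n - z)"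
  have nz: "c n - z \<noteq> 0" for n
    using \<delta>[of n] \<open>\<delta> > 0\<close> by auto
  have le: "norm (?r n - ?r (Suc n)) \<le> norm (c n - c (Suc n)) * (1 / \<delta>\<^sup>2)" for n
  proof -
    have "?r n - ?r (Suc n) = (c (Suc n) - c n) / ((c n - z) * (c (Suc n) - z))"
      using nz[of n] nz[of "Suc n"] by (simp add: field_simps)
    then have "norm (?r n - ?r (Suc n)) = norm (c n - c (Suc n)) * (1 / (norm (c n - z) * norm (c (Suc n) - z)))"
      by (simp add: norm_divide norm_mult norm_minus_commute)
    also have "\<dots> \<le> norm (c n - c (Suc n)) * (1 / \<delta>\<^sup>2)"
      using \<open>\<delta> > 0\<close> mult_mono[OF \<delta>[of n] \<delta>[of "Suc n"]]
      by (intro mult_left_mono frac_le) (simp_all add: power2_eq_square)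
    finally show ?thesis .
  qed
  have "summable (\<lambda>n. norm (c n - c (Suc n)) * (1 / \<delta>\<^sup>2))"
    using c unfolding bv_def by (rule summable_mult2)
  then have r: "bv ?r"
    unfolding bv_def
    by (rule summable_comparison_test'[where N=0]) (simp only: real_norm_def abs_norm_cancel le)
  \<comment> \<open>The shape of this term matches \<open>mult_op_lincomb\<close>.\<close>
  let ?d = "\<lambda>n. 1 * c n + - z * 1"
  have d: "bv ?d" using bv_diff[OF c bv_const[of z]] by simp
  have rd: "(\<lambda>n. ?r n * ?d n) = (\<lambda>_. 1)" "(\<lambda>n. ?d n * ?r n) = (\<lambda>_. 1)"
    using nz by auto
  define R where "R = mult_op ?r"
  have "Lp_bounded_op M 2 R"
    unfolding R_def by (rule acts_as_bounded_op[OF one_le_two_ennreal acts_as_mult_op summable_coef[OF r]])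
  moreover have S': "AE x in M. S f x - z * f x = mult_op ?d f x" if f: "f \<in> Lp M 2" for f
    using acts_as_coefD(2)[OF S f] mult_op_lincomb[OF Lp_subset_L1[OF one_le_two_ennreal f] c bv_const[of 1], of 1 "-z"]
    by eventually_elim (simp add: mult_op_const)
  have "AE x in M. R (\<lambda>y. S f y - z * f y) x = f x" if f: "f \<in> Lp M 2" for f
  proof -
    note [measurable] = Lp_measurable[OF f] acts_as_coefD(1)[OF S f]
    have "AE x in M. R (\<lambda>y. S f y - z * f y) x = mult_op ?r (mult_op ?d f) x"
      unfolding R_def by (intro mult_op_cong_AE S' f) measurable
    with mult_op_mult_op[OF r d Lp_subset_L1[OF one_le_two_ennreal f]] show ?thesis
      unfolding rd by eventually_elim (simp add: mult_op_const)
  qed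
  moreover have "AE x in M. S (R f) x - z * R f x = f x" if f: "f \<in> Lp M 2" for f
  proof -
    have "R f \<in> Lp M 2" unfolding R_def by (intro Lp_mult_op r f) simp
    from S'[OF this] mult_op_mult_op[OF d r Lp_subset_L1[OF one_le_two_ennreal f]] show ?thesis
      unfolding rd R_def by eventually_elim (simp add: mult_op_const)
  qed
  ultimately show ?thesis
    unfolding L2_spectrum_def by blast
qed

subsection \<open>Mean square convergence of the filtration\<close>

text \<open>The functions for which mean square martingale convergence holds. Membership in L_2 is
  included so that they can be treated as a closed subspace, which is then shown to be
  everything.\<close>

definition L2_conv :: "('a \<Rightarrow> complex) \<Rightarrow> bool" where
  "L2_conv f \<longleftrightarrow> f \<in> Lp M 2 \<and> (\<lambda>n. Lp_norm M 2 (\<lambda>x. f x - E n f x)) \<longlonglongrightarrow> 0"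

lemma L2_conv_filtration:
  assumes f: "f \<in> Lp M 2" and m: "m \<ge> 1" "f \<in> borel_measurable (\<A> m)"
  shows "L2_conv f"
proof -
  have "Lp_norm M 2 (\<lambda>x. f x - E n f x) = 0" if "n \<ge> m" for n
  proof -
    have "f \<in> borel_measurable (\<A> n)"
      using measurable_from_subalg[OF subalgebra_filtration[OF m(1) that] m(2)] .
    then have "AE x in M. E n f x = f x"
      using Lp_subset_L1[OF one_le_two_ennreal f] m that by (intro cexp_charact) auto
    then have "AE x in M. 0 = f x - E n f x"
      by eventually_elim simp
    from Lp_cong_AE(2)[OF one_le_two_ennreal Lp_zero(1)[OF one_le_two_ennreal] _ this] show ?thesis
      using Lp_zero(2)[OF one_le_two_ennreal, of M] Lp_measurable[OF f] by simp
  qed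
  then show ?thesis
    unfolding L2_conv_def using f
    by (auto intro!: tendsto_eventually eventually_sequentiallyI[of m])
qed

lemma L2_norm_diff_cexp_add:
  assumes f: "f \<in> Lp M 2" and g: "g \<in> Lp M 2"
  shows "Lp_norm M 2 (\<lambda>x. (f x + g x) - E n (\<lambda>y. f y + g y) x)
    \<le> Lp_norm M 2 (\<lambda>x. f x - E n f x) + Lp_norm M 2 (\<lambda>x. g x - E n g x)"
proof -
  have p: "(1::ennreal) \<le> 2" by simp
  note [measurable] = Lp_measurable[OF f] Lp_measurable[OF g]
  have d: "(\<lambda>x. f x - E n f x) \<in> Lp M 2" "(\<lambda>x. g x - E n g x) \<in> Lp M 2"
    by (intro Lp_diff p f g Lp_cexp)+
  have "AE x in M. (f x - E n f x) + (g x - E n g x) = (f x + g x) - E n (\<lambda>y. f y + g y) x"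
    using cexp_add[OF Lp_subset_L1[OF p f] Lp_subset_L1[OF p g], of n]
    by eventually_elim simp
  from Lp_cong_AE(2)[OF p Lp_add(1)[OF p d] _ this] show ?thesis
    using Lp_add(2)[OF p d] by simp
qed

lemma L2_conv_add:
  assumes "L2_conv f" "L2_conv g"
  shows "L2_conv (\<lambda>x. f x + g x)"
proof -
  have fg: "f \<in> Lp M 2" "g \<in> Lp M 2" using assms by (auto simp: L2_conv_def)
  have "(\<lambda>n. Lp_norm M 2 (\<lambda>x. f x - E n f x) + Lp_norm M 2 (\<lambda>x. g x - E n g x)) \<longlonglongrightarrow> 0"
    using assms unfolding L2_conv_def by (intro tendsto_add_zero) auto
  then have "(\<lambda>n. Lp_norm M 2 (\<lambda>x. (f x + g x) - E n (\<lambda>y. f y + g y) x)) \<longlonglongrightarrow> 0"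
    by (rule Lim_null_comparison[OF always_eventually, rotated]) (simp add: L2_norm_diff_cexp_add fg)
  then show ?thesis
    using Lp_add(1)[OF _ fg] by (simp add: L2_conv_def)
qed

lemma L2_conv_cmult:
  assumes "L2_conv f"
  shows "L2_conv (\<lambda>x. c * f x)"
proof -
  have p: "(1::ennreal) \<le> 2" by simp
  have f: "f \<in> Lp M 2" using assms by (auto simp: L2_conv_def)
  note [measurable] = Lp_measurable[OF f]
  have d: "(\<lambda>x. f x - E n f x) \<in> Lp M 2" for n
    by (intro Lp_diff p f Lp_cexp)
  have le: "Lp_norm M 2 (\<lambda>x. c * f x - E n (\<lambda>y. c * f y) x) \<le> norm c * Lp_norm M 2 (\<lambda>x. f x - E n f x)" for n
  proof -
    have "AE x in M. c * (f x - E n f x) = c * f x - E n (\<lambda>y. c * f y) x"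
      using cexp_cmult[OF Lp_subset_L1[OF p f], of n c]
      by eventually_elim (simp add: right_diff_distrib)
    from Lp_cong_AE(2)[OF p Lp_cmult(1)[OF p d] _ this] show ?thesis
      using Lp_cmult(2)[OF p d, of c n] by simp
  qed
  have "(\<lambda>n. norm c * Lp_norm M 2 (\<lambda>x. f x - E n f x)) \<longlonglongrightarrow> 0"
    using assms unfolding L2_conv_def by (intro tendsto_mult_right_zero) auto
  then have "(\<lambda>n. Lp_norm M 2 (\<lambda>x. c * f x - E n (\<lambda>y. c * f y) x)) \<longlonglongrightarrow> 0"
    by (rule Lim_null_comparison[OF always_eventually, rotated]) (simp add: le)
  then show ?thesis
    using Lp_cmult(1)[OF p f] by (simp add: L2_conv_def)
qed

text \<open>As \<open>E n\<close> is a contraction, the error of f exceeds that of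
  \<open>s i\<close> by at most twice the distance of f and \<open>s i\<close>, for all n
  alike.\<close>

lemma L2_conv_closed:
  assumes f: "f \<in> Lp M 2" and s: "\<And>i. L2_conv (s i)"
    and lim: "(\<lambda>i::nat. Lp_norm M 2 (\<lambda>x. f x - s i x)) \<longlonglongrightarrow> 0"
  shows "L2_conv f"
  unfolding L2_conv_def
proof (intro conjI f LIMSEQ_I)
  have p: "(1::ennreal) \<le> 2" by simp
  fix e :: real assume "e > 0"
  then obtain i where i: "Lp_norm M 2 (\<lambda>x. f x - s i x) < e / 3"
    using order_tendstoD(2)[OF lim, of "e / 3"] by (auto simp: eventually_sequentially)
  have si: "s i \<in> Lp M 2" using s by (simp add: L2_conv_def)
  have d: "(\<lambda>x. f x - s i x) \<in> Lp M 2"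
    by (intro Lp_diff p f si)
  obtain N where N: "\<And>n. n \<ge> N \<Longrightarrow> Lp_norm M 2 (\<lambda>x. s i x - E n (s i) x) < e / 3"
    using s[of i] order_tendstoD(2)[of _ 0 sequentially "e / 3"] \<open>e > 0\<close>
    by (auto simp: L2_conv_def eventually_sequentially)
  have "Lp_norm M 2 (\<lambda>x. f x - E n f x) < e" if "n \<ge> N" for n
  proof -
    have "Lp_norm M 2 (\<lambda>x. f x - E n f x)
        \<le> Lp_norm M 2 (\<lambda>x. (f x - s i x) - E n (\<lambda>y. f y - s i y) x) + Lp_norm M 2 (\<lambda>x. s i x - E n (s i) x)"
      using L2_norm_diff_cexp_add[OF d si, of n] by simp
    also have "Lp_norm M 2 (\<lambda>x. (f x - s i x) - E n (\<lambda>y. f y - s i y) x)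
        \<le> Lp_norm M 2 (\<lambda>x. f x - s i x) + Lp_norm M 2 (E n (\<lambda>y. f y - s i y))"
      by (intro Lp_diff(2) p d Lp_cexp)
    also have "Lp_norm M 2 (E n (\<lambda>y. f y - s i y)) \<le> Lp_norm M 2 (\<lambda>x. f x - s i x)"
      by (intro Lp_cexp p d)
    finally show ?thesis using i N[OF that] by simp
  qed
  then show "\<exists>N. \<forall>n\<ge>N. norm (Lp_norm M 2 (\<lambda>x. f x - E n f x) - 0) < e"
    by auto
qed

lemma L2_conv_cong:
  assumes "L2_conv f" "\<And>x. x \<in> space M \<Longrightarrow> f x = g x"
  shows "L2_conv g"
\<comment> \<open>The constant sequence f approximates g, as the two agree on
  \<open>space M\<close>. The indicator identities used later for complements and simple functions
  are needed only there.\<close>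
proof (rule L2_conv_closed)
  have f: "f \<in> Lp M 2" using assms by (simp add: L2_conv_def)
  have "g \<in> borel_measurable M"
    using Lp_measurable[OF f] measurable_cong[of M f g] assms(2) by blast
  from Lp_cong_AE(1)[OF one_le_two_ennreal f this AE_I2[OF assms(2)]]
  show g: "g \<in> Lp M 2" .
  show "L2_conv f" for i :: nat by fact
  have "(\<integral>x. (norm (g x - f x))\<^sup>2 \<partial>M) = (\<integral>x. 0 \<partial>M)"
    by (intro Bochner_Integration.integral_cong) (use assms in auto)
  then show "(\<lambda>i::nat. Lp_norm M 2 (\<lambda>x. g x - f x)) \<longlonglongrightarrow> 0"
    by (simp add: Lp_norm_2)
qed

lemma indicator_in_L2: "B \<in> sets M \<Longrightarrow> indicator B \<in> Lp M 2"
  by (auto simp: Lp_2_iff intro!: integrable_const_bound[of _ 1] split: split_indicator)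

text \<open>A Dynkin argument: the union of the \<open>\<A> n\<close> is stable under intersection
  because the filtration increases, and the sets with convergent indicator are closed under
  complements and countable disjoint unions.\<close>

lemma L2_conv_indicator:
  assumes gen: "sets M = sigma_sets (space M) (\<Union>n\<in>{1..}. sets (\<A> n))" and B: "B \<in> sets M"
  shows "L2_conv (indicator B)"
proof -
  let ?G = "\<Union>n\<in>{1..}. sets (\<A> n)"
  have space: "space (\<A> n) = space M" if "n \<ge> 1" for n
    using sub[OF that] by (simp add: subalgebra_def)
  have gen_conv: "L2_conv (indicator C)" if C: "C \<in> ?G" for C
  proof -
    obtain n where n: "n \<ge> 1" "C \<in> sets (\<A> n)" using C by auto
    then have "C \<in> sets M" using sub[of n] by (auto simp: subalgebra_def)
    with n show ?thesis
      by (intro L2_conv_filtration[of _ n] indicator_in_L2) auto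
  qed
  have "Int_stable ?G"
  proof (rule Int_stableI)
    fix C D assume "C \<in> ?G" "D \<in> ?G"
    then obtain m n where mn: "m \<ge> 1" "n \<ge> 1" "C \<in> sets (\<A> m)" "D \<in> sets (\<A> n)" by auto
    then have "C \<in> sets (\<A> (max m n))" "D \<in> sets (\<A> (max m n))"
      using subalgebra_filtration[of m "max m n"] subalgebra_filtration[of n "max m n"]
      by (auto simp: subalgebra_def)
    then show "C \<inter> D \<in> ?G" using mn(1) by (auto intro!: bexI[of _ "max m n"])
  qed
  moreover have "?G \<subseteq> Pow (space M)"
    using sets.sets_into_space space by fastforce
  moreover have "B \<in> sigma_sets (space M) ?G" using B gen by simp
  ultimately show ?thesis
  proof (induction rule: sigma_sets_induct_disjoint)
    case (basic C)
    then show ?case by (rule gen_conv)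
  next
    case empty
    show ?case by (rule gen_conv) auto
  next
    case (compl C)
    have "space M \<in> ?G" using space[of 1] sets.top[of "\<A> 1"] by auto
    from L2_conv_add[OF gen_conv[OF this] L2_conv_cmult[OF compl.IH, of "-1"]] show ?case
      by (rule L2_conv_cong) (auto split: split_indicator)
  next
    case (union C)
    then have [measurable]: "\<And>i. C i \<in> sets M" unfolding gen by blast
    \<comment> \<open>Disjointness turns the indicator of a finite union into a sum, so linearity
      applies; the countable union is then a dominated limit.\<close>
    have fin: "L2_conv (indicator (\<Union>i<k. C i))" for k
    proof (induction k)
      case 0
      show ?case by (rule gen_conv) auto
    next
      case (Suc k)
      have "C i \<inter> C k = {}" if "i < k" for i
        using \<open>disjoint_family C\<close> that unfolding disjoint_family_on_def by simp
      then have "(\<Union>i<k. C i) \<inter> C k = {}" by auto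
      then have eq: "indicator (\<Union>i<Suc k. C i) x = (indicator (\<Union>i<k. C i) x + indicator (C k) x :: complex)" for x
        by (auto simp: lessThan_Suc split: split_indicator)
      from L2_conv_add[OF Suc.IH union.IH[of k]] show ?case
        by (rule L2_conv_cong) (rule eq[symmetric])
    qed
    show ?case
    proof (rule L2_conv_closed[OF _ fin])
      show U: "indicator (\<Union>i. C i) \<in> Lp M 2"
        by (intro indicator_in_L2) measurable
      show "(\<lambda>k. Lp_norm M 2 (\<lambda>x. indicator (\<Union>i. C i) x - indicator (\<Union>i<k. C i) x)) \<longlonglongrightarrow> 0"
      proof (rule L2_dominated_convergence(2)[OF U, where K=1])
        show "(\<lambda>k. indicator (\<Union>i<k. C i) x) \<longlonglongrightarrow> (indicator (\<Union>i. C i) x :: complex)" for x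
          by (rule LIMSEQ_indicator_UN)
      qed (auto split: split_indicator)
    qed
  qed
qed

text \<open>Linearity extends the convergence from indicators to simple functions. Every f in L_2 is
  a pointwise limit of simple functions of modulus at most twice its own, hence a limit in L_2 by
  domination.\<close>

theorem L2_conv_generating:
  assumes gen: "sets M = sigma_sets (space M) (\<Union>n\<in>{1..}. sets (\<A> n))" and f: "f \<in> Lp M 2"
  shows "L2_conv f"
proof -
  obtain F where F: "\<And>i. simple_function M (F i)" "\<And>x. x \<in> space M \<Longrightarrow> (\<lambda>i. F i x) \<longlonglongrightarrow> f x"
    "\<And>i x. x \<in> space M \<Longrightarrow> dist (F i x) 0 \<le> 2 * dist (f x) 0"
    using borel_measurable_implies_sequence_metric[OF Lp_measurable[OF f], of 0] by blast
  have "L2_conv (F i)" for i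
  proof -
    have sum: "L2_conv (\<lambda>x. \<Sum>y\<in>Y. y * indicator (F i -` {y} \<inter> space M) x)" for Y
    proof (induction Y rule: infinite_finite_induct)
      case (insert y Y)
      have "F i -` {y} \<inter> space M \<in> sets M"
        using F(1) by (rule simple_functionD)
      from L2_conv_add[OF L2_conv_cmult[OF L2_conv_indicator[OF gen this]] insert.IH]
      show ?case by (simp only: sum.insert[OF insert.hyps])
    qed (use L2_conv_cmult[OF L2_conv_indicator[OF gen sets.top], of 0] in simp_all)
    from sum[of "F i ` space M"] show ?thesis
    proof (rule L2_conv_cong)
      fix x assume x: "x \<in> space M"
      have "(\<Sum>y\<in>F i ` space M. y * indicator (F i -` {y} \<inter> space M) x) =
          (\<Sum>y\<in>F i ` space M. indicator (F i -` {y} \<inter> space M) x *\<^sub>R y)"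
        by (intro sum.cong) (auto split: split_indicator)
      also have "\<dots> = F i x"
        by (rule simple_function_indicator_representation_banach[OF F(1) x, symmetric])
      finally show "(\<Sum>y\<in>F i ` space M. y * indicator (F i -` {y} \<inter> space M) x) = F i x" .
    qed
  qed
  then show ?thesis
    using L2_dominated_convergence(2)[OF f borel_measurable_simple_function[OF F(1)] F(2), of 2] F(3) f
    by (intro L2_conv_closed[of f F]) auto
qed

subsection \<open>Functional calculus\<close>

text \<open>A real symbol gives a selfadjoint operator, which can be moved to the other side, where
  the product of the symbols vanishes.\<close>

lemma mult_op_orthogonal:
  assumes c: "bv c" and d: "bv d" "\<And>n. d n \<in> \<real>" and cd: "\<And>n. c n * d n = 0" and f: "f \<in> Lp M 2"
  shows "L2_inner M (mult_op c f) (mult_op d f) = 0"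
proof -
  have p: "(1::ennreal) \<le> 2" by simp
  note [measurable] = Lp_measurable[OF f]
  have "coef d n \<in> \<real>" for n
  proof (cases "n = 0")
    case True
    \<comment> \<open>At index 0 \<open>coef\<close> is the limit of d, which stays real because the
      reals are closed.\<close>
    have "closed (\<real> :: complex set)" by (rule closed_complex_Reals)
    then show ?thesis
      using closed_sequentially[OF _ _ bv_LIMSEQ[OF d(1)]] d(2) True by (simp add: coef_def)
  qed (simp add: coef_def d(2))
  then have "L2_selfadjoint M (mult_op d)"
    by (intro acts_as_selfadjoint[OF acts_as_mult_op summable_coef[OF d(1)]])
  then have "L2_inner M (mult_op c f) (mult_op d f) = L2_inner M (mult_op d (mult_op c f)) f"
    using Lp_mult_op[OF p c f] f by (simp add: L2_selfadjoint_def)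
  also have "\<dots> = L2_inner M (\<lambda>x. 0) f"
  proof (intro L2_inner_cong_AE)
    have "(\<lambda>n. d n * c n) = (\<lambda>_. 0)" by (intro ext) (subst mult.commute, rule cd)
    then show "AE x in M. mult_op d (mult_op c f) x = 0"
      using mult_op_mult_op[OF d(1) c Lp_subset_L1[OF p f]] by (simp add: mult_op_const)
  qed auto
  finally show ?thesis by (simp add: L2_inner_def)
qed

text \<open>Pythagoras, one difference at a time: passing from N to \<open>Suc N\<close> adds
  \<open>(norm (b (Suc N)))\<^sup>2 * (Lp_norm M 2 D)\<^sup>2\<close> for any symbol b, and the
  increments for b = c and b = 1 are compared.\<close>

lemma mult_op_L2_bound_truncated:
  assumes "B \<ge> 0"
    and bound: "\<And>n g. n \<ge> 1 \<Longrightarrow> g \<in> Lp M 2 \<Longrightarrow> \<not> (AE x in M. dcexp M \<A> n g x = 0) \<Longrightarrow> norm (c n) \<le> B"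
    and f: "f \<in> Lp M 2"
  shows "(Lp_norm M 2 (mult_op (\<lambda>k. if k \<le> N then c k else 0) f))\<^sup>2
    \<le> B\<^sup>2 * (Lp_norm M 2 (mult_op (\<lambda>k. if k \<le> N then 1 else 0) f))\<^sup>2"
proof (induction N)
  case 0
  \<comment> \<open>A symbol supported at index 0 gives the zero operator, since the differences
    start at 1.\<close>
  have "mult_op (\<lambda>k. if k \<le> 0 then b k else 0) f = (\<lambda>_. 0)" for b :: "nat \<Rightarrow> complex"
    by (subst mult_op_cong[of _ "\<lambda>_. 0"]) (auto simp: mult_op_const)
  from this[of c] this[of "\<lambda>_. 1"] show ?case by (simp add: Lp_norm_2)
next
  case (Suc N)
  have p: "(1::ennreal) \<le> 2" by simp
  note [measurable] = Lp_measurable[OF f]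
  have fi: "integrable M f" using Lp_subset_L1[OF p f] .
  let ?t = "\<lambda>b k. if k \<le> N then b k else (0::complex)"
  let ?t' = "\<lambda>b k. if k \<le> Suc N then b k else (0::complex)"
  let ?\<delta> = "\<lambda>k. if k = Suc N then 1 else (0::complex)"
  define D where "D = mult_op ?\<delta> f"
  have D: "D \<in> Lp M 2" unfolding D_def by (intro Lp_mult_op f) auto
  have step: "(Lp_norm M 2 (mult_op (?t' b) f))\<^sup>2 =
      (Lp_norm M 2 (mult_op (?t b) f))\<^sup>2 + (norm (b (Suc N)))\<^sup>2 * (Lp_norm M 2 D)\<^sup>2" for b
  proof -
    have u: "mult_op (?t b) f \<in> Lp M 2" by (intro Lp_mult_op f) auto
    have v: "(\<lambda>x. b (Suc N) * D x) \<in> Lp M 2" by (intro Lp_cmult D) auto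
    have "L2_inner M (mult_op (?t b) f) D = 0"
      unfolding D_def by (intro mult_op_orthogonal f) auto
    then have orth: "L2_inner M (mult_op (?t b) f) (\<lambda>x. b (Suc N) * D x) = 0"
      by (simp add: L2_inner_def mult.left_commute)
    have t': "?t' b = (\<lambda>k. 1 * ?t b k + b (Suc N) * ?\<delta> k)"
      by (auto simp: fun_eq_iff le_Suc_eq)
    have "AE x in M. mult_op (?t b) f x + b (Suc N) * D x = mult_op (?t' b) f x"
      unfolding t' using mult_op_lincomb[OF fi bv_indicators(1) bv_indicators(2), of 1 N b "b (Suc N)" "Suc N" "\<lambda>_. 1"]
      by eventually_elim (simp add: D_def)
    from Lp_cong_AE(2)[OF p Lp_add(1)[OF p u v] _ this]
    have "(Lp_norm M 2 (mult_op (?t' b) f))\<^sup>2 = (Lp_norm M 2 (\<lambda>x. mult_op (?t b) f x + b (Suc N) * D x))\<^sup>2"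
      by simp
    also have "\<dots> = (Lp_norm M 2 (mult_op (?t b) f))\<^sup>2 + (Lp_norm M 2 (\<lambda>x. b (Suc N) * D x))\<^sup>2"
      by (rule L2_norm_add_orthogonal[OF u v orth])
    also have "(Lp_norm M 2 (\<lambda>x. b (Suc N) * D x))\<^sup>2 = (norm (b (Suc N)))\<^sup>2 * (Lp_norm M 2 D)\<^sup>2"
      by (simp add: Lp_norm_2 norm_mult power_mult_distrib integral_nonneg_AE)
    finally show ?thesis .
  qed
  \<comment> \<open>If the difference of f vanishes, f yields no bound on \<open>c (Suc N)\<close>,
    but the factor next to it is 0.\<close>
  have "(norm (c (Suc N)))\<^sup>2 * (Lp_norm M 2 D)\<^sup>2 \<le> B\<^sup>2 * (Lp_norm M 2 D)\<^sup>2"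
  proof (cases "AE x in M. dcexp M \<A> (Suc N) f x = 0")
    case True
    then have "AE x in M. D x = 0"
      by (simp add: D_def mult_op_dcexp)
    then have "AE x in M. 0 = D x"
      by (rule AE_symmetric)
    from Lp_cong_AE(2)[OF p Lp_zero(1)[OF p] Lp_measurable[OF D] this] have "Lp_norm M 2 D = 0"
      using Lp_zero(2)[OF p, of M] by simp
    then show ?thesis by simp
  next
    case False
    then show ?thesis
      using bound[OF _ f, of "Suc N"] by (intro mult_right_mono power_mono) auto
  qed
  with Suc.IH show ?case
    using step[of c] step[of "\<lambda>_. 1"] by (simp add: ring_distribs)
qed

text \<open>The truncated estimate bounds \<open>E N ?g\<close> for every N \<ge> 1 by the same
  multiple of the norm of f; as the filtration generates, \<open>E N ?g\<close> tends to
  \<open>?g\<close> and the bound survives the limit.\<close>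

theorem mult_op_L2_bound:
  assumes gen: "sets M = sigma_sets (space M) (\<Union>n\<in>{1..}. sets (\<A> n))"
    and c: "bv c" and B: "B \<ge> 0"
    and bound: "\<And>n g. n \<ge> 1 \<Longrightarrow> g \<in> Lp M 2 \<Longrightarrow> \<not> (AE x in M. dcexp M \<A> n g x = 0) \<Longrightarrow> norm (c n) \<le> B"
    and f: "f \<in> Lp M 2"
  shows "Lp_norm M 2 (mult_op c f) \<le> B * Lp_norm M 2 f"
proof -
  have p: "(1::ennreal) \<le> 2" by simp
  note [measurable] = Lp_measurable[OF f]
  let ?g = "mult_op c f"
  have g: "?g \<in> Lp M 2" by (rule Lp_mult_op[OF p c f])
  have E_le: "Lp_norm M 2 (E N ?g) \<le> B * Lp_norm M 2 f" if N: "N \<ge> 1" for N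
  proof -
    let ?e = "\<lambda>k. if k \<le> N then 1 else (0::complex)"
    \<comment> \<open>\<open>E N\<close> has the symbol \<open>?e\<close>, so applying it to
      \<open>mult_op c f\<close> cuts the symbol off after N.\<close>
    have prod: "(\<lambda>k. ?e k * c k) = (\<lambda>k. if k \<le> N then c k else 0)" by auto
    have "AE x in M. mult_op (\<lambda>k. if k \<le> N then c k else 0) f x = E N ?g x"
      using mult_op_mult_op[OF bv_indicators(1)[of N "\<lambda>_. 1"] c Lp_subset_L1[OF p f]]
      unfolding prod mult_op_cexp[OF N] by (rule AE_symmetric)
    from Lp_cong_AE(2)[OF p Lp_mult_op[OF p bv_indicators(1) f] _ this]
    have "(Lp_norm M 2 (E N ?g))\<^sup>2 = (Lp_norm M 2 (mult_op (\<lambda>k. if k \<le> N then c k else 0) f))\<^sup>2"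
      by simp
    also have "\<dots> \<le> B\<^sup>2 * (Lp_norm M 2 (E N f))\<^sup>2"
      using mult_op_L2_bound_truncated[OF B bound f, where N=N] by (simp only: mult_op_cexp[OF N])
    also have "\<dots> \<le> B\<^sup>2 * (Lp_norm M 2 f)\<^sup>2"
      by (intro mult_left_mono power_mono Lp_cexp p f) auto
    also have "\<dots> = (B * Lp_norm M 2 f)\<^sup>2" by (simp add: power_mult_distrib)
    finally show ?thesis
      by (rule power2_le_imp_le) (use B in simp)
  qed
  have "(\<lambda>N. Lp_norm M 2 (\<lambda>x. ?g x - E N ?g x) + B * Lp_norm M 2 f) \<longlonglongrightarrow> 0 + B * Lp_norm M 2 f"
    using L2_conv_generating[OF gen g] by (intro tendsto_intros) (simp add: L2_conv_def)
  moreover have "Lp_norm M 2 ?g \<le> Lp_norm M 2 (\<lambda>x. ?g x - E N ?g x) + B * Lp_norm M 2 f" if "N \<ge> 1" for N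
    using Lp_add(2)[OF p Lp_diff(1)[OF p g Lp_cexp(1)[OF p g, of N]] Lp_cexp(1)[OF p g, of N]] E_le[OF that]
    by simp
  ultimately show ?thesis
    by (intro LIMSEQ_le_const[of _ "B * Lp_norm M 2 f"]) auto
qed

lemma op_poly_tendsto:
  assumes gen: "sets M = sigma_sets (space M) (\<Union>n\<in>{1..}. sets (\<A> n))"
    and S: "acts_as 2 S (coef c)" and c: "bv c"
    and R: "acts_as 2 R (coef (\<lambda>n. \<phi> (c n)))" and \<phi>: "bv (\<lambda>n. \<phi> (c n))"
    and lim: "uniform_limit (L2_spectrum M S) (\<lambda>n. poly (q n)) \<phi> sequentially"
  shows "Lp_op_tendsto M 2 (\<lambda>n. op_poly (q n) S) R"
  unfolding Lp_op_tendsto_def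
proof (intro conjI allI impI)
  have p: "(1::ennreal) \<le> 2" by simp
  note P = acts_as_op_poly[OF S c] and bP = bv_poly[OF c]
  show "Lp_bounded_op M 2 (op_poly (q n) S)" for n
    by (rule acts_as_bounded_op[OF p P summable_coef[OF bP]])
  show "Lp_bounded_op M 2 R"
    by (rule acts_as_bounded_op[OF p R summable_coef[OF \<phi>]])
  fix e :: real assume "e > 0"
  then obtain N where N: "\<And>n z. n \<ge> N \<Longrightarrow> z \<in> L2_spectrum M S \<Longrightarrow> dist (poly (q n) z) (\<phi> z) < e"
    using uniform_limitD[OF lim] by (force simp: eventually_sequentially)
  have "Lp_norm M 2 (\<lambda>x. op_poly (q n) S f x - R f x) \<le> e * Lp_norm M 2 f"
    if n: "n \<ge> N" and f: "f \<in> Lp M 2" for n f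
  proof -
    let ?d = "\<lambda>k. 1 * poly (q n) (c k) + - 1 * \<phi> (c k)"
    have d: "bv ?d" using bv_diff[OF bP[of "q n"] \<phi>] by simp
    note [measurable] = acts_as_coefD(1)[OF P f] acts_as_coefD(1)[OF R f]
    have "AE x in M. mult_op ?d f x = op_poly (q n) S f x - R f x"
      using mult_op_lincomb[OF Lp_subset_L1[OF p f] bP[of "q n"] \<phi>, of 1 "-1"]
        acts_as_coefD(2)[OF P[of "q n"] f] acts_as_coefD(2)[OF R f]
      by eventually_elim simp
    from Lp_cong_AE(2)[OF p Lp_mult_op[OF p d f] _ this]
    have "Lp_norm M 2 (\<lambda>x. op_poly (q n) S f x - R f x) = Lp_norm M 2 (mult_op ?d f)"
      by simp
    also have "\<dots> \<le> e * Lp_norm M 2 f"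
    proof (rule mult_op_L2_bound[OF gen d _ _ f])
      fix k g assume "k \<ge> 1" "g \<in> Lp M 2" "\<not> (AE x in M. dcexp M \<A> k g x = 0)"
      from eigenvalue_in_spectrum[OF S c this] N[OF n] show "norm (?d k) \<le> e"
        by (auto simp: dist_norm intro: less_imp_le)
    qed (use \<open>e > 0\<close> in simp)
    finally show ?thesis .
  qed
  then show "\<exists>N. \<forall>n\<ge>N. \<forall>f\<in>Lp M 2. Lp_norm M 2 (\<lambda>x. op_poly (q n) S f x - R f x) \<le> e * Lp_norm M 2 f"
    by blast
qed

text \<open>The polynomials that witness R also converge in norm to the operator with symbol
  \<open>\<phi> (c n)\<close>, so R agrees with it whichever witness is taken.\<close>

lemma acts_as_if_fun_calc:
  assumes gen: "sets M = sigma_sets (space M) (\<Union>n\<in>{1..}. sets (\<A> n))"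
    and S: "acts_as 2 S (coef c)" and c: "bv c" and \<phi>: "bv (\<lambda>n. \<phi> (c n))"
    and R: "is_fun_calc M S \<phi> R"
  shows "acts_as 2 R (coef (\<lambda>n. \<phi> (c n)))"
  unfolding acts_as_def
proof (intro ballI conjI)
  fix f assume f: "f \<in> Lp M 2"
  obtain q where q: "uniform_limit (L2_spectrum M S) (\<lambda>n. poly (q n)) \<phi> sequentially"
    "Lp_op_tendsto M 2 (\<lambda>n. op_poly (q n) S) R"
    using R by (auto simp: is_fun_calc_def)
  then have "R f \<in> Lp M 2" using f by (auto simp: Lp_op_tendsto_def Lp_bounded_op_def)
  then show "R f \<in> borel_measurable M" by measurable
  show "AE x in M. R f x = wsum (coef (\<lambda>n. \<phi> (c n))) f x"
    using Lp_op_tendsto_unique[OF one_le_two_ennreal q(2) op_poly_tendsto[OF gen S c acts_as_wsum \<phi> q(1)] f] .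
qed

section \<open>Series in operator norm\<close>

text \<open>\<open>wsum\<close> is the same pointwise series for all p, so a representation on L_1,
  the largest space, restricts to every L_p.\<close>

lemma acts_as_mono:
  assumes S: "acts_as 1 S v" and p: "p \<ge> 1"
  shows "acts_as p S v"
  using S Lp_subset_L1[OF p] by (auto simp: acts_as_def Lp_1_iff)

lemma truncation_tendsto:
  assumes v: "summable (\<lambda>n. norm (v n))"
  shows "(\<lambda>N. \<Sum>n. norm ((if n \<le> N then v n else 0) - v n)) \<longlonglongrightarrow> (0::real)"
    and "summable (\<lambda>n. norm ((if n \<le> N then v n else (0::complex)) - v n))"
proof -
  have *: "norm ((if n \<le> N then v n else 0) - v n) = norm (v n) - (if n \<in> {..N} then norm (v n) else 0)" for n N
    by simp
  have "(\<lambda>n. norm ((if n \<le> N then v n else 0) - v n)) sums ((\<Sum>n. norm (v n)) - (\<Sum>n\<le>N. norm (v n)))" for N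
    unfolding * by (intro sums_diff summable_sums v sums_If_finite_set) simp
  then show "summable (\<lambda>n. norm ((if n \<le> N then v n else 0) - v n))"
    and s: "(\<lambda>N. \<Sum>n. norm ((if n \<le> N then v n else 0) - v n)) \<longlonglongrightarrow> 0"
    using tendsto_diff[OF tendsto_const summable_LIMSEQ'[OF v], of "\<Sum>n. norm (v n)"]
    by (auto simp: sums_iff)
qed

lemma cexp_series_sums:
  assumes p: "p \<ge> 1" and v: "summable (\<lambda>n. norm (v n))" "v 0 = 0" and S: "acts_as p S v"
  shows "Lp_op_sums M p (\<lambda>n f x. v n * E n f x) S"
  unfolding Lp_op_sums_def
proof (rule acts_as_tendsto[OF p _ S _ v(1) truncation_tendsto(1)[OF v(1)]])
  fix N
  have "wsum (\<lambda>n. if n \<le> N then v n else 0) f = (\<lambda>x. \<Sum>n=1..N. v n * E n f x)" for f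
    by (subst wsum_finite[of "{1..N}"]) (auto simp: v(2) not_less_eq_eq lev_pos intro!: sum.cong)
  then show "acts_as p (\<lambda>f x. \<Sum>n=1..N. v n * E n f x) (\<lambda>n. if n \<le> N then v n else 0)"
    using acts_as_wsum[of p "\<lambda>n. if n \<le> N then v n else 0"] by (simp add: acts_as_def)
  show "summable (\<lambda>n. norm (if n \<le> N then v n else 0))"
    by (rule summable_comparison_test'[OF v(1), of 0]) simp
qed

text \<open>\<open>wsum v f\<close> satisfies the property by which \<open>Lp_suminf\<close> is
  chosen, and uniqueness of limits identifies the chosen function with it.\<close>

lemma acts_as_Lp_suminf:
  assumes p: "p \<ge> 1" and v: "summable (\<lambda>n. norm (v n))" "v 0 = 0"
  shows "acts_as p (\<lambda>f. Lp_suminf M p (\<lambda>n x. v n * E n f x)) v"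
  unfolding acts_as_def
proof (intro ballI)
  fix f assume f: "f \<in> Lp M p"
  let ?P = "\<lambda>h. h \<in> Lp M p \<and> (\<forall>n\<ge>1. (\<lambda>x. v n * E n f x) \<in> Lp M p) \<and>
     (\<lambda>N. Lp_norm M p (\<lambda>x. (\<Sum>n=1..N. v n * E n f x) - h x)) \<longlonglongrightarrow> 0"
  have u: "(\<lambda>x. v n * E n f x) \<in> Lp M p" for n
    by (intro Lp_cmult Lp_cexp p f)
  have "?P (wsum v f)"
    using Lp_wsum(2)[OF p f v(1)] u
      Lp_op_tendsto_LIMSEQ[OF cexp_series_sums[OF p v acts_as_wsum, unfolded Lp_op_sums_def] f] by simp
  moreover from this have "?P (Lp_suminf M p (\<lambda>n x. v n * E n f x))"
    unfolding Lp_suminf_def by (rule someI[where P="?P"])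
  moreover have "(\<lambda>x. \<Sum>n=1..N. v n * E n f x) \<in> Lp M p" for N
    by (rule Lp_sum[OF p u])
  ultimately show "Lp_suminf M p (\<lambda>n x. v n * E n f x) \<in> borel_measurable M \<and>
      (AE x in M. Lp_suminf M p (\<lambda>n x. v n * E n f x) x = wsum v f x)"
    using Lp_limit_unique[OF p, of "\<lambda>N x. \<Sum>n=1..N. v n * E n f x" M "Lp_suminf M p (\<lambda>n x. v n * E n f x)" "wsum v f"]
    by (auto intro: Lp_measurable)
qed

text \<open>The N-th partial sum has the symbol c cut off after N. Its coefficients agree with those
  of c below N, vanish beyond N and at N \<ge> 1 are off by the boundary value
  \<open>c (Suc N)\<close>. This value tends to 0, and the remaining error is the tail of an
  absolutely convergent series.\<close>

lemma dcexp_series_sums: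
  assumes c: "bv c" "lim c = 0" and p: "p \<ge> 1" and S: "acts_as p S (coef c)"
  shows "Lp_op_sums M p (\<lambda>n f x. c n * dcexp M \<A> n f x) S"
  unfolding Lp_op_sums_def
proof (rule acts_as_tendsto[OF p _ S _ summable_coef[OF c(1)]])
  let ?d = "\<lambda>N k. if k \<in> {1..N} then c k else 0"
  let ?\<delta> = "\<lambda>n k. if k = n then 1 else (0::complex)"
  have bv_d: "bv (?d N)" for N
    by (rule bv_eventually_const[of "Suc N"]) simp
  have lim_d: "lim (?d N) = 0" for N
    by (rule lim_eventually_const[of "Suc N"]) simp
  show "summable (\<lambda>k. norm (coef (?d N) k))" for N
    by (rule summable_coef[OF bv_d])
  show "acts_as p (\<lambda>f x. \<Sum>n=1..N. c n * dcexp M \<A> n f x) (coef (?d N))" for N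
    unfolding acts_as_def
  proof (intro ballI conjI)
    fix f assume f: "f \<in> Lp M p"
    show "(\<lambda>x. \<Sum>n=1..N. c n * dcexp M \<A> n f x) \<in> borel_measurable M"
      unfolding dcexp_def by measurable
    have "(\<lambda>k. \<Sum>n=1..N. c n * ?\<delta> n k) = ?d N"
      by (auto simp: fun_eq_iff if_distrib sum.delta cong: if_cong)
    moreover have "AE x in M. mult_op (\<lambda>k. \<Sum>n=1..N. c n * ?\<delta> n k) f x = (\<Sum>n=1..N. c n * mult_op (?\<delta> n) f x)"
      by (rule mult_op_sum[OF Lp_subset_L1[OF p f]]) simp
    moreover have "(\<Sum>n=1..N. c n * mult_op (?\<delta> n) f x) = (\<Sum>n=1..N. c n * dcexp M \<A> n f x)" for x
      by (intro sum.cong) (simp_all add: mult_op_dcexp)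
    ultimately have "AE x in M. wsum (coef (?d N)) f x = (\<Sum>n=1..N. c n * dcexp M \<A> n f x)"
      by (simp only: mult_op_def)
    then show "AE x in M. (\<Sum>n=1..N. c n * dcexp M \<A> n f x) = wsum (coef (?d N)) f x"
      by (rule AE_symmetric)
  qed
  define r where "r N k = norm ((if k \<le> N then coef c k else 0) - coef c k)" for N k
  have le: "norm (coef (?d N) k - coef c k) \<le> r N k + (if k = N then norm (c (Suc N)) else 0)" for N k
    using c(2) lim_d[of N] by (cases "k = 0"; cases "k = N"; cases "k < N") (auto simp: coef_def r_def)
  note r = truncation_tendsto[OF summable_coef[OF c(1)], folded r_def]
  have sums: "(\<lambda>k. r N k + (if k = N then norm (c (Suc N)) else 0)) sums ((\<Sum>k. r N k) + norm (c (Suc N)))" for N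
    by (intro sums_add summable_sums r(2) sums_single)
  have "(\<lambda>N. (\<Sum>k. r N k) + norm (c (Suc N))) \<longlonglongrightarrow> 0"
    using bv_LIMSEQ[OF c(1)] by (intro tendsto_add_zero r(1) tendsto_norm_zero LIMSEQ_Suc) (simp add: c(2))
  then show "(\<lambda>N. \<Sum>k. norm (coef (?d N) k - coef c k)) \<longlonglongrightarrow> 0"
  proof (rule Lim_null_comparison[OF always_eventually, rotated], intro allI)
    fix N
    have s: "summable (\<lambda>k. norm (coef (?d N) k - coef c k))"
      by (rule summable_comparison_test'[OF sums_summable[OF sums[of N]], of 0])
        (simp only: real_norm_def abs_norm_cancel le)
    have "(\<Sum>k. norm (coef (?d N) k - coef c k)) \<le> (\<Sum>k. r N k + (if k = N then norm (c (Suc N)) else 0))"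
      by (rule suminf_le[OF le s sums_summable[OF sums]])
    also have "\<dots> = (\<Sum>k. r N k) + norm (c (Suc N))"
      using sums by (simp add: sums_iff)
    finally show "norm (\<Sum>k. norm (coef (?d N) k - coef c k)) \<le> (\<Sum>k. r N k) + norm (c (Suc N))"
      using suminf_nonneg[OF s] by simp
  qed
qed

end

subsection \<open>Powers of the averaging operator\<close>

locale averaged_filtration = filtered_prob_space +
  fixes a :: "nat \<Rightarrow> real"
  assumes gen: "sets M = sigma_sets (space M) (\<Union>n\<in>{1..}. sets (\<A> n))"
    and a_mono: "strict_mono a"
    and a_0: "a 0 = 0"
    and a_lim: "a \<longlonglongrightarrow> 1"
begin

definition symb :: "real \<Rightarrow> nat \<Rightarrow> complex" where
  "symb t n = complex_of_real ((1 - a (n - 1)) powr t)"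

lemma a_bounds: "0 \<le> a n" "a n < 1"
proof -
  show "0 \<le> a n" using a_0 strict_mono_less_eq[OF a_mono, of 0 n] by simp
  have "a n < a (Suc n)" using a_mono by (simp add: strict_mono_Suc_iff)
  also have "a (Suc n) \<le> 1"
    using a_lim strict_mono_mono[OF a_mono] by (intro incseq_le) (simp_all add: mono_def incseq_def)
  finally show "a n < 1" .
qed

lemma powers_LIMSEQ:
  assumes "t > 0"
  shows "(\<lambda>n. (1 - a n) powr t) \<longlonglongrightarrow> 0"
proof -
  have "(\<lambda>n. (1 - a n) powr t) \<longlonglongrightarrow> (1 - 1) powr t"
    using assms a_bounds(2) by (intro tendsto_powr' tendsto_intros a_lim) (auto simp: less_imp_le)
  then show ?thesis by simp
qed

lemma symb_LIMSEQ:
  assumes "t > 0"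
  shows "symb t \<longlonglongrightarrow> 0"
proof -
  have "(\<lambda>n. symb t (Suc n)) \<longlonglongrightarrow> complex_of_real 0"
    unfolding symb_def using powers_LIMSEQ[OF assms] by (intro tendsto_of_real) simp
  then show ?thesis by (simp add: filterlim_sequentially_Suc)
qed

lemma coef_symb:
  assumes "t > 0"
  shows "coef (symb t) n = complex_of_real (pow_weight a t n)"
  using limI[OF symb_LIMSEQ[OF assms]] by (simp add: coef_def pow_weight_def symb_def)

lemma pow_weight_nonneg: "t > 0 \<Longrightarrow> pow_weight a t n \<ge> 0"
  using a_bounds(2)[of n] strict_mono_less_eq[OF a_mono, of "n - 1" n]
  by (auto simp: pow_weight_def intro!: powr_mono2)

lemma pow_weight_sums:
  assumes "t > 0"
  shows "pow_weight a t sums 1"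
proof -
  have "(\<lambda>n. pow_weight a t (Suc n)) sums 1"
    using telescope_sums'[OF powers_LIMSEQ[OF assms]] by (simp add: pow_weight_def a_0)
  from sums_Suc[OF this] show ?thesis by (simp add: pow_weight_def[of _ _ 0])
qed

lemma norm_coef_symb:
  assumes "t > 0"
  shows "(\<lambda>n. norm (coef (symb t) n)) sums 1"
  using pow_weight_sums[OF assms] pow_weight_nonneg[OF assms] by (simp add: coef_symb[OF assms])

lemma bv_symb:
  assumes "t > 0"
  shows "bv (symb t)"
proof -
  \<comment> \<open>At n = 0 both sides are 0: natural subtraction makes \<open>symb t 0\<close>
    equal to \<open>symb t 1\<close>, and \<open>coef\<close> has there the limit 0.\<close>
  have "norm (symb t n - symb t (Suc n)) = norm (coef (symb t) n)" for n
    unfolding coef_symb[OF assms] by (cases n) (simp_all add: symb_def pow_weight_def flip: of_real_diff)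
  then show ?thesis
    using sums_summable[OF norm_coef_symb[OF assms]] by (simp add: bv_def)
qed

lemma symb_mult: "symb t n * symb s n = symb (t + s) n"
  using a_bounds(2)[of "n - 1"] by (simp add: symb_def powr_add)

lemma symb_powr: "symb 1 n powr complex_of_real t = symb t n"
  using a_bounds(2)[of "n - 1"] by (simp add: symb_def powr_of_real del: of_real_diff)

lemma symb_1: "symb 1 n = complex_of_real (1 - a (n - 1))"
  using a_bounds(2)[of "n - 1"] by (simp add: symb_def)

lemma avg_op_acts_as: "acts_as 2 (avg_op M \<A> a) (coef (symb 1))"
proof -
  have "coef (symb 1) = (\<lambda>n. complex_of_real (a n - a (n - 1)))"
    using a_bounds(2) by (auto simp: coef_symb pow_weight_def fun_eq_iff less_imp_le)
  then show ?thesis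
    using acts_as_Lp_suminf[of 2 "coef (symb 1)"] sums_summable[OF norm_coef_symb[of 1]]
    by (simp add: avg_op_def[abs_def])
qed

section \<open>Spectrum and powers of the averaging operator\<close>

text \<open>The interval is closed and contains all symbol values, so a point outside keeps a
  positive distance from them.\<close>

lemma spectrum_avg_op: "L2_spectrum M (avg_op M \<A> a) \<subseteq> of_real ` {0..1}"
proof (rule ccontr)
  assume "\<not> ?thesis"
  then obtain z where z: "z \<in> L2_spectrum M (avg_op M \<A> a)" "z \<notin> of_real ` {0..1}" by blast
  have "closed (complex_of_real ` {0..1})"
    by (intro compact_imp_closed compact_continuous_image continuous_intros) simp
  then obtain \<delta> where \<delta>: "\<delta> > 0" "\<And>x. x \<in> complex_of_real ` {0..1} \<Longrightarrow> \<delta> \<le> dist z x"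
    using separate_point_closed z(2) by metis
  have "norm (symb 1 n - z) \<ge> \<delta>" for n
    using \<delta>(2)[of "symb 1 n"] a_bounds[of "n - 1"] by (simp add: symb_1 dist_norm norm_minus_commute del: of_real_diff)
  then show False
    using not_in_spectrum[OF avg_op_acts_as bv_symb \<delta>(1)] z(1) by simp
qed

text \<open>Supplies the existence behind the choice in \<open>fun_calc\<close>. Continuity and
  polynomial approximation are established on the whole interval and then restricted to the
  spectrum.\<close>

lemma fun_calc_avg_op:
  assumes t: "t > 0"
  shows "is_fun_calc M (avg_op M \<A> a) (\<lambda>z. z powr complex_of_real t) (mult_op (symb t))"
  unfolding is_fun_calc_def
proof (intro conjI)
  let ?\<phi> = "\<lambda>z. z powr complex_of_real t"
  have eq: "complex_of_real (Re z powr t) = ?\<phi> z" if "z \<in> of_real ` {0..1}" for z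
    using that by (auto simp: powr_of_real)
  have "coef (symb 1) n \<in> \<real>" for n
    by (simp add: coef_symb)
  then show "L2_selfadjoint M (avg_op M \<A> a)"
    by (intro acts_as_selfadjoint[OF avg_op_acts_as summable_coef[OF bv_symb]]) simp_all
  \<comment> \<open>Continuity is shown for the real power of \<open>Re z\<close>, which avoids the
    branch cut and the base 0 of the complex power, and then transferred.\<close>
  have "continuous_on (of_real ` {0..1}) (\<lambda>z. complex_of_real (Re z powr t))"
    using t by (intro continuous_on_of_real continuous_on_powr' continuous_intros) auto
  then have "continuous_on (of_real ` {0..1}) ?\<phi>"
    by (rule continuous_on_eq) (rule eq)
  then show "continuous_on (L2_spectrum M (avg_op M \<A> a)) ?\<phi>"
    by (rule continuous_on_subset[OF _ spectrum_avg_op])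
  have "continuous_on {0..1} (\<lambda>x. x powr t)"
    using t by (intro continuous_on_powr' continuous_intros) auto
  from polynomials_dense_unit_interval[OF this] obtain q where
    "uniform_limit (of_real ` {0..1}) (\<lambda>n. poly (q n)) (\<lambda>z. complex_of_real (Re z powr t)) sequentially"
    by blast
  then have "uniform_limit (of_real ` {0..1}) (\<lambda>n. poly (q n)) ?\<phi> sequentially"
    by (rule uniform_limit_cong'[THEN iffD1, rotated 2]) (simp_all add: eq)
  then have "uniform_limit (L2_spectrum M (avg_op M \<A> a)) (\<lambda>n. poly (q n)) ?\<phi> sequentially"
    by (rule uniform_limit_on_subset[OF _ spectrum_avg_op])
  from op_poly_tendsto[OF gen avg_op_acts_as bv_symb _ _ this, of "mult_op (symb t)"]
  have "Lp_op_tendsto M 2 (\<lambda>n. op_poly (q n) (avg_op M \<A> a)) (mult_op (symb t))"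
    using bv_symb[OF t] acts_as_mult_op by (simp add: symb_powr)
  with \<open>uniform_limit (L2_spectrum _ _) _ _ _\<close>
  show "\<exists>q. uniform_limit (L2_spectrum M (avg_op M \<A> a)) (\<lambda>n. poly (q n)) ?\<phi> sequentially \<and>
      Lp_op_tendsto M 2 (\<lambda>n. op_poly (q n) (avg_op M \<A> a)) (mult_op (symb t))"
    by blast
qed

lemma is_fun_calc_avg_pow:
  assumes "t > 0"
  shows "is_fun_calc M (avg_op M \<A> a) (\<lambda>z. z powr complex_of_real t) (avg_pow M \<A> a t)"
  unfolding avg_pow_def fun_calc_def
  by (rule someI[where P="is_fun_calc M (avg_op M \<A> a) (\<lambda>z. z powr complex_of_real t)"])
    (rule fun_calc_avg_op[OF assms])

lemma avg_pow_acts_as: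
  assumes t: "t > 0"
  shows "acts_as 2 (avg_pow M \<A> a t) (coef (symb t))"
  using acts_as_if_fun_calc[OF gen avg_op_acts_as bv_symb _ is_fun_calc_avg_pow[OF t]] bv_symb[OF t]
  by (simp add: symb_powr)

lemma avg_pow_ext_acts_as:
  assumes t: "t > 0" and p: "p \<ge> 1"
  shows "acts_as p (avg_pow_ext M \<A> a t) (coef (symb t))"
proof (rule acts_as_mono[OF _ p])
  have "coef (symb t) = (\<lambda>n. complex_of_real (pow_weight a t n))"
    using coef_symb[OF t] by blast
  then show "acts_as 1 (avg_pow_ext M \<A> a t) (coef (symb t))"
    using acts_as_Lp_suminf[of 1 "coef (symb t)"] sums_summable[OF norm_coef_symb[OF t]]
    by (simp add: avg_pow_ext_def[abs_def] pow_weight_def[of _ _ 0])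
qed

text \<open>Stated for any representative S, so that it applies to T at t = 1, to
  \<open>avg_pow\<close> on L_2 and to \<open>avg_pow_ext\<close> on every L_p.\<close>

lemma acts_as_symb:
  assumes t: "t > 0" and p: "p \<ge> 1" and S: "acts_as p S (coef (symb t))"
  shows "Lp_contraction M p S" "Lp_positivity_preserving M p S"
    and "Lp_op_sums M p (\<lambda>n f x. complex_of_real ((1 - a (n - 1)) powr t - (1 - a n) powr t) * E n f x) S"
    and "Lp_op_sums M p (\<lambda>n f x. complex_of_real ((1 - a (n - 1)) powr t) * dcexp M \<A> n f x) S"
proof -
  note s = norm_coef_symb[OF t]
  note v = sums_summable[OF s]
  show "Lp_contraction M p S"
    using s by (intro acts_as_contraction[OF p S v]) (simp add: sums_iff)
  show "Lp_positivity_preserving M p S"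
    by (intro acts_as_positivity_preserving[OF p S v]) (simp add: coef_symb[OF t] pow_weight_nonneg[OF t])
  have "coef (symb t) 0 = 0" by (simp add: coef_symb[OF t] pow_weight_def)
  from cexp_series_sums[OF p v this S]
  show "Lp_op_sums M p (\<lambda>n f x. complex_of_real ((1 - a (n - 1)) powr t - (1 - a n) powr t) * E n f x) S"
    by (simp only: coef_symb[OF t] pow_weight_def)
  from dcexp_series_sums[OF bv_symb[OF t] limI[OF symb_LIMSEQ[OF t]] p S]
  show "Lp_op_sums M p (\<lambda>n f x. complex_of_real ((1 - a (n - 1)) powr t) * dcexp M \<A> n f x) S"
    by (simp only: symb_def)
qed

lemma avg_pow_ext_one:
  assumes t: "t > 0"
  shows "AE x in M. avg_pow_ext M \<A> a t (\<lambda>_. 1) x = 1"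
proof -
  have "AE x in M. lev n (\<lambda>_. 1) x = 1" for n
    using cexp_const[of n 1] by (simp add: lev_def)
  then have "AE x in M. \<forall>n. lev n (\<lambda>_. 1) x = 1"
    by (simp add: AE_all_countable)
  moreover have "(\<lambda>_. 1) \<in> Lp M 1" by (simp add: Lp_1_iff)
  note acts_asD(2)[OF avg_pow_ext_acts_as[OF t order_refl] this]
  moreover have "(\<Sum>n. coef (symb t) n * 1) = 1"
    using sums_of_real[OF pow_weight_sums[OF t], where 'a=complex] by (simp add: coef_symb[OF t] sums_iff)
  ultimately show ?thesis
    by (auto simp: wsum_def elim!: eventually_elim2)
qed

text \<open>On functions measurable with respect to a fixed \<open>\<A> N\<close> only finitely many symbol values matter,
  and each of them tends to 1 as \<open>t \<rightarrow> 0\<close>.\<close>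

lemma strongly_continuous:
  assumes P: "\<And>t. t > 0 \<Longrightarrow> acts_as 2 (P t) (coef (symb t))" and f: "f \<in> Lp M 2"
  shows "((\<lambda>t. Lp_norm M 2 (\<lambda>x. P t f x - f x)) \<longlongrightarrow> 0) (at_right 0)"
proof (rule tendstoI)
  have p: "(1::ennreal) \<le> 2" by simp
  have fi: "integrable M f" using Lp_subset_L1[OF p f] .
  note [measurable] = Lp_measurable[OF f]
  \<comment> \<open>The symbol of \<open>P t\<close> minus the identity, in the shape of
    \<open>mult_op_lincomb\<close>.\<close>
  define b where "b t n = 1 * symb t n + -1 * 1" for t n
  have b_bv: "bv (b t)" if "t > 0" for t
    using bv_diff[OF bv_symb[OF that] bv_const[of 1]] by (simp add: b_def[abs_def])
  fix e :: real assume "e > 0"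
  \<comment> \<open>The remainder \<open>f - E N f\<close> is amplified by at most 2, the total of
    the coefficients of \<open>b t\<close>, so e / 4 leaves e / 2 for the part in
    \<open>E N f\<close>.\<close>
  obtain N0 where "\<And>n. n \<ge> N0 \<Longrightarrow> Lp_norm M 2 (\<lambda>x. f x - E n f x) < e / 4"
    using L2_conv_generating[OF gen f] order_tendstoD(2)[of _ 0 sequentially "e / 4"] \<open>e > 0\<close>
    by (auto simp: L2_conv_def eventually_sequentially)
  from this[of "Suc N0"] obtain N where N: "N \<ge> 1" "Lp_norm M 2 (\<lambda>x. f x - E N f x) < e / 4"
    by force
  have g: "E N f \<in> Lp M 2" and h: "(\<lambda>x. f x - E N f x) \<in> Lp M 2"
    by (intro Lp_diff Lp_cexp p f)+
  let ?b = "\<lambda>t k. b t k * (if k \<le> N then 1 else 0)"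
  let ?K = "\<lambda>t. \<Sum>n\<in>{1..N}. norm (coef (?b t) n)"
  have b0: "((\<lambda>t. b t k) \<longlongrightarrow> 0) (at_right 0)" for k
  proof -
    \<comment> \<open>The base is positive because \<open>a n < 1\<close>, so its power with
      exponent 0 is 1.\<close>
    have "((\<lambda>t. complex_of_real ((1 - a (k - 1)) powr t)) \<longlongrightarrow> complex_of_real ((1 - a (k - 1)) powr 0)) (at_right 0)"
      using a_bounds(2)[of "k - 1"] by (intro tendsto_intros) auto
    then have "((\<lambda>t. 1 * symb t k + -1 * 1) \<longlongrightarrow> 1 * 1 + -1 * 1) (at_right 0)"
      using a_bounds(2)[of "k - 1"] by (intro tendsto_intros) (simp add: symb_def)
    then show ?thesis by (simp add: b_def[abs_def])
  qed
  have "((\<lambda>t. norm (coef (?b t) n)) \<longlongrightarrow> 0) (at_right 0)" if "n \<in> {1..N}" for n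
  proof -
    have "((\<lambda>t. ?b t n - ?b t (Suc n)) \<longlongrightarrow> 0 * (if n \<le> N then 1 else 0) - 0 * (if Suc n \<le> N then 1 else 0)) (at_right 0)"
      by (intro tendsto_intros b0)
    then show ?thesis
      using that by (intro tendsto_norm_zero) (simp add: coef_def)
  qed
  then have "(?K \<longlongrightarrow> (\<Sum>n\<in>{1..N}. 0)) (at_right 0)"
    by (rule tendsto_sum)
  then have "((\<lambda>t. ?K t * Lp_norm M 2 f) \<longlongrightarrow> 0) (at_right 0)"
    by (intro tendsto_mult_left_zero) simp
  then have "\<forall>\<^sub>F t in at_right 0. ?K t * Lp_norm M 2 f < e / 2"
    using \<open>e > 0\<close> by (intro order_tendstoD) auto
  moreover have "\<forall>\<^sub>F t in at_right (0::real). t > 0"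
    by (simp add: eventually_at_right_less)
  ultimately show "\<forall>\<^sub>F t in at_right 0. dist (Lp_norm M 2 (\<lambda>x. P t f x - f x)) 0 < e"
  proof eventually_elim
    case (elim t)
    then have t: "t > 0" by simp
    note [measurable] = acts_as_coefD(1)[OF P[OF t] f]
    note mb = Lp_mult_op[OF p b_bv[OF t]]
    \<comment> \<open>The coefficients of \<open>symb t\<close> contribute 1; the identity, whose
      coefficient is the limit -1 of \<open>b t\<close>, contributes another 1.\<close>
    have sums: "(\<lambda>n. norm (coef (b t) n)) sums 2"
    proof -
      have "b t \<longlonglongrightarrow> 1 * 0 + -1 * 1"
        unfolding b_def[abs_def] by (intro tendsto_intros symb_LIMSEQ t)
      then have "lim (b t) = -1" by (simp add: limI)
      then have "norm (coef (b t) n) = norm (coef (symb t) n) + (if n = 0 then 1 else 0)" for n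
        using limI[OF symb_LIMSEQ[OF t]] by (simp add: coef_def b_def)
      then show ?thesis
        using sums_add[OF norm_coef_symb[OF t] sums_single[of 0 "\<lambda>_. 1::real"]] by simp
    qed
    have Kh: "Lp_norm M 2 (mult_op (b t) (\<lambda>x. f x - E N f x)) \<le> 2 * Lp_norm M 2 (\<lambda>x. f x - E N f x)"
      using Lp_wsum(3)[OF p h sums_summable[OF sums]] sums by (simp add: mult_op_def sums_iff)
    have bvt: "bv (?b t)"
      by (intro bv_mult b_bv t) simp
    have coef0: "coef (?b t) n = 0" if "n \<notin> {1..N}" for n
      using that lim_eventually_const[of "Suc N" "?b t" 0] by (auto simp: coef_def not_le)
    have "(\<lambda>n. norm (coef (?b t) n)) sums ?K t"
      by (rule sums_finite) (use coef0 in auto)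
    then have Kt: "Lp_norm M 2 (mult_op (?b t) f) \<le> ?K t * Lp_norm M 2 f"
      using Lp_wsum(3)[OF p f summable_coef[OF bvt]] by (simp add: mult_op_def sums_iff)
    have "AE x in M. mult_op (?b t) f x = mult_op (b t) (E N f) x"
      using mult_op_mult_op[OF b_bv[OF t] bv_indicators(1)[of N "\<lambda>_. 1"] fi]
      unfolding mult_op_cexp[OF N(1)] by (rule AE_symmetric)
    from Lp_cong_AE(2)[OF p Lp_mult_op[OF p bvt f] _ this]
    have Kg: "Lp_norm M 2 (mult_op (b t) (E N f)) \<le> ?K t * Lp_norm M 2 f"
      using Kt by simp
    have "AE x in M. mult_op (b t) (\<lambda>y. (f y - E N f y) + E N f y) x
        = mult_op (b t) (\<lambda>x. f x - E N f x) x + mult_op (b t) (E N f) x"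
      unfolding mult_op_def
      by (rule wsum_add[OF Lp_subset_L1[OF p h] Lp_subset_L1[OF p g] summable_coef[OF b_bv[OF t]]])
    moreover have "AE x in M. mult_op (b t) f x = 1 * mult_op (symb t) f x + -1 * mult_op (\<lambda>_. 1) f x"
      unfolding b_def by (rule mult_op_lincomb[OF fi bv_symb[OF t] bv_const])
    ultimately have "AE x in M. mult_op (b t) (\<lambda>x. f x - E N f x) x + mult_op (b t) (E N f) x = P t f x - f x"
      using acts_as_coefD(2)[OF P[OF t] f] by eventually_elim (simp add: mult_op_const)
    from Lp_cong_AE(2)[OF p Lp_add(1)[OF p mb[OF h] mb[OF g]] _ this]
    have "Lp_norm M 2 (\<lambda>x. P t f x - f x)
        \<le> Lp_norm M 2 (mult_op (b t) (\<lambda>x. f x - E N f x)) + Lp_norm M 2 (mult_op (b t) (E N f))"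
      using Lp_add(2)[OF p mb[OF h] mb[OF g]] by simp
    then show ?case
      using Kh Kg N(2) elim by simp
  qed
qed

lemma symmetric_diffusion_semigroup_avg_pow_ext:
  "symmetric_diffusion_semigroup M (avg_pow_ext M \<A> a)"
  unfolding symmetric_diffusion_semigroup_def
proof (intro conjI allI impI ballI)
  let ?P = "avg_pow_ext M \<A> a"
  show "sigma_finite_measure M" by (rule sigma_finite_measure_axioms)
  fix t :: real assume t: "t > 0"
  show "Lp_contraction M p (?P t)" "Lp_positivity_preserving M p (?P t)" if "p \<ge> 1" for p
    using acts_as_symb(1,2)[OF t that avg_pow_ext_acts_as[OF t that]] .
  show "L2_selfadjoint M (?P t)"
    by (intro acts_as_selfadjoint[OF avg_pow_ext_acts_as[OF t] summable_coef[OF bv_symb[OF t]]])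
      (simp_all add: coef_symb[OF t])
  show "AE x in M. ?P t (\<lambda>_. 1) x = 1" by (rule avg_pow_ext_one[OF t])
  fix s :: real and p f assume s: "s > 0" and p: "(1::ennreal) \<le> p" and f: "f \<in> Lp M p"
  note Ps = avg_pow_ext_acts_as[OF s p] and Pt = avg_pow_ext_acts_as[OF t p]
  have Psf: "?P s f \<in> Lp M p"
    by (rule acts_as_Lp(1)[OF p Ps summable_coef[OF bv_symb[OF s]] f])
  have "AE x in M. mult_op (symb t) (?P s f) x = mult_op (symb t) (mult_op (symb s) f) x"
    using f by (intro mult_op_cong_AE acts_as_coefD[OF Ps]) (auto simp: Lp_measurable)
  moreover have "AE x in M. ?P (t + s) f x = mult_op (symb (t + s)) f x"
    by (rule acts_as_coefD(2)[OF avg_pow_ext_acts_as[OF add_pos_pos[OF t s] p] f])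
  ultimately show "AE x in M. ?P t (?P s f) x = ?P (t + s) f x"
    using acts_as_coefD(2)[OF Pt Psf] mult_op_mult_op[OF bv_symb[OF t] bv_symb[OF s] Lp_subset_L1[OF p f]]
    unfolding symb_mult by eventually_elim simp
qed (rule strongly_continuous, simp_all add: avg_pow_ext_acts_as)

end

theorem theorem1p1:
  fixes M :: "'a measure" and \<A> :: "nat \<Rightarrow> 'a measure" and a :: "nat \<Rightarrow> real"
  assumes prob: "prob_space M"
    and sub: "\<And>n. n \<ge> 1 \<Longrightarrow> subalgebra M (\<A> n)"
    and incr: "\<And>n. n \<ge> 1 \<Longrightarrow> sets (\<A> n) \<subseteq> sets (\<A> (Suc n))"
    and gen: "sets M = sigma_sets (space M) (\<Union>n\<in>{1..}. sets (\<A> n))"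
    and a_mono: "strict_mono a"
    and a_0: "a 0 = 0"
    and a_lim: "a \<longlonglongrightarrow> 1"
  defines "T \<equiv> avg_op M \<A> a"
  shows
    "Lp_op_sums M 2 (\<lambda>n f x. complex_of_real (a n - a (n - 1)) * cexp M \<A> n f x) T
     \<and> Lp_contraction M 2 T \<and> L2_selfadjoint M T \<and> L2_nonneg_form M T
     \<and> (\<forall>t>0.
          is_fun_calc M T (\<lambda>z. z powr complex_of_real t) (avg_pow M \<A> a t)
        \<and> Lp_op_sums M 2
            (\<lambda>n f x. complex_of_real ((1 - a (n - 1)) powr t) * dcexp M \<A> n f x)
            (avg_pow M \<A> a t)
        \<and> Lp_op_sums M 2
            (\<lambda>n f x. complex_of_real ((1 - a (n - 1)) powr t - (1 - a n) powr t) * cexp M \<A> n f x)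
            (avg_pow M \<A> a t)
        \<and> (\<forall>f\<in>Lp M 2. AE x in M. avg_pow_ext M \<A> a t f x = avg_pow M \<A> a t f x)
        \<and> (\<forall>p\<ge>1.
             Lp_op_sums M p
               (\<lambda>n f x. complex_of_real ((1 - a (n - 1)) powr t - (1 - a n) powr t) * cexp M \<A> n f x)
               (avg_pow_ext M \<A> a t)
           \<and> Lp_contraction M p (avg_pow_ext M \<A> a t)
           \<and> Lp_positivity_preserving M p (avg_pow_ext M \<A> a t)))
     \<and> symmetric_diffusion_semigroup M (avg_pow_ext M \<A> a)"
proof -
  interpret averaged_filtration M \<A> a
    by (intro averaged_filtration.intro filtered_prob_space.intro filtered_prob_space_axioms.intro
        averaged_filtration_axioms.intro assms)
  have T: "acts_as 2 T (coef (symb 1))" unfolding T_def by (rule avg_op_acts_as)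
  note v1 = summable_coef[OF bv_symb[OF zero_less_one]]
  have "Lp_op_sums M 2 (\<lambda>n f x. complex_of_real (a n - a (n - 1)) * cexp M \<A> n f x) T"
    \<comment> \<open>T is the case t = 1: as \<open>1 - a n\<close> is nonnegative, its first power
      is itself and the weights become \<open>a n - a (n - 1)\<close>.\<close>
    using acts_as_symb(3)[OF zero_less_one one_le_two_ennreal T] a_bounds(2) by (simp add: less_imp_le)
  moreover have "L2_selfadjoint M T"
    by (intro acts_as_selfadjoint[OF T v1]) (simp add: coef_symb)
  moreover have "L2_nonneg_form M T"
    by (intro acts_as_nonneg_form[OF T v1]) (simp add: coef_symb pow_weight_nonneg)
  moreover have "AE x in M. avg_pow_ext M \<A> a t f x = avg_pow M \<A> a t f x" if "t > 0" "f \<in> Lp M 2" for t f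
    using acts_asD(2)[OF avg_pow_ext_acts_as[OF that(1) one_le_two_ennreal] that(2)]
      acts_asD(2)[OF avg_pow_acts_as[OF that(1)] that(2)] by eventually_elim simp
  ultimately show ?thesis
    using acts_as_symb(1)[OF zero_less_one one_le_two_ennreal T]
      is_fun_calc_avg_pow acts_as_symb(3,4)[OF _ one_le_two_ennreal avg_pow_acts_as]
      acts_as_symb(1-3)[OF _ _ avg_pow_ext_acts_as] symmetric_diffusion_semigroup_avg_pow_ext
    by (simp add: T_def)
qed

end
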